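(* Let $k\ge0$, with $k\ge1$ in the case where $\boldsymbol V_h^{\mathrm{div}}$ is built from the Raviart–Thomas element. Let $\theta\in\{0,1,-1\}$, $\gamma\ge0$, let $\zeta=\{\zeta_F\}_{F\in\mathcal F_h}$ be arbitrary non-negative constants, let $c_h\in\{c_h^1,c_h^2\}$, and let $0=t_0<t_1<\dots<t_N=T$, $\tau_n=t_{n+1}-t_n$. Let $\boldsymbol u_h^0\in\boldsymbol V_h^{\mathrm{div}}$ and let $\{(\boldsymbol u_h^{n+1},P_h^{n+\frac12})\}_{n=0}^{N-1}\subset\boldsymbol V_h^{\mathrm{div}}\times Q_h$ satisfy, for all $0\le n\le N-1$, with $\boldsymbol u_h^{n+\frac12}=\tfrac12(\boldsymbol u_h^{n+1}+\boldsymbol u_h^n)$, $$\Big(\tfrac{\boldsymbol u_h^{n+1}-\boldsymbol u_h^n}{\tau_n},\boldsymbol v_h\Big)+c_h\big(\boldsymbol u_h^{n+\frac12};\boldsymbol u_h^{n+\frac12},\boldsymbol v_h\big)-b_h\big(\boldsymbol v_h,P_h^{n+\frac12}\big)+d_h\big(\boldsymbol u_h^{n+\frac12},\boldsymbol v_h\big)=0\quad\forall\boldsymbol v_h\in\boldsymbol V_h^{\mathrm{div}},$$ $$b_h\big(\boldsymbol u_h^{n+\frac12},q_h\big)=0\quad\forall q_h\in Q_h.$$ Assume that there is an inner neighborhood $\Omega^b\subset\Omega$ of $\partial\Omega$ (the intersection of $\Omega$ with an open set containing $\partial\Omega$) such that $\boldsymbol u_h^n=\boldsymbol 0$ in $\Omega^b$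 for all $0\le n\le N$ and $P_h^{n+\frac12}=0$ in $\Omega^b$ for all $0\le n\le N-1$. Then linear and angular momentum are conserved: for all $0\le n\le N-1$, $$\int_\Omega\boldsymbol u_h^{n+1}\cdot\boldsymbol\phi\,d\boldsymbol x=\int_\Omega\boldsymbol u_h^{n}\cdot\boldsymbol\phi\,d\boldsymbol x$$ for every $\boldsymbol\phi=\boldsymbol e_i$, $1\le i\le d$ (linear momentum), and for every $\boldsymbol\phi=\boldsymbol x\times\boldsymbol e_i$, $i=1,2,3$, if $d=3$, respectively $\boldsymbol\phi=(x_2,-x_1)$ if $d=2$ (angular momentum).
   Context: $\boldsymbol e_i$ is the $i$-th standard unit vector. **Mesh.** $\mathcal T_h$ is a conforming shape-regular simplicial mesh of a bounded polyhedral domain $\Omega\subset\mathbb R^d$, $d\in\{2,3\}$; $\mathcal F_h$ is its set of faces, $\mathcal F_h^i$ the interior faces, $\mathcal F_h^\partial$ the boundary faces, $h_F$ the diameter of $F$. Each $F\in\mathcal F_h^i$ carries a fixed unit normal $\boldsymbol n_F$ pointing from one adjacent element $K^+$ to the other, $K^-$; for $F\in\mathcal F_h^\partial$, $\boldsymbol n_F$ is the outward unit normal to $\partial\Omega$. $\boldsymbol n|_F:=\boldsymbol n_F$. For a scalar- or vector-valued piecewise smooth $\phi$: on interior faces $[\![\phi]\!]=\phi|_{K^+}-\phi|_{K^-}$ and $\{\!\{\phi\}\!\}=\frac12(\phi|_{K^+}+\phi|_{K^-})$; on a boundary face of $K$, $[\![\phi]\!]=\{\!\{\phi\}\!\}=\phi|_K$.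 $(\cdot,\cdot)$ is the $L^2(\Omega)$ inner product, $\langle\cdot,\cdot\rangle_F$ the $L^2(F)$ inner product, $\langle\cdot,\cdot\rangle_{\mathcal F_h}=\sum_{F\in\mathcal F_h}\langle\cdot,\cdot\rangle_F$, $\langle\cdot,\cdot\rangle_{\mathcal F_h^i}=\sum_{F\in\mathcal F_h^i}\langle\cdot,\cdot\rangle_F$. $\nabla_h$, $\nabla_h\cdot$ are the elementwise gradient and divergence; $\boldsymbol\beta\cdot\nabla_h\boldsymbol v=(\boldsymbol\beta\cdot\nabla_h)\boldsymbol v$, i.e. $(\boldsymbol\beta\cdot\nabla_h\boldsymbol v)_i=\sum_j\beta_j\partial_jv_i$. **Spaces.** With $\mathcal P_j(K)$ the polynomials of degree at most $j$ on $K$: $Q_h=\{q\in L^2(\Omega):\int_\Omega q=0,\ q|_K\in\mathcal P_k(K)\ \forall K\in\mathcal T_h\}$; $\boldsymbol V_h^{\mathrm{div}}=\{\boldsymbol v\in H(\mathrm{div};\Omega):\boldsymbol v|_K\in\boldsymbol{\mathcal Q}_k(K)\ \forall K\in\mathcal T_h,\ \boldsymbol v\cdot\boldsymbol n|_{\partial\Omega}=0\}$, where either $\boldsymbol{\mathcal Q}_k(K)=[\mathcal P_k(K)]^d+\mathcal P_k(K)\boldsymbol x$ for all $K$ (Raviart–Thomas) or $\boldsymbol{\mathcal Q}_k(K)=[\mathcal P_{k+1}(K)]^d$ for all $K$ (Brezzi–Douglas–Marini). **Forms.** $$b_h(\boldsymbol v,q)=(\nabla_h\cdot\boldsymbol v,q)-\langle[\![\boldsymbol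 v]\!]\cdot\boldsymbol n,\{\!\{q\}\!\}\rangle_{\mathcal F_h},$$ $$d_h(\boldsymbol u,\boldsymbol v)=\gamma\Big(\sum_{F\in\mathcal F_h}h_F^{-1}\langle[\![\boldsymbol u]\!]\cdot\boldsymbol n_F,[\![\boldsymbol v]\!]\cdot\boldsymbol n_F\rangle_F+(\nabla_h\cdot\boldsymbol u,\nabla_h\cdot\boldsymbol v)\Big),$$ $$\begin{aligned}c_h^1(\boldsymbol u;\boldsymbol u,\boldsymbol v)=&(\boldsymbol u\cdot\nabla_h\boldsymbol u,\boldsymbol v)+\tfrac12((\nabla_h\cdot\boldsymbol u)\boldsymbol u,\boldsymbol v)-\langle(\{\!\{\boldsymbol u\}\!\}\cdot\boldsymbol n)[\![\boldsymbol u]\!],\{\!\{\boldsymbol v\}\!\}\rangle_{\mathcal F_h^i}-\tfrac12\langle[\![\boldsymbol u]\!]\cdot\boldsymbol n,\{\!\{\boldsymbol u\cdot\boldsymbol v\}\!\}\rangle_{\mathcal F_h^i}\\&+\langle\zeta|\{\!\{\boldsymbol u\}\!\}\cdot\boldsymbol n|[\![\boldsymbol u]\!],[\![\boldsymbol v]\!]\rangle_{\mathcal F_h}+\theta\langle(\{\!\{\boldsymbol v\}\!\}\cdot\boldsymbol n)[\![\boldsymbol u]\!],\{\!\{\boldsymbol u\}\!\}\rangle_{\mathcal F_h^i}+\tfrac\theta2\langle[\![\boldsymbol v]\!]\cdot\boldsymbol n,\{\!\{\boldsymbol u\cdot\boldsymbol u\}\!\}\rangle_{\mathcal F_h^i}\\&-\theta(\boldsymbol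 v\cdot\nabla_h\boldsymbol u,\boldsymbol u)-\tfrac\theta2((\nabla_h\cdot\boldsymbol v)\boldsymbol u,\boldsymbol u),\end{aligned}$$ $$\begin{aligned}c_h^2(\boldsymbol u;\boldsymbol u,\boldsymbol v)=&(\boldsymbol u\cdot\nabla_h\boldsymbol u,\boldsymbol v)+\tfrac{1-\theta}2((\nabla_h\cdot\boldsymbol u)\boldsymbol u,\boldsymbol v)-\langle(\{\!\{\boldsymbol u\}\!\}\cdot\boldsymbol n)[\![\boldsymbol u]\!],\{\!\{\boldsymbol v\}\!\}\rangle_{\mathcal F_h^i}-\tfrac{1-\theta}2\langle[\![\boldsymbol u]\!]\cdot\boldsymbol n,\{\!\{\boldsymbol u\cdot\boldsymbol v\}\!\}\rangle_{\mathcal F_h^i}\\&+\langle\zeta|\{\!\{\boldsymbol u\}\!\}\cdot\boldsymbol n|[\![\boldsymbol u]\!],[\![\boldsymbol v]\!]\rangle_{\mathcal F_h}+\theta\langle(\{\!\{\boldsymbol v\}\!\}\cdot\boldsymbol n)[\![\boldsymbol u]\!],\{\!\{\boldsymbol u\}\!\}\rangle_{\mathcal F_h^i}-\theta(\boldsymbol v\cdot\nabla_h\boldsymbol u,\boldsymbol u).\end{aligned}$$ Here $\zeta|_F=\zeta_F$. *)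

theory Defs
  imports "HOL-Analysis.Analysis"
begin

definition polys :: "nat \<Rightarrow> (real^'d \<Rightarrow> real) set" where
  "polys j = {p. \<exists>c. \<forall>x. p x =
     (\<Sum>\<alpha> | (\<Sum>i\<in>UNIV. \<alpha> i) \<le> j. c \<alpha> * (\<Prod>i\<in>UNIV. x $ i ^ \<alpha> i))}"

datatype hdiv_element = RT | BDM

fun local_space :: "hdiv_element \<Rightarrow> nat \<Rightarrow> (real^'d \<Rightarrow> real^'d) set" where
  "local_space RT k = {v. \<exists>p q. (\<forall>i. (\<lambda>x. p x $ i) \<in> polys k) \<and> q \<in> polys k \<and>
                              (\<forall>x. v x = p x + q x *\<^sub>R x)}"
| "local_space BDM k = {v. \<forall>i. (\<lambda>x. v x $ i) \<in> polys (k + 1)}"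

definition partial :: "'d \<Rightarrow> (real^'d \<Rightarrow> 'b::real_normed_vector) \<Rightarrow> real^'d \<Rightarrow> 'b" where
  "partial j f x = frechet_derivative f (at x) (axis j 1)"

primrec Ck :: "nat \<Rightarrow> (real^'d \<Rightarrow> real) \<Rightarrow> bool" where
  "Ck 0 f \<longleftrightarrow> continuous_on UNIV f"
| "Ck (Suc m) f \<longleftrightarrow> (\<forall>x. f differentiable (at x)) \<and> (\<forall>j. Ck m (partial j f))"

definition test_functions :: "(real^'d) set \<Rightarrow> (real^'d \<Rightarrow> real) set" where
  "test_functions \<Omega> = {\<psi>. (\<forall>m. Ck m \<psi>) \<and> compact (closure {x. \<psi> x \<noteq> 0}) \<and>
                          closure {x. \<psi> x \<noteq> 0} \<subseteq> \<Omega>}"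

definition L2 :: "(real^'d) set \<Rightarrow> (real^'d \<Rightarrow> 'b::euclidean_space) set" where
  "L2 \<Omega> = {f. set_borel_measurable lebesgue \<Omega> f \<and> set_integrable lebesgue \<Omega> (\<lambda>x. (norm (f x))\<^sup>2)}"

definition L2_inner ::
    "(real^'d) set \<Rightarrow> (real^'d \<Rightarrow> 'b::euclidean_space) \<Rightarrow> (real^'d \<Rightarrow> 'b) \<Rightarrow> real" where
  "L2_inner \<Omega> f g = (LINT x:\<Omega>|lebesgue. f x \<bullet> g x)"

definition Hdiv :: "(real^'d) set \<Rightarrow> (real^'d \<Rightarrow> real^'d) set" where
  "Hdiv \<Omega> = {v. v \<in> L2 \<Omega> \<and>
     (\<exists>g \<in> L2 \<Omega>. \<forall>\<psi> \<in> test_functions \<Omega>.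
        L2_inner \<Omega> v (\<lambda>x. \<chi> j. partial j \<psi> x) = - L2_inner \<Omega> g \<psi>)}"

definition outward_normal :: "(real^'d) set \<Rightarrow> (real^'d) set \<Rightarrow> real^'d \<Rightarrow> bool" where
  "outward_normal K F \<nu> \<longleftrightarrow> norm \<nu> = 1 \<and> (\<forall>x\<in>K. \<forall>y\<in>F. \<nu> \<bullet> (x - y) \<le> 0)"

text \<open>The fields \<open>Kplus\<close> and \<open>Kminus\<close> assign to an interior face its two elements. On a boundary
  face \<open>Kplus\<close> is the only adjacent element and \<open>Kminus\<close> is unused.\<close>

record ('d::finite) dg_mesh =
  region :: "(real^'d) set"
  cells :: "(real^'d) set set"
  nrml :: "(real^'d) set \<Rightarrow> real^'d"
  Kplus :: "(real^'d) set \<Rightarrow> (real^'d) set"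
  Kminus :: "(real^'d) set \<Rightarrow> (real^'d) set"

definition faces :: "'d::finite dg_mesh \<Rightarrow> (real^'d) set set" where
  "faces M = {F. \<exists>K\<in>cells M. F facet_of K}"

definition interior_faces :: "'d::finite dg_mesh \<Rightarrow> (real^'d) set set" where
  "interior_faces M = {F. \<exists>K\<in>cells M. \<exists>K'\<in>cells M. K \<noteq> K' \<and> F facet_of K \<and> F facet_of K'}"

definition boundary_faces :: "'d::finite dg_mesh \<Rightarrow> (real^'d) set set" where
  "boundary_faces M = faces M - interior_faces M"

text \<open>Requiring \<open>interior (closure \<Omega>) = \<Omega>\<close> excludes slits, so that a face shared by two
  elements never lies on the boundary of the domain.\<close>

definition polyhedral_domain :: "(real^'d) set \<Rightarrow> bool" where
  "polyhedral_domain \<Omega> \<longleftrightarrow> open \<Omega> \<and> connected \<Omega> \<and> bounded \<Omega> \<and> \<Omega> \<noteq> {} \<and>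
     interior (closure \<Omega>) = \<Omega> \<and>
     (\<exists>\<P>. finite \<P> \<and> (\<forall>P\<in>\<P>. polytope P) \<and> closure \<Omega> = \<Union>\<P>)"

definition shape_regular :: "real \<Rightarrow> (real^'d) set set \<Rightarrow> bool" where
  "shape_regular \<sigma> \<T> \<longleftrightarrow> (\<forall>K\<in>\<T>. \<exists>a r. 0 < r \<and> cball a r \<subseteq> K \<and> diameter K \<le> \<sigma> * r)"

text \<open>Conformity of the mesh (two elements meet in a common face) is part of
  \<^const>\<open>triangulation\<close>.\<close>

definition valid_mesh :: "real \<Rightarrow> 'd::finite dg_mesh \<Rightarrow> bool" where
  "valid_mesh \<sigma> M \<longleftrightarrow>
     polyhedral_domain (region M) \<and>
     triangulation (cells M) \<and> (\<forall>K\<in>cells M. int CARD('d) simplex K) \<and>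
     \<Union>(cells M) = closure (region M) \<and> shape_regular \<sigma> (cells M) \<and>
     (\<forall>F\<in>faces M. Kplus M F \<in> cells M \<and> F facet_of Kplus M F \<and>
                   outward_normal (Kplus M F) F (nrml M F)) \<and>
     (\<forall>F\<in>interior_faces M. Kminus M F \<in> cells M \<and> F facet_of Kminus M F \<and>
                   outward_normal (Kminus M F) F (- nrml M F))"

text \<open>Piecewise polynomials are represented by total functions that agree with a polynomial on the
  interior of each element; their values on the faces are irrelevant. The restriction to the closed
  element \<open>K\<close>, evaluated at a point of a face, is the limit from the interior of \<open>K\<close>.\<close>

definition elem_trace :: "(real^'d) set \<Rightarrow> (real^'d \<Rightarrow> 'b::real_normed_vector) \<Rightarrow> real^'d \<Rightarrow> 'b" where
  "elem_trace K f x = Lim (at x within interior K) f"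

definition jump :: "'d::finite dg_mesh \<Rightarrow> (real^'d) set \<Rightarrow>
    (real^'d \<Rightarrow> 'b::real_normed_vector) \<Rightarrow> real^'d \<Rightarrow> 'b" where
  "jump M F f x = (if F \<in> interior_faces M then elem_trace (Kplus M F) f x - elem_trace (Kminus M F) f x
                   else elem_trace (Kplus M F) f x)"

definition avg :: "'d::finite dg_mesh \<Rightarrow> (real^'d) set \<Rightarrow>
    (real^'d \<Rightarrow> 'b::real_normed_vector) \<Rightarrow> real^'d \<Rightarrow> 'b" where
  "avg M F f x = (if F \<in> interior_faces M
                  then (1/2) *\<^sub>R (elem_trace (Kplus M F) f x + elem_trace (Kminus M F) f x)
                  else elem_trace (Kplus M F) f x)"

text \<open>Integration over a subset \<open>F\<close> of a hyperplane with unit normal \<open>\<nu>\<close> with respect to the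
  \<open>(d-1)\<close>-dimensional Lebesgue measure of the hyperplane. By Fubini, this is the \<open>d\<close>-dimensional
  integral, over the prism with base \<open>F\<close> and height one in direction \<open>\<nu>\<close>, of the integrand extended
  constantly along \<open>\<nu>\<close>.\<close>

definition face_integral :: "real^'d \<Rightarrow> (real^'d) set \<Rightarrow> (real^'d \<Rightarrow> real) \<Rightarrow> real" where
  "face_integral \<nu> F f = (LINT z:{x + s *\<^sub>R \<nu> | x s. x \<in> F \<and> 0 \<le> s \<and> s \<le> 1}|lebesgue.
                             f (closest_point (affine hull F) z))"

definition face_inner :: "'d::finite dg_mesh \<Rightarrow> (real^'d) set \<Rightarrow>
    (real^'d \<Rightarrow> 'b::real_inner) \<Rightarrow> (real^'d \<Rightarrow> 'b) \<Rightarrow> real" where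
  "face_inner M F f g = face_integral (nrml M F) F (\<lambda>x. f x \<bullet> g x)"

definition Vdiv :: "'d::finite dg_mesh \<Rightarrow> hdiv_element \<Rightarrow> nat \<Rightarrow> (real^'d \<Rightarrow> real^'d) set" where
  "Vdiv M elt k = {v. v \<in> Hdiv (region M) \<and>
     (\<forall>K\<in>cells M. \<exists>w\<in>local_space elt k. \<forall>x\<in>interior K. v x = w x) \<and>
     (\<forall>F\<in>boundary_faces M. \<forall>x\<in>F. elem_trace (Kplus M F) v x \<bullet> nrml M F = 0)}"

definition Qh :: "'d::finite dg_mesh \<Rightarrow> nat \<Rightarrow> (real^'d \<Rightarrow> real) set" where
  "Qh M k = {q. q \<in> L2 (region M) \<and> (LINT x:region M|lebesgue. q x) = 0 \<and>
     (\<forall>K\<in>cells M. \<exists>p\<in>polys k. \<forall>x\<in>interior K. q x = p x)}"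

text \<open>For piecewise polynomials the pointwise derivatives exist in the interior of each element,
  hence almost everywhere, and there they are the elementwise ones.\<close>

definition divh :: "(real^'d \<Rightarrow> real^'d) \<Rightarrow> real^'d \<Rightarrow> real" where
  "divh v x = (\<Sum>j\<in>UNIV. partial j v x $ j)"

definition conv :: "(real^'d \<Rightarrow> real^'d) \<Rightarrow> (real^'d \<Rightarrow> real^'d) \<Rightarrow> real^'d \<Rightarrow> real^'d" where
  "conv \<beta> v x = (\<chi> i. \<Sum>j\<in>UNIV. \<beta> x $ j * partial j v x $ i)"

definition bh :: "'d::finite dg_mesh \<Rightarrow> (real^'d \<Rightarrow> real^'d) \<Rightarrow> (real^'d \<Rightarrow> real) \<Rightarrow> real" where
  "bh M v q = L2_inner (region M) (divh v) q
     - (\<Sum>F\<in>faces M. face_inner M F (\<lambda>x. jump M F v x \<bullet> nrml M F) (avg M F q))"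

definition dh :: "'d::finite dg_mesh \<Rightarrow> real \<Rightarrow>
    (real^'d \<Rightarrow> real^'d) \<Rightarrow> (real^'d \<Rightarrow> real^'d) \<Rightarrow> real" where
  "dh M \<gamma> u v = \<gamma> *
     ((\<Sum>F\<in>faces M. inverse (diameter F) *
          face_inner M F (\<lambda>x. jump M F u x \<bullet> nrml M F) (\<lambda>x. jump M F v x \<bullet> nrml M F))
      + L2_inner (region M) (divh u) (divh v))"

text \<open>\<open>ch1 M \<theta> \<zeta> u v\<close> and \<open>ch2 M \<theta> \<zeta> u v\<close> are the convective forms with equal first two
  arguments \<open>u\<close>.\<close>

definition ch1 :: "'d::finite dg_mesh \<Rightarrow> real \<Rightarrow> ((real^'d) set \<Rightarrow> real) \<Rightarrow>
    (real^'d \<Rightarrow> real^'d) \<Rightarrow> (real^'d \<Rightarrow> real^'d) \<Rightarrow> real" where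
  "ch1 M \<theta> \<zeta> u v =
     L2_inner (region M) (conv u u) v
     + 1/2 * L2_inner (region M) (\<lambda>x. divh u x *\<^sub>R u x) v
     - (\<Sum>F\<in>interior_faces M.
          face_inner M F (\<lambda>x. (avg M F u x \<bullet> nrml M F) *\<^sub>R jump M F u x) (avg M F v))
     - 1/2 * (\<Sum>F\<in>interior_faces M.
          face_inner M F (\<lambda>x. jump M F u x \<bullet> nrml M F) (avg M F (\<lambda>x. u x \<bullet> v x)))
     + (\<Sum>F\<in>faces M.
          face_inner M F (\<lambda>x. (\<zeta> F * \<bar>avg M F u x \<bullet> nrml M F\<bar>) *\<^sub>R jump M F u x) (jump M F v))
     + \<theta> * (\<Sum>F\<in>interior_faces M.
          face_inner M F (\<lambda>x. (avg M F v x \<bullet> nrml M F) *\<^sub>R jump M F u x) (avg M F u))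
     + \<theta>/2 * (\<Sum>F\<in>interior_faces M.
          face_inner M F (\<lambda>x. jump M F v x \<bullet> nrml M F) (avg M F (\<lambda>x. u x \<bullet> u x)))
     - \<theta> * L2_inner (region M) (conv v u) u
     - \<theta>/2 * L2_inner (region M) (\<lambda>x. divh v x *\<^sub>R u x) u"

definition ch2 :: "'d::finite dg_mesh \<Rightarrow> real \<Rightarrow> ((real^'d) set \<Rightarrow> real) \<Rightarrow>
    (real^'d \<Rightarrow> real^'d) \<Rightarrow> (real^'d \<Rightarrow> real^'d) \<Rightarrow> real" where
  "ch2 M \<theta> \<zeta> u v =
     L2_inner (region M) (conv u u) v
     + (1 - \<theta>)/2 * L2_inner (region M) (\<lambda>x. divh u x *\<^sub>R u x) v
     - (\<Sum>F\<in>interior_faces M.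
          face_inner M F (\<lambda>x. (avg M F u x \<bullet> nrml M F) *\<^sub>R jump M F u x) (avg M F v))
     - (1 - \<theta>)/2 * (\<Sum>F\<in>interior_faces M.
          face_inner M F (\<lambda>x. jump M F u x \<bullet> nrml M F) (avg M F (\<lambda>x. u x \<bullet> v x)))
     + (\<Sum>F\<in>faces M.
          face_inner M F (\<lambda>x. (\<zeta> F * \<bar>avg M F u x \<bullet> nrml M F\<bar>) *\<^sub>R jump M F u x) (jump M F v))
     + \<theta> * (\<Sum>F\<in>interior_faces M.
          face_inner M F (\<lambda>x. (avg M F v x \<bullet> nrml M F) *\<^sub>R jump M F u x) (avg M F u))
     - \<theta> * L2_inner (region M) (conv v u) u"

definition midpoint_step :: "(nat \<Rightarrow> real^'d \<Rightarrow> real^'d) \<Rightarrow> nat \<Rightarrow> real^'d \<Rightarrow> real^'d" where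
  "midpoint_step u n x = (1/2) *\<^sub>R (u (Suc n) x + u n x)"

text \<open>\<open>P n\<close> is the pressure at the half step \<open>n + 1/2\<close>.\<close>

definition solves_scheme :: "'d::finite dg_mesh \<Rightarrow> hdiv_element \<Rightarrow> nat \<Rightarrow> real \<Rightarrow>
    ((real^'d \<Rightarrow> real^'d) \<Rightarrow> (real^'d \<Rightarrow> real^'d) \<Rightarrow> real) \<Rightarrow> (nat \<Rightarrow> real) \<Rightarrow> nat \<Rightarrow>
    (nat \<Rightarrow> real^'d \<Rightarrow> real^'d) \<Rightarrow> (nat \<Rightarrow> real^'d \<Rightarrow> real) \<Rightarrow> bool" where
  "solves_scheme M elt k \<gamma> c t N u P \<longleftrightarrow>
     (\<forall>n\<le>N. u n \<in> Vdiv M elt k) \<and> (\<forall>n<N. P n \<in> Qh M k) \<and>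
     (\<forall>n<N.
        (\<forall>v\<in>Vdiv M elt k.
           L2_inner (region M) (\<lambda>x. (1 / (t (Suc n) - t n)) *\<^sub>R (u (Suc n) x - u n x)) v
           + c (midpoint_step u n) v - bh M v (P n) + dh M \<gamma> (midpoint_step u n) v = 0) \<and>
        (\<forall>q\<in>Qh M k. bh M (midpoint_step u n) q = 0))"

definition inner_neighborhood :: "(real^'d) set \<Rightarrow> (real^'d) set \<Rightarrow> bool" where
  "inner_neighborhood \<Omega> \<Omega>b \<longleftrightarrow> (\<exists>U. open U \<and> frontier \<Omega> \<subseteq> U \<and> \<Omega>b = \<Omega> \<inter> U)"

definition vanishes_in :: "(real^'d) set \<Rightarrow> (real^'d \<Rightarrow> 'b::zero) \<Rightarrow> bool" where
  "vanishes_in A f \<longleftrightarrow> (AE x in lebesgue. x \<in> A \<longrightarrow> f x = 0)"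

end

theory Submission
  imports Defs
begin

text \<open>
  The fields \<open>e\<^sub>i\<close>, \<open>x \<times> e\<^sub>i\<close> and \<open>(x\<^sub>2, - x\<^sub>1)\<close> are rigid motions \<open>\<phi> x = b + A x\<close> with a
  skew-symmetric linear map \<open>A\<close>. Momentum would be conserved if the discrete momentum equation could
  be tested with \<open>\<phi>\<close>, but \<open>\<phi>\<close> violates the condition on the normal component at the boundary. The
  remedy is local. Velocity and pressure are polynomials in each cell and vanish near the boundary, so
  they vanish identically in every cell with a boundary face (\<open>vanishing_near_boundary\<close>). The values
  of the test field in these cells do not matter, as long as its normal component stays continuous.
  On a simplex there is an affine field whose normal component agrees with that of \<open>\<phi>\<close> on some facets
  and is zero on the others; this gives a test field \<open>v\<close> in the discrete space that equals \<open>\<phi>\<close> in all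
  other cells (\<open>conforming_test_field\<close>).

  Let \<open>w\<close> be the velocity at the midpoint of the time step. Its normal component is continuous across
  the faces (\<open>normal_continuous_Vdiv\<close>), and the discrete constraint makes it exactly divergence free in
  each cell (\<open>pointwise_divergence_free\<close>). Therefore the grad-div term and all terms with a normal jump
  of \<open>w\<close> or \<open>v\<close> vanish, and so does the pressure term, since \<open>div v = div \<phi> = 0\<close> wherever the
  pressure is not zero. The convective forms reduce to two pairs of a volume term and a sum over
  interior faces. In each cell
  \<open>div ((w \<bullet> \<phi>) w) = ((w \<bullet> \<nabla>) w) \<bullet> \<phi>\<close> because \<open>w \<bullet> A w = 0\<close>, and
  \<open>div (\<bar>w\<bar>\<^sup>2 \<phi>) = 2 ((\<phi> \<bullet> \<nabla>) w) \<bullet> w\<close> because the trace of \<open>A\<close> is zero. By the divergence theorem on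
  each cell the two volume terms are exactly the two sums over faces (\<open>convection_consistent\<close>,
  \<open>transport_consistent\<close>). So both forms vanish, and only the time difference remains
  (\<open>momentum_step\<close>).

  Two analytic facts carry this argument. The divergence theorem on a simplex, with face integrals
  defined as integrals over prisms, is obtained by cutting a function off near the boundary, using
  that derivatives of compactly supported Lipschitz functions have integral zero, and rescaling the
  boundary layers (\<open>divergence_theorem_halfspaces\<close>). The continuity of the normal component of a
  piecewise polynomial field with a square integrable weak divergence is obtained by testing with
  smooth bumps that are squeezed onto a face (\<open>Hdiv_normal_jump\<close>).
\<close>

section \<open>The divergence theorem on an intersection of half-spaces\<close>

text \<open>Lebesgue measure is translation invariant, so every difference quotient of \<open>h\<close> in the
  direction \<open>e\<close> has integral zero, and the Lipschitz bound along \<open>e\<close> lets these quotients pass to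
  the limit. The derivative is asked for almost everywhere, which admits the kinks of a piecewise
  linear cut-off function.\<close>

lemma integral_directional_derivative_eq_0:
  fixes h D :: "'a::euclidean_space \<Rightarrow> real"
  assumes h: "integrable lborel h" and D[measurable]: "D \<in> borel_measurable lborel"
    and bound: "\<And>x t. 0 \<le> t \<Longrightarrow> t \<le> 1 \<Longrightarrow> \<bar>h (x + t *\<^sub>R e) - h x\<bar> \<le> L * t"
    and supp: "\<And>x. norm x > R \<Longrightarrow> h x = 0"
    and deriv: "AE x in lborel. ((\<lambda>t. h (x + t *\<^sub>R e)) has_real_derivative D x) (at 0)"
  shows "integrable lborel D" "(\<integral>x. D x \<partial>lborel) = 0"
proof -
  define q where "q n x = (h (x + inverse (real (Suc n)) *\<^sub>R e) - h x) * real (Suc n)" for n x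
  define w where "w x = indicat_real (cball 0 (R + norm e)) x *\<^sub>R L" for x :: 'a
  have hm[measurable]: "h \<in> borel_measurable lborel"
    using h by auto
  have shift: "integrable lborel (\<lambda>x. h (x + b))" "(\<integral>x. h (x + b) \<partial>lborel) = (\<integral>x. h x \<partial>lborel)" for b
  proof -
    have "integrable (distr lborel borel ((+) b)) h"
      using h by (simp add: lborel_distr_plus)
    then show "integrable lborel (\<lambda>x. h (x + b))"
      by (subst (asm) integrable_distr_eq) (auto simp: add.commute)
    have "(\<integral>x. h x \<partial>lborel) = (\<integral>x. h x \<partial>distr lborel borel ((+) b))"
      by (simp add: lborel_distr_plus)
    also have "\<dots> = (\<integral>x. h (x + b) \<partial>lborel)"
      by (subst integral_distr) (auto simp: add.commute)
    finally show "(\<integral>x. h (x + b) \<partial>lborel) = (\<integral>x. h x \<partial>lborel)" ..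
  qed
  have q0: "(\<integral>x. q n x \<partial>lborel) = 0" for n
    unfolding q_def using shift h by simp
  have qm: "q n \<in> borel_measurable lborel" for n
    unfolding q_def by measurable
  have wint: "integrable lborel w"
    unfolding w_def by (intro integrable_scaleR_left integrable_real_indicator)
      (auto simp: emeasure_lborel_cball_finite[unfolded infinity_ennreal_def])
  have L0: "L \<ge> 0"
    using bound[of 1 0] by auto
  have qw: "norm (q n x) \<le> w x" for n x
  proof (cases "norm x \<le> R + norm e")
    case True
    have "inverse (real (Suc n)) \<le> 1"
      by (simp add: field_simps)
    then have "\<bar>h (x + inverse (real (Suc n)) *\<^sub>R e) - h x\<bar> \<le> L * inverse (real (Suc n))"
      by (intro bound) auto
    then have "\<bar>h (x + inverse (real (Suc n)) *\<^sub>R e) - h x\<bar> * real (Suc n) \<le> L * inverse (real (Suc n)) * real (Suc n)"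
      by (intro mult_right_mono) auto
    then have "norm (q n x) \<le> L"
      unfolding q_def by (simp add: abs_mult mult.assoc del: of_nat_Suc)
    with True show ?thesis
      by (simp add: w_def)
  next
    case False
    have s: "norm (inverse (real (Suc n)) *\<^sub>R e) \<le> norm e"
      using mult_right_mono[of "inverse (real (Suc n))" 1 "norm e"] by (simp add: divide_simps)
    have "norm (x + inverse (real (Suc n)) *\<^sub>R e) > R" "norm x > R"
      using False s norm_diff_ineq[of x "inverse (real (Suc n)) *\<^sub>R e"] norm_ge_zero[of e] by linarith+
    then show ?thesis
      using supp L0 by (simp add: q_def w_def)
  qed
  have lim: "AE x in lborel. (\<lambda>n. q n x) \<longlonglongrightarrow> D x"
    using deriv
  proof eventually_elim
    case (elim x)
    have "filterlim (\<lambda>n. inverse (real (Suc n))) (at 0) sequentially"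
      by (rule filterlim_atI) (use LIMSEQ_inverse_real_of_nat in auto)
    from filterlim_compose[OF elim[unfolded DERIV_def] this]
    show ?case
      by (simp add: q_def divide_inverse del: of_nat_Suc)
  qed
  show "integrable lborel D"
    by (rule integrable_dominated_convergence[OF D qm wint lim]) (use qw in auto)
  have "(\<lambda>n. \<integral>x. q n x \<partial>lborel) \<longlonglongrightarrow> (\<integral>x. D x \<partial>lborel)"
    by (rule integral_dominated_convergence[OF D qm wint lim]) (use qw in auto)
  then show "(\<integral>x. D x \<partial>lborel) = 0"
    by (simp add: q0 LIMSEQ_const_iff)
qed

lemma integral_linear_change_of_variables_lborel:
  fixes L :: "real^'d::{finite,wellorder} \<Rightarrow> real^'d::_" and f :: "real^'d::_ \<Rightarrow> real"
  assumes "linear L" "integrable lborel f" "det (matrix L) \<noteq> 0"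
  shows "(\<integral>x. f x \<partial>lborel) = \<bar>det (matrix L)\<bar> * (\<integral>x. f (L x) \<partial>lborel)"
proof -
  have im: "L ` UNIV = UNIV"
    using assms by (simp add: det_nz_iff_inj linear_injective_imp_surjective)
  have Lm[measurable]: "L \<in> borel_measurable borel"
    by (intro borel_measurable_continuous_onI linear_continuous_on) (simp add: assms linear_conv_bounded_linear[symmetric])
  have f[measurable]: "f \<in> borel_measurable borel"
    using assms by auto
  have fa: "f absolutely_integrable_on UNIV"
    using assms(2) by (simp add: set_integrable_def integrable_completion)
  define g where "g x = (vec (f x) :: real^1)" for x
  have ga: "g absolutely_integrable_on L ` UNIV"
    unfolding im using fa by (simp add: absolutely_integrable_on_1_iff g_def)
  have comp: "(g \<circ> L) absolutely_integrable_on UNIV"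
    using absolutely_integrable_on_linear_image[OF assms(1), where f = g and S = UNIV] ga assms(3) by auto
  then have fL: "(\<lambda>x. f (L x)) absolutely_integrable_on UNIV"
    by (simp add: absolutely_integrable_on_1_iff g_def o_def)
  have "integral UNIV g = \<bar>det (matrix L)\<bar> *\<^sub>R integral UNIV (g \<circ> L)"
    using integral_change_of_variables_linear[OF assms(1), where f = g and S = UNIV] ga im by auto
  moreover have "g integrable_on UNIV" "(g \<circ> L) integrable_on UNIV"
    using ga comp im by (auto simp: absolutely_integrable_on_def)
  ultimately have "integral UNIV f = \<bar>det (matrix L)\<bar> * integral UNIV (\<lambda>x. f (L x))"
    by (auto simp: integral_on_1_eq g_def o_def vec_eq_iff)
  moreover have "integral UNIV f = (\<integral>x. f x \<partial>lborel)"
    using set_lebesgue_integral_eq_integral(2)[OF fa] by (simp add: set_lebesgue_integral_def integral_completion)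
  moreover have "integral UNIV (\<lambda>x. f (L x)) = (\<integral>x. f (L x) \<partial>lborel)"
    using set_lebesgue_integral_eq_integral(2)[OF fL] by (simp add: set_lebesgue_integral_def integral_completion)
  ultimately show ?thesis by simp
qed

text \<open>A rotation that takes a coordinate axis to \<open>\<nu>\<close> turns the map into a diagonal one.\<close>

lemma det_normal_rescaling:
  fixes \<nu> :: "real^'d::finite"
  assumes "norm \<nu> = 1"
  shows "det (matrix (\<lambda>z. z - (a * (\<nu> \<bullet> z)) *\<^sub>R \<nu>)) = 1 - a"
proof -
  obtain k :: 'd where True
    by simp
  have "norm (axis k 1 :: real^'d) = 1"
    by simp
  then obtain R :: "real^'d \<Rightarrow> real^'d"
    where R: "orthogonal_transformation R" "R (axis k 1) = \<nu>"
    using assms by (rule orthogonal_transformation_exists_1) blast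
  have linR: "linear R"
    using R by (simp add: orthogonal_transformation_def)
  define Dg :: "real^'d \<Rightarrow> real^'d" where "Dg x = x - (a * (axis k 1 \<bullet> x)) *\<^sub>R axis k 1" for x
  define L where "L z = z - (a * (\<nu> \<bullet> z)) *\<^sub>R \<nu>" for z
  have linD: "linear Dg" 
    unfolding Dg_def by (rule linearI) (auto simp: algebra_simps)
  have linL: "linear L"
    unfolding L_def by (rule linearI) (auto simp: algebra_simps)
  have inn: "\<nu> \<bullet> R x = axis k 1 \<bullet> x" for x
    using R by (auto simp: orthogonal_transformation_def)
  have "L \<circ> R = R \<circ> Dg"
    using R(2) by (auto simp: fun_eq_iff L_def Dg_def linear_diff[OF linR] linear_scale[OF linR] inn)
  then have "matrix L ** matrix R = matrix R ** matrix Dg"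
    using linL linR linD by (metis matrix_compose)
  then have "det (matrix L) * det (matrix R) = det (matrix R) * det (matrix Dg)"
    by (metis det_mul)
  moreover have "det (matrix R) \<noteq> 0"
    using R by (metis det_nz_iff_inj linR orthogonal_transformation_inj)
  ultimately have "det (matrix L) = det (matrix Dg)"
    by simp
  have Dgn: "matrix Dg $ i $ j = (if i = j then (if j = k then 1 - a else 1) else 0)" for i j
    by (simp add: matrix_def Dg_def inner_axis_axis) (auto simp: axis_def)
  note \<open>det (matrix L) = det (matrix Dg)\<close>
  also have "det (matrix Dg) = (\<Prod>i\<in>UNIV. matrix Dg $ i $ i)"
    by (rule det_diagonal) (auto simp: Dgn)
  also have "\<dots> = (\<Prod>i\<in>UNIV. if i = k then 1 - a else 1)"
    by (intro prod.cong) (auto simp: Dgn)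
  also have "\<dots> = 1 - a"
    by simp
  finally show ?thesis
    unfolding L_def .
qed

text \<open>The substituted map fixes the hyperplane \<open>\<nu> \<bullet> x = c\<close> and multiplies the signed distance to
  it by \<open>r\<close>. With \<open>r = - \<epsilon>\<close> it carries the unit slab on the outer side of the hyperplane, over
  which face integrals are defined, to a layer of width \<open>\<epsilon>\<close> on the inner side.\<close>

lemma integral_normal_rescaling:
  fixes \<nu> :: "real^'d::{finite,wellorder}" and f :: "real^'d::_ \<Rightarrow> real"
  assumes \<nu>: "norm \<nu> = 1" and f: "integrable lborel f" and r: "r \<noteq> 0"
  shows "(\<integral>x. f x \<partial>lborel) = \<bar>r\<bar> * (\<integral>z. f (z - ((1 - r) * (\<nu> \<bullet> z - c)) *\<^sub>R \<nu>) \<partial>lborel)"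
proof -
  define b where "b = ((1 - r) * c) *\<^sub>R \<nu>"
  define L where "L z = z - ((1 - r) * (\<nu> \<bullet> z)) *\<^sub>R \<nu>" for z
  have f'[measurable]: "f \<in> borel_measurable borel" using f by auto
  have "integrable (distr lborel borel ((+) b)) f"
    using f by (simp add: lborel_distr_plus)
  then have fb: "integrable lborel (\<lambda>x. f (b + x))"
    by (subst (asm) integrable_distr_eq) auto
  have lin: "linear L"
    unfolding L_def by (rule linearI) (auto simp: algebra_simps)
  have det: "det (matrix L) = r"
    unfolding L_def using det_normal_rescaling[OF \<nu>, of "1 - r"] by simp
  have "(\<integral>x. f x \<partial>lborel) = (\<integral>x. f x \<partial>distr lborel borel ((+) b))"
    by (simp add: lborel_distr_plus)
  also have "\<dots> = (\<integral>x. f (b + x) \<partial>lborel)"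
    by (subst integral_distr) auto
  also have "\<dots> = \<bar>r\<bar> * (\<integral>x. f (b + L x) \<partial>lborel)"
    using integral_linear_change_of_variables_lborel[OF lin fb] det r by simp
  also have "(\<lambda>z. f (b + L z)) = (\<lambda>z. f (z - ((1 - r) * (\<nu> \<bullet> z - c)) *\<^sub>R \<nu>))"
    by (auto simp: L_def b_def algebra_simps)
  finally show ?thesis .
qed

text \<open>The profile of the cut-off function. It is piecewise linear so that its derivative is the
  indicator of the layer in which the cut-off is not constant.\<close>

definition ramp :: "real \<Rightarrow> real" where
  "ramp s = max 0 (min 1 s)"

lemma ramp_bounds: "0 \<le> ramp s" "ramp s \<le> 1"
  by (auto simp: ramp_def)

lemma ramp_lipschitz: "\<bar>ramp a - ramp b\<bar> \<le> \<bar>a - b\<bar>"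
  by (auto simp: ramp_def)

lemma continuous_on_ramp [continuous_intros]:
  "continuous_on A f \<Longrightarrow> continuous_on A (\<lambda>x. ramp (f x))"
  unfolding ramp_def by (intro continuous_intros)

lemma borel_measurable_ramp [measurable]: "ramp \<in> borel_measurable borel"
  by (intro borel_measurable_continuous_onI continuous_intros)

lemma ramp_has_derivative:
  assumes "s \<noteq> 0" "s \<noteq> 1"
  shows "(ramp has_real_derivative (if 0 < s \<and> s < 1 then 1 else 0)) (at s)"
proof -
  consider "s < 0" | "0 < s" "s < 1" | "s > 1"
    using assms by linarith
  then show ?thesis
  proof cases
    case 1
    have "((\<lambda>x. 0) has_real_derivative 0) (at s)" by simp
    then have "(ramp has_real_derivative 0) (at s)"
      by (rule has_field_derivative_transform_within_open[where S = "{..<0}"]) (use 1 in \<open>auto simp: ramp_def\<close>)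
    with 1 show ?thesis by simp
  next
    case 2
    have "((\<lambda>x. x) has_real_derivative 1) (at s)" by simp
    then have "(ramp has_real_derivative 1) (at s)"
      by (rule has_field_derivative_transform_within_open[where S = "{0<..<1}"]) (use 2 in \<open>auto simp: ramp_def\<close>)
    with 2 show ?thesis by simp
  next
    case 3
    have "((\<lambda>x. 1) has_real_derivative 0) (at s)" by simp
    then have "(ramp has_real_derivative 0) (at s)"
      by (rule has_field_derivative_transform_within_open[where S = "{1<..}"]) (use 3 in \<open>auto simp: ramp_def\<close>)
    with 3 show ?thesis by simp
  qed
qed

text \<open>As the layer width \<open>1 / (m + 1)\<close> tends to zero, the cut-off becomes the indicator of the
  open half-space, except on the bounding hyperplane \<open>l = 0\<close>.\<close>

lemma ramp_scaled_eventually: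
  fixes a :: "nat \<Rightarrow> real"
  assumes a: "a \<longlonglongrightarrow> l" and l: "l \<noteq> 0"
  shows "\<forall>\<^sub>F m in sequentially. ramp (a m * real (Suc m)) = (if l > 0 then 1 else 0)"
proof (cases "l > 0")
  case True
  have "\<forall>\<^sub>F m in sequentially. a m > l / 2"
    using order_tendstoD(1)[OF a, of "l/2"] True by simp
  moreover have "\<forall>\<^sub>F m in sequentially. real (Suc m) > 2 / l"
    using eventually_gt_at_top[of "nat \<lceil>2 / l\<rceil>"] by eventually_elim linarith
  ultimately show ?thesis
  proof eventually_elim
    case (elim m)
    have "1 = l / 2 * (2 / l)"
      using True by simp
    also have "\<dots> \<le> a m * real (Suc m)"
      using elim True by (intro mult_mono) auto
    finally show ?case
      using True by (simp add: ramp_def)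
  qed
next
  case False
  have "\<forall>\<^sub>F m in sequentially. a m < 0"
    using order_tendstoD(2)[OF a, of 0] False l by simp
  then show ?thesis
  proof eventually_elim
    case (elim m)
    then have "a m * real (Suc m) \<le> 0"
      by (simp add: mult_nonpos_nonneg del: of_nat_Suc)
    then show ?case
      using False by (simp add: ramp_def del: of_nat_Suc)
  qed
qed

lemma AE_not_in_hyperplane:
  fixes a :: "'a::euclidean_space"
  assumes "a \<noteq> 0 \<or> b \<noteq> 0"
  shows "AE x in lborel. a \<bullet> x \<noteq> b"
proof -
  have "{x. a \<bullet> x = b} \<in> null_sets lebesgue"
    using negligible_hyperplane[OF assms] by (simp add: negligible_iff_null_sets)
  then have "AE x in lebesgue. x \<notin> {x. a \<bullet> x = b}"
    by (rule AE_not_in)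
  then show ?thesis
    by (simp add: AE_completion_iff)
qed

lemma integrable_bounded_support:
  fixes g :: "'a::euclidean_space \<Rightarrow> real"
  assumes "g \<in> borel_measurable borel" "\<And>x. \<bar>g x\<bar> \<le> B * indicat_real (cball 0 R) x"
  shows "integrable lborel g"
proof (rule Bochner_Integration.integrable_bound)
  show "integrable lborel (\<lambda>x::'a. B * indicat_real (cball 0 R) x)"
    by (intro integrable_mult_right integrable_real_indicator)
      (auto simp: emeasure_lborel_cball_finite[unfolded infinity_ennreal_def])
  show "AE x in lborel. norm (g x) \<le> norm (B * indicat_real (cball 0 R) x)"
    using order_trans[OF assms(2) abs_ge_self] by (intro AE_I2) simp
qed (use assms in auto)

text \<open>The integrand of \<^const>\<open>face_integral\<close> for a base \<open>F\<close> in the hyperplane \<open>\<nu> \<bullet> x = c\<close>: there the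
  closest point is \<open>z - (\<nu> \<bullet> z - c) *\<^sub>R \<nu>\<close>.\<close>

definition slab_fun :: "real^'d \<Rightarrow> real \<Rightarrow> (real^'d) set \<Rightarrow> (real^'d \<Rightarrow> real) \<Rightarrow> real^'d \<Rightarrow> real" where
  "slab_fun \<nu> c F f z = (if 0 \<le> \<nu> \<bullet> z - c \<and> \<nu> \<bullet> z - c \<le> 1 \<and> z - (\<nu> \<bullet> z - c) *\<^sub>R \<nu> \<in> F
           then f (z - (\<nu> \<bullet> z - c) *\<^sub>R \<nu>) else 0)"

text \<open>Averaging \<open>f\<close> over a layer of width \<open>1 / (m + 1)\<close> along one facet gives the face integral in
  the limit. Rescaling the normal direction makes the layer a slab of fixed width one; the factors
  \<open>ramp\<close> of the remaining half-spaces then converge to the indicator of the facet, except where the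
  projection to the hyperplane meets a second bounding hyperplane. The points \<open>y\<close> in the hypothesis
  ensure that for each \<open>j\<close> this exceptional set is empty or a hyperplane, hence null.\<close>

lemma boundary_layer_tendsto:
  fixes \<nu> :: "real^'d::{finite,wellorder}" and f :: "real^'d::_ \<Rightarrow> real" and \<mu> :: "'j \<Rightarrow> real^'d::_"
  assumes \<nu>: "norm \<nu> = 1" and J: "finite J" and f: "continuous_on UNIV f"
    and K: "K = {x. \<nu> \<bullet> x \<le> c \<and> (\<forall>j\<in>J. \<mu> j \<bullet> x \<le> d j)}" "bounded K"
    and proper: "\<And>j. j \<in> J \<Longrightarrow> \<exists>y. \<nu> \<bullet> y = c \<and> \<mu> j \<bullet> y \<noteq> d j"
  defines "G \<equiv> \<lambda>m x. f x * (if 0 < c - \<nu> \<bullet> x \<and> (c - \<nu> \<bullet> x) * real (Suc m) < 1 then 1 else 0) *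
                   (\<Prod>j\<in>J. ramp ((d j - \<mu> j \<bullet> x) * real (Suc m)))"
  shows "(\<lambda>m. real (Suc m) * (\<integral>x. G m x \<partial>lborel)) \<longlonglongrightarrow>
     (\<integral>z. slab_fun \<nu> c K f z \<partial>lborel)"
    and "\<And>m. integrable lborel (G m)"
proof -
  obtain R where R: "K \<subseteq> cball 0 R"
    using K(2) unfolding bounded_iff by (auto simp: subset_iff)
  obtain B where B: "\<And>x. x \<in> K \<Longrightarrow> \<bar>f x\<bar> \<le> B" and B0: "0 \<le> B"
  proof -
    have "compact (f ` cball 0 R)"
      by (intro compact_continuous_image continuous_on_subset[OF f]) auto
    then obtain B where "\<forall>y\<in>f ` cball 0 R. norm y \<le> B"
      using bounded_iff compact_imp_bounded by blast
    then have "\<bar>f x\<bar> \<le> \<bar>B\<bar>" if "x \<in> K" for x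
      using R that by fastforce
    then show ?thesis
      by (rule that) auto
  qed
  have fm[measurable]: "f \<in> borel_measurable borel"
    using f by (rule borel_measurable_continuous_onI)
  have Gm[measurable]: "G m \<in> borel_measurable borel" for m
    unfolding G_def by measurable
  have prod01: "0 \<le> (\<Prod>j\<in>J. ramp (g j))" "(\<Prod>j\<in>J. ramp (g j)) \<le> 1" for g
    by (auto intro!: prod_nonneg prod_le_1 simp: ramp_bounds)
  have Gsupp: "x \<in> K" if "G m x \<noteq> 0" for m x
  proof -
    have "\<mu> j \<bullet> x \<le> d j" if j: "j \<in> J" for j
    proof (rule ccontr)
      assume "\<not> ?thesis"
      then have "(d j - \<mu> j \<bullet> x) * real (Suc m) \<le> 0"
        by (simp add: mult_nonpos_nonneg del: of_nat_Suc)
      then have "ramp ((d j - \<mu> j \<bullet> x) * real (Suc m)) = 0"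
        by (simp add: ramp_def del: of_nat_Suc)
      with j J have "(\<Prod>j\<in>J. ramp ((d j - \<mu> j \<bullet> x) * real (Suc m))) = 0"
        by (auto simp: prod_zero_iff simp del: of_nat_Suc)
      with \<open>G m x \<noteq> 0\<close> show False by (simp add: G_def del: of_nat_Suc)
    qed
    moreover have "\<nu> \<bullet> x \<le> c"
      using that by (auto simp: G_def split: if_splits)
    ultimately show ?thesis by (simp add: K)
  qed
  have GB: "\<bar>G m x\<bar> \<le> B" if "x \<in> K" for m x
  proof -
    have "\<bar>G m x\<bar> \<le> \<bar>f x\<bar> * 1 * 1"
      unfolding G_def abs_mult using prod01 by (intro mult_mono) auto
    with B[OF that] show ?thesis by simp
  qed
  show Gint: "integrable lborel (G m)" for m
  proof (rule integrable_bounded_support)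
    show "\<bar>G m x\<bar> \<le> B * indicat_real (cball 0 R) x" for x
    proof (cases "x \<in> K")
      case True
      then show ?thesis
        using GB[of x m] R by (auto simp: indicator_def subset_iff)
    next
      case False
      then have "G m x = 0" using Gsupp by blast
      then show ?thesis
        using B0 by simp
    qed
  qed measurable
  \<comment> \<open>\<open>T m\<close> flattens the outer unit slab onto the inner layer; its determinant cancels the factor \<open>Suc m\<close>.\<close>
  define T where "T m z = z - ((1 + inverse (real (Suc m))) * (\<nu> \<bullet> z - c)) *\<^sub>R \<nu>" for m z
  define \<pi> where "\<pi> z = z - (\<nu> \<bullet> z - c) *\<^sub>R \<nu>" for z
  have \<nu>\<nu>: "\<nu> \<bullet> \<nu> = 1"
    using \<nu> by (simp add: norm_eq_1)
  have \<nu>T: "c - \<nu> \<bullet> T m z = inverse (real (Suc m)) * (\<nu> \<bullet> z - c)" for m z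
    by (simp add: T_def \<nu>\<nu> algebra_simps)
  have \<nu>T': "(c - \<nu> \<bullet> T m z) * real (Suc m) = \<nu> \<bullet> z - c" for m z
    by (simp add: \<nu>T del: of_nat_Suc)
  have sl: "(0 < c - \<nu> \<bullet> T m z \<and> (c - \<nu> \<bullet> T m z) * real (Suc m) < 1) \<longleftrightarrow> 0 < \<nu> \<bullet> z - c \<and> \<nu> \<bullet> z - c < 1" for m z
    unfolding \<nu>T' unfolding \<nu>T by (simp add: zero_less_mult_iff del: of_nat_Suc)
  have resc: "real (Suc m) * (\<integral>x. G m x \<partial>lborel) = (\<integral>z. G m (T m z) \<partial>lborel)" for m
    using integral_normal_rescaling[OF \<nu> Gint[of m], of "- inverse (real (Suc m))" c]
    by (simp add: T_def del: of_nat_Suc)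
  define w where "w z = B * indicat_real (cball 0 (R + 2)) z" for z :: "real^'d::_"
  have wint: "integrable lborel w"
    unfolding w_def by (intro integrable_mult_right integrable_real_indicator)
      (auto simp: emeasure_lborel_cball_finite[unfolded infinity_ennreal_def])
  have lim: "(\<lambda>m. \<integral>z. G m (T m z) \<partial>lborel) \<longlonglongrightarrow>
      (\<integral>z. (if 0 \<le> \<nu> \<bullet> z - c \<and> \<nu> \<bullet> z - c \<le> 1 \<and> \<pi> z \<in> K then f (\<pi> z) else 0) \<partial>lborel)"
  proof (rule integral_dominated_convergence[OF _ _ wint])
    have "K = {x. \<nu> \<bullet> x \<le> c} \<inter> (\<Inter>j\<in>J. {x. \<mu> j \<bullet> x \<le> d j})"
      unfolding K by auto
    then have "closed K"
      by (auto intro!: closed_Int closed_INT closed_halfspace_le)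
    then have [measurable]: "K \<in> sets borel" by auto
    show "(\<lambda>z. if 0 \<le> \<nu> \<bullet> z - c \<and> \<nu> \<bullet> z - c \<le> 1 \<and> \<pi> z \<in> K then f (\<pi> z) else 0) \<in> borel_measurable lborel"
      unfolding \<pi>_def by measurable
    show "(\<lambda>z. G m (T m z)) \<in> borel_measurable lborel" for m
      unfolding T_def by measurable
    show "AE z in lborel. norm (G m (T m z)) \<le> w z" for m
    proof (rule AE_I2)
      fix z
      show "norm (G m (T m z)) \<le> w z"
      proof (cases "G m (T m z) = 0")
        case False
        then have TK: "T m z \<in> K" by (rule Gsupp)
        have "0 < \<nu> \<bullet> z - c" "\<nu> \<bullet> z - c < 1"
          using False unfolding G_def sl by (auto split: if_splits)
        moreover have "inverse (real (Suc m)) \<le> 1"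
          by (simp add: field_simps)
        ultimately have sh: "\<bar>(1 + inverse (real (Suc m))) * (\<nu> \<bullet> z - c)\<bar> \<le> 2 * 1"
          unfolding abs_mult by (intro mult_mono) auto
        have "norm z = norm (T m z + ((1 + inverse (real (Suc m))) * (\<nu> \<bullet> z - c)) *\<^sub>R \<nu>)"
          by (simp add: T_def)
        also have "\<dots> \<le> norm (T m z) + norm (((1 + inverse (real (Suc m))) * (\<nu> \<bullet> z - c)) *\<^sub>R \<nu>)"
          by (rule norm_triangle_ineq)
        also have "\<dots> \<le> norm (T m z) + 2"
          using sh \<nu> by simp
        finally have "norm z \<le> norm (T m z) + 2" .
        moreover have "norm (T m z) \<le> R" using TK R by auto
        ultimately show ?thesis
          using GB[OF TK, of m] by (simp add: w_def)
      next
        case True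
        then show ?thesis
          using B0 by (simp add: w_def)
      qed
    qed
    have AE1: "AE z in lborel. \<forall>j\<in>J. \<mu> j \<bullet> \<pi> z \<noteq> d j"
    proof (rule AE_finite_allI[OF J])
      fix j assume "j \<in> J"
      then obtain y where y: "\<nu> \<bullet> y = c" "\<mu> j \<bullet> y \<noteq> d j"
        using proper by blast
      define a where "a = \<mu> j - (\<mu> j \<bullet> \<nu>) *\<^sub>R \<nu>"
      define b where "b = d j - c * (\<mu> j \<bullet> \<nu>)"
      have "a \<bullet> y \<noteq> b"
        using y by (simp add: a_def b_def algebra_simps)
      then have "a \<noteq> 0 \<or> b \<noteq> 0" by auto
      then have "AE z in lborel. a \<bullet> z \<noteq> b" by (rule AE_not_in_hyperplane)
      then show "AE z in lborel. \<mu> j \<bullet> \<pi> z \<noteq> d j"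
        by eventually_elim (simp add: a_def b_def \<pi>_def algebra_simps)
    qed
    have nz: "\<nu> \<noteq> 0" using \<nu> by auto
    have AE2: "AE z in lborel. \<nu> \<bullet> z \<noteq> c" "AE z in lborel. \<nu> \<bullet> z \<noteq> c + 1"
      using nz by (auto intro: AE_not_in_hyperplane)
    show "AE z in lborel. (\<lambda>m. G m (T m z)) \<longlonglongrightarrow> (if 0 \<le> \<nu> \<bullet> z - c \<and> \<nu> \<bullet> z - c \<le> 1 \<and> \<pi> z \<in> K then f (\<pi> z) else 0)"
      using AE1 AE2
    proof eventually_elim
      case (elim z)
      have "(\<lambda>m. T m z) \<longlonglongrightarrow> z - ((1 + 0) * (\<nu> \<bullet> z - c)) *\<^sub>R \<nu>"
        unfolding T_def by (intro tendsto_intros LIMSEQ_inverse_real_of_nat)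
      then have T: "(\<lambda>m. T m z) \<longlonglongrightarrow> \<pi> z"
        by (simp add: \<pi>_def)
      have fT: "(\<lambda>m. f (T m z)) \<longlonglongrightarrow> f (\<pi> z)"
        using f by (intro isCont_tendsto_compose[OF _ T]) (simp add: continuous_on_eq_continuous_at)
      have "\<forall>\<^sub>F m in sequentially. \<forall>j\<in>J. ramp ((d j - \<mu> j \<bullet> T m z) * real (Suc m))
               = (if d j - \<mu> j \<bullet> \<pi> z > 0 then 1 else 0)"
      proof (rule eventually_ball_finite[OF J], rule ballI)
        fix j assume j: "j \<in> J"
        have "(\<lambda>m. d j - \<mu> j \<bullet> T m z) \<longlonglongrightarrow> d j - \<mu> j \<bullet> \<pi> z"
          by (intro tendsto_intros T)
        moreover have "d j - \<mu> j \<bullet> \<pi> z \<noteq> 0"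
          using elim(1) j by auto
        ultimately show "\<forall>\<^sub>F m in sequentially. ramp ((d j - \<mu> j \<bullet> T m z) * real (Suc m))
               = (if d j - \<mu> j \<bullet> \<pi> z > 0 then 1 else 0)"
          by (rule ramp_scaled_eventually)
      qed
      then have "\<forall>\<^sub>F m in sequentially. (\<Prod>j\<in>J. ramp ((d j - \<mu> j \<bullet> T m z) * real (Suc m)))
               = (\<Prod>j\<in>J. if d j - \<mu> j \<bullet> \<pi> z > 0 then 1 else 0)"
        by eventually_elim (auto intro: prod.cong)
      then have pr: "(\<lambda>m. \<Prod>j\<in>J. ramp ((d j - \<mu> j \<bullet> T m z) * real (Suc m)))
             \<longlonglongrightarrow> (\<Prod>j\<in>J. if d j - \<mu> j \<bullet> \<pi> z > 0 then 1 else 0)"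
        by (rule tendsto_eventually)
      have "\<nu> \<bullet> \<pi> z = c"
        by (simp add: \<pi>_def algebra_simps \<nu>\<nu>)
      then have prK: "(\<Prod>j\<in>J. if d j - \<mu> j \<bullet> \<pi> z > 0 then 1 else 0) = (if \<pi> z \<in> K then 1 else (0::real))"
      proof (cases "\<pi> z \<in> K")
        case True
        then have "d j - \<mu> j \<bullet> \<pi> z > 0" if "j \<in> J" for j
          using elim(1) that by (force simp: K)
        then show ?thesis
          using True by simp
      next
        case False
        then obtain j where "j \<in> J" "\<not> \<mu> j \<bullet> \<pi> z \<le> d j"
          using \<open>\<nu> \<bullet> \<pi> z = c\<close> unfolding K by auto
        then have "\<exists>j\<in>J. (if d j - \<mu> j \<bullet> \<pi> z > 0 then 1 else 0) = (0::real)"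
          by force
        then show ?thesis
          using False by (simp add: prod_zero[OF J])
      qed
      have "(\<lambda>m. G m (T m z)) \<longlonglongrightarrow> f (\<pi> z) * (if 0 < \<nu> \<bullet> z - c \<and> \<nu> \<bullet> z - c < 1 then 1 else 0) * (if \<pi> z \<in> K then 1 else 0)"
        unfolding G_def sl using pr[unfolded prK] by (intro tendsto_mult fT tendsto_const)
      also have "f (\<pi> z) * (if 0 < \<nu> \<bullet> z - c \<and> \<nu> \<bullet> z - c < 1 then 1 else 0) * (if \<pi> z \<in> K then 1 else 0)
          = (if 0 \<le> \<nu> \<bullet> z - c \<and> \<nu> \<bullet> z - c \<le> 1 \<and> \<pi> z \<in> K then f (\<pi> z) else 0)"
        using elim by auto
      finally show ?case .
    qed
  qed
  then show "(\<lambda>m. real (Suc m) * (\<integral>x. G m x \<partial>lborel)) \<longlonglongrightarrow>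
     (\<integral>z. slab_fun \<nu> c K f z \<partial>lborel)"
    unfolding resc \<pi>_def slab_fun_def .
qed

lemma line_difference_bound:
  fixes f f' :: "'a::real_normed_vector \<Rightarrow> real"
  assumes df: "\<And>x. ((\<lambda>s. f (x + s *\<^sub>R e)) has_real_derivative f' x) (at 0)"
    and B: "\<And>s. 0 \<le> s \<Longrightarrow> s \<le> t \<Longrightarrow> \<bar>f' (x + s *\<^sub>R e)\<bar> \<le> B" and t: "0 \<le> t"
  shows "\<bar>f (x + t *\<^sub>R e) - f x\<bar> \<le> B * t"
proof -
  have d: "((\<lambda>s. f (x + s *\<^sub>R e)) has_real_derivative f' (x + s *\<^sub>R e)) (at s within {0..t})" for s
  proof -
    have "((\<lambda>r. f (x + s *\<^sub>R e + r *\<^sub>R e)) has_real_derivative f' (x + s *\<^sub>R e)) (at (s + - s))"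
      using df[of "x + s *\<^sub>R e"] by simp
    then have "((\<lambda>r. f (x + s *\<^sub>R e + (r + - s) *\<^sub>R e)) has_real_derivative f' (x + s *\<^sub>R e)) (at s)"
      by (subst (asm) DERIV_shift)
    then show ?thesis
      by (simp add: algebra_simps has_field_derivative_at_within)
  qed
  have "norm (f (x + t *\<^sub>R e) - f (x + 0 *\<^sub>R e)) \<le> B * norm (t - 0)"
    by (rule field_differentiable_bound[OF _ d]) (use B t in auto)
  with t show ?thesis by simp
qed

text \<open>Multiplying \<open>f\<close> by the cut-off \<open>\<eta> m\<close>, the product of the ramps of all distances, gives a
  Lipschitz function of compact support, whose directional derivative has integral zero. The
  derivative of the cut-off lives in the boundary layers, one for each half-space, and
  \<open>boundary_layer_tendsto\<close> identifies the limit of each layer.\<close>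

theorem divergence_theorem_halfspaces:
  fixes f f' :: "real^'d::{finite,wellorder} \<Rightarrow> real" and \<nu> :: "'i \<Rightarrow> real^'d::_"
  assumes H: "finite H" and \<nu>: "\<And>i. i \<in> H \<Longrightarrow> norm (\<nu> i) = 1"
    and K: "K = {x. \<forall>i\<in>H. \<nu> i \<bullet> x \<le> c i}" "bounded K"
    and proper: "\<And>i j. i \<in> H \<Longrightarrow> j \<in> H \<Longrightarrow> i \<noteq> j \<Longrightarrow> \<exists>y. \<nu> i \<bullet> y = c i \<and> \<nu> j \<bullet> y \<noteq> c j"
    and f: "continuous_on UNIV f" and f': "continuous_on UNIV f'"
    and df: "\<And>x. ((\<lambda>s. f (x + s *\<^sub>R e)) has_real_derivative f' x) (at 0)"
  shows "(\<integral>x. indicat_real K x * f' x \<partial>lborel) =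
     (\<Sum>i\<in>H. (\<nu> i \<bullet> e) * (\<integral>z. slab_fun (\<nu> i) (c i) K f z \<partial>lborel))"
proof -
  define lev where "lev m i x = (c i - \<nu> i \<bullet> x) * real (Suc m)" for m i x
  define \<eta> where "\<eta> m x = (\<Prod>i\<in>H. ramp (lev m i x))" for m x
  define chi where "chi m i x = (if 0 < c i - \<nu> i \<bullet> x \<and> lev m i x < 1 then 1 else (0::real))" for m i x
  define G where "G i m x = f x * chi m i x * (\<Prod>j\<in>H-{i}. ramp (lev m j x))" for i m x
  define I where "I i = (\<integral>z. slab_fun (\<nu> i) (c i) K f z \<partial>lborel)" for i
  have [measurable]: "f \<in> borel_measurable borel" "f' \<in> borel_measurable borel"
    using f f' by (auto intro: borel_measurable_continuous_onI)
  have "K = (\<Inter>i\<in>H. {x. \<nu> i \<bullet> x \<le> c i})"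
    unfolding K by auto
  then have "closed K"
    by (auto intro!: closed_INT closed_halfspace_le)
  then have Kb[measurable]: "K \<in> sets borel" by auto
  have nz: "i \<in> H \<Longrightarrow> \<nu> i \<noteq> 0" for i
    using \<nu> by force
  have layer: "(\<lambda>m. real (Suc m) * (\<integral>x. G i m x \<partial>lborel)) \<longlonglongrightarrow> I i" "\<And>m. integrable lborel (G i m)"
    if i: "i \<in> H" for i
  proof -
    have K': "K = {x. \<nu> i \<bullet> x \<le> c i \<and> (\<forall>j\<in>H - {i}. \<nu> j \<bullet> x \<le> c j)}"
      using i unfolding K by auto
    have pr: "\<exists>y. \<nu> i \<bullet> y = c i \<and> \<nu> j \<bullet> y \<noteq> c j" if "j \<in> H - {i}" for j
      using proper[OF i] that by auto
    note layer_limit = boundary_layer_tendsto[OF \<nu>[OF i] finite_Diff[OF H] f K' K(2) pr]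
    show "(\<lambda>m. real (Suc m) * (\<integral>x. G i m x \<partial>lborel)) \<longlonglongrightarrow> I i"
      unfolding G_def I_def chi_def lev_def by (rule layer_limit(1))
    show "\<And>m. integrable lborel (G i m)"
      unfolding G_def I_def chi_def lev_def by (rule layer_limit(2))
  qed
  obtain R where R: "K \<subseteq> cball 0 R"
    using K(2) unfolding bounded_iff by (auto simp: subset_iff)
  obtain B where B: "\<And>x. norm x \<le> R + norm e \<Longrightarrow> \<bar>f x\<bar> \<le> B \<and> \<bar>f' x\<bar> \<le> B" and B0: "0 \<le> B"
  proof -
    have "compact ((\<lambda>x. (f x, f' x)) ` cball 0 (R + norm e))"
      by (intro compact_continuous_image continuous_on_Pair continuous_on_subset[OF f] continuous_on_subset[OF f']) auto
    then obtain B where B: "\<forall>y\<in>(\<lambda>x. (f x, f' x)) ` cball 0 (R + norm e). norm y \<le> B"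
      using bounded_iff compact_imp_bounded by blast
    have "\<bar>f x\<bar> \<le> \<bar>B\<bar> \<and> \<bar>f' x\<bar> \<le> \<bar>B\<bar>" if "norm x \<le> R + norm e" for x
    proof -
      have "norm (f x, f' x) \<le> B" using B that by auto
      then show ?thesis
        using norm_fst_le[of "f x" "f' x"] norm_snd_le[of "f' x" "f x"] by simp
    qed
    then show ?thesis
      by (rule that) auto
  qed
  have \<eta>01: "0 \<le> \<eta> m x" "\<eta> m x \<le> 1" for m x
    unfolding \<eta>_def by (auto intro!: prod_nonneg prod_le_1 simp: ramp_bounds)
  have \<eta>0: "\<eta> m x = 0" if "x \<notin> K" for m x
  proof -
    obtain i where i: "i \<in> H" "\<not> \<nu> i \<bullet> x \<le> c i"
      using \<open>x \<notin> K\<close> unfolding K by auto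
    then have "lev m i x \<le> 0"
      unfolding lev_def by (simp add: mult_nonpos_nonneg del: of_nat_Suc)
    then have "ramp (lev m i x) = 0"
      by (simp add: ramp_def)
    with i H show ?thesis
      unfolding \<eta>_def by (auto simp: prod_zero_iff)
  qed
  have \<eta>m[measurable]: "\<eta> m \<in> borel_measurable borel" for m
    unfolding \<eta>_def lev_def by measurable
  have layers: "(\<integral>x. \<eta> m x * f' x \<partial>lborel) = (\<Sum>i\<in>H. (\<nu> i \<bullet> e) * (real (Suc m) * (\<integral>x. G i m x \<partial>lborel)))" for m
  proof -
    define h where "h x = f x * \<eta> m x" for x
    define D2 where "D2 x = (\<Sum>i\<in>H. (\<nu> i \<bullet> e) * (real (Suc m) * G i m x))" for x
    have D2i: "integrable lborel D2"
      unfolding D2_def by (intro Bochner_Integration.integrable_sum integrable_mult_right layer)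
    have [measurable]: "D2 \<in> borel_measurable borel" using D2i by auto
    have f\<eta>: "integrable lborel (\<lambda>x. \<eta> m x * f' x)"
    proof (rule integrable_bounded_support)
      show "\<bar>\<eta> m x * f' x\<bar> \<le> B * indicat_real (cball 0 R) x" for x
      proof (cases "x \<in> K")
        case True
        then have xR: "norm x \<le> R" using R by auto
        then have "\<bar>f' x\<bar> \<le> B" using B[of x] norm_ge_zero[of e] by linarith
        then have "\<bar>\<eta> m x\<bar> * \<bar>f' x\<bar> \<le> 1 * B"
          using \<eta>01[of m x] by (intro mult_mono) auto
        then show ?thesis using xR by (simp add: abs_mult)
      qed (use \<eta>0 B0 in auto)
    qed measurable
    have hi: "integrable lborel h"
    proof (rule integrable_bounded_support)
      show "\<bar>h x\<bar> \<le> B * indicat_real (cball 0 R) x" for x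
      proof (cases "x \<in> K")
        case True
        then have xR: "norm x \<le> R" using R by auto
        then have "\<bar>f x\<bar> \<le> B" using B[of x] norm_ge_zero[of e] by linarith
        then have "\<bar>\<eta> m x\<bar> * \<bar>f x\<bar> \<le> 1 * B"
          using \<eta>01[of m x] by (intro mult_mono) auto
        then show ?thesis using xR by (simp add: h_def abs_mult mult.commute)
      qed (use \<eta>0 B0 in \<open>auto simp: h_def\<close>)
    qed (unfold h_def, measurable)
    define S where "S = (\<Sum>i\<in>H. \<bar>\<nu> i \<bullet> e\<bar> * real (Suc m))"
    have S0: "0 \<le> S" unfolding S_def by (intro sum_nonneg) auto
    have \<eta>lip: "\<bar>\<eta> m (x + t *\<^sub>R e) - \<eta> m x\<bar> \<le> S * t" if "0 \<le> t" for x t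
    proof -
      have "norm (\<eta> m (x + t *\<^sub>R e) - \<eta> m x) \<le> (\<Sum>i\<in>H. norm (ramp (lev m i (x + t *\<^sub>R e)) - ramp (lev m i x)))"
        unfolding \<eta>_def by (rule norm_prod_diff) (auto simp: ramp_bounds abs_le_iff intro: order_trans[OF _ ramp_bounds(1)])
      also have "\<dots> \<le> (\<Sum>i\<in>H. \<bar>\<nu> i \<bullet> e\<bar> * real (Suc m) * t)"
      proof (rule sum_mono)
        fix i
        have "norm (ramp (lev m i (x + t *\<^sub>R e)) - ramp (lev m i x)) \<le> \<bar>lev m i (x + t *\<^sub>R e) - lev m i x\<bar>"
          by (simp add: ramp_lipschitz)
        also have "lev m i (x + t *\<^sub>R e) - lev m i x = - ((\<nu> i \<bullet> e) * real (Suc m) * t)"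
          by (simp add: lev_def algebra_simps)
        finally show "norm (ramp (lev m i (x + t *\<^sub>R e)) - ramp (lev m i x)) \<le> \<bar>\<nu> i \<bullet> e\<bar> * real (Suc m) * t"
          using that by (simp add: abs_mult del: of_nat_Suc)
      qed
      finally show ?thesis by (simp add: S_def sum_distrib_right)
    qed
    have hlip: "\<bar>h (x + t *\<^sub>R e) - h x\<bar> \<le> (B + B * S) * t" if t: "0 \<le> t" "t \<le> 1" for x t
    proof (cases "x \<in> K \<or> x + t *\<^sub>R e \<in> K")
      case True
      have near: "norm (x + s *\<^sub>R e) \<le> R + norm e" if s: "0 \<le> s" "s \<le> t" for s
      proof -
        have "norm (s *\<^sub>R e) \<le> norm e" "norm ((t - s) *\<^sub>R e) \<le> norm e"
          using s t by (auto simp: mult_left_le_one_le)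
        moreover have "norm (x + s *\<^sub>R e) = norm ((x + t *\<^sub>R e) - (t - s) *\<^sub>R e)"
          by (simp add: algebra_simps)
        moreover have "norm x \<le> R \<or> norm (x + t *\<^sub>R e) \<le> R"
          using True R by auto
        ultimately show ?thesis
          using norm_triangle_ineq[of x "s *\<^sub>R e"] norm_triangle_ineq4[of "x + t *\<^sub>R e" "(t - s) *\<^sub>R e"]
          by linarith
      qed
      have "h (x + t *\<^sub>R e) - h x = (f (x + t *\<^sub>R e) - f x) * \<eta> m (x + t *\<^sub>R e) + f x * (\<eta> m (x + t *\<^sub>R e) - \<eta> m x)"
        by (simp add: h_def algebra_simps)
      then have "\<bar>h (x + t *\<^sub>R e) - h x\<bar> \<le> \<bar>f (x + t *\<^sub>R e) - f x\<bar> * \<bar>\<eta> m (x + t *\<^sub>R e)\<bar> + \<bar>f x\<bar> * \<bar>\<eta> m (x + t *\<^sub>R e) - \<eta> m x\<bar>"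
        by (metis abs_mult abs_triangle_ineq)
      also have "\<dots> \<le> (B * t) * 1 + B * (S * t)"
        using line_difference_bound[OF df, of t x B] near B \<eta>lip[OF t(1)] \<eta>01[of m "x + t *\<^sub>R e"] t B0 near[of 0]
        by (intro add_mono mult_mono) auto
      finally show ?thesis by (simp add: algebra_simps)
    next
      case False
      then show ?thesis using \<eta>0 t B0 S0 by (simp add: h_def)
    qed
    have AE1: "AE x in lborel. \<forall>i\<in>H. \<nu> i \<bullet> x \<noteq> c i \<and> \<nu> i \<bullet> x \<noteq> c i - inverse (real (Suc m))"
      by (rule AE_finite_allI[OF H]) (auto intro!: AE_conjI AE_not_in_hyperplane dest: nz)
    have deriv: "AE x in lborel. ((\<lambda>t. h (x + t *\<^sub>R e)) has_real_derivative (\<eta> m x * f' x - D2 x)) (at 0)"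
      using AE1
    proof eventually_elim
      case (elim x)
      have r: "((\<lambda>t. ramp (lev m i (x + t *\<^sub>R e))) has_real_derivative - (chi m i x * ((\<nu> i \<bullet> e) * real (Suc m)))) (at 0)"
        if i: "i \<in> H" for i
      proof -
        have l: "((\<lambda>t. lev m i (x + t *\<^sub>R e)) has_real_derivative - ((\<nu> i \<bullet> e) * real (Suc m))) (at 0)"
          unfolding lev_def inner_add_right inner_scaleR_right by (auto intro!: derivative_eq_intros)
        have "lev m i x \<noteq> 0"
          using elim i by (auto simp: lev_def)
        moreover have "lev m i x \<noteq> 1"
        proof
          assume "lev m i x = 1"
          then have "c i - \<nu> i \<bullet> x = inverse (real (Suc m))"
            by (simp add: lev_def inverse_eq_divide eq_divide_eq del: of_nat_Suc)
          with elim i show False by (auto simp: algebra_simps)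
        qed
        ultimately have "(ramp has_real_derivative (if 0 < lev m i x \<and> lev m i x < 1 then 1 else 0)) (at (lev m i (x + 0 *\<^sub>R e)))"
          using ramp_has_derivative[of "lev m i x"] by simp
        from DERIV_chain2[OF this l]
        show ?thesis
          by (simp add: chi_def lev_def zero_less_mult_iff split: if_splits)
      qed
      have "((\<lambda>t. \<eta> m (x + t *\<^sub>R e)) has_real_derivative
           (\<Sum>i\<in>H. - (chi m i x * ((\<nu> i \<bullet> e) * real (Suc m))) * (\<Prod>j\<in>H-{i}. ramp (lev m j (x + 0 *\<^sub>R e))))) (at 0)"
        unfolding \<eta>_def by (rule has_field_derivative_prod) (rule r)
      from DERIV_mult[OF df[of x] this]
      have "((\<lambda>t. h (x + t *\<^sub>R e)) has_real_derivative
        f' x * \<eta> m x + (\<Sum>i\<in>H. - (chi m i x * ((\<nu> i \<bullet> e) * real (Suc m))) * (\<Prod>j\<in>H-{i}. ramp (lev m j x))) * f x) (at 0)"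
        by (simp add: h_def)
      also have "f' x * \<eta> m x + (\<Sum>i\<in>H. - (chi m i x * ((\<nu> i \<bullet> e) * real (Suc m))) * (\<Prod>j\<in>H-{i}. ramp (lev m j x))) * f x
          = \<eta> m x * f' x - D2 x"
        unfolding D2_def G_def sum_distrib_right by (simp add: sum_negf mult_ac del: of_nat_Suc)
      finally show ?case .
    qed
    have hsupp: "h x = 0" if "norm x > R" for x
    proof -
      have "x \<notin> K" using that R by auto
      then show ?thesis by (simp add: h_def \<eta>0)
    qed
    have "(\<integral>x. \<eta> m x * f' x - D2 x \<partial>lborel) = 0"
      by (rule integral_directional_derivative_eq_0[OF hi _ hlip hsupp deriv]) auto
    then have "(\<integral>x. \<eta> m x * f' x \<partial>lborel) = (\<integral>x. D2 x \<partial>lborel)"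
      using f\<eta> D2i by simp
    also have "\<dots> = (\<Sum>i\<in>H. (\<nu> i \<bullet> e) * (real (Suc m) * (\<integral>x. G i m x \<partial>lborel)))"
      unfolding D2_def using layer(2) by (simp del: of_nat_Suc)
    finally show ?thesis .
  qed
  have "(\<lambda>m. \<integral>x. \<eta> m x * f' x \<partial>lborel) \<longlonglongrightarrow> (\<integral>x. indicat_real K x * f' x \<partial>lborel)"
  proof (rule integral_dominated_convergence[where w = "\<lambda>x. B * indicat_real (cball 0 R) x"])
    show "integrable lborel (\<lambda>x::real^'d::_. B * indicat_real (cball 0 R) x)"
      by (intro integrable_mult_right integrable_real_indicator)
        (auto simp: emeasure_lborel_cball_finite[unfolded infinity_ennreal_def])
    show "AE x in lborel. norm (\<eta> m x * f' x) \<le> B * indicat_real (cball 0 R) x" for m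
    proof (rule AE_I2)
      fix x
      show "norm (\<eta> m x * f' x) \<le> B * indicat_real (cball 0 R) x"
      proof (cases "x \<in> K")
        case True
        then have xR: "norm x \<le> R" using R by auto
        then have "\<bar>f' x\<bar> \<le> B" using B[of x] norm_ge_zero[of e] by linarith
        then have "\<bar>\<eta> m x\<bar> * \<bar>f' x\<bar> \<le> 1 * B"
          using \<eta>01[of m x] by (intro mult_mono) auto
        then show ?thesis using xR by (simp add: abs_mult)
      qed (use \<eta>0 B0 in auto)
    qed
    have "AE x in lborel. \<forall>i\<in>H. \<nu> i \<bullet> x \<noteq> c i"
      by (rule AE_finite_allI[OF H]) (auto intro!: AE_not_in_hyperplane dest: nz)
    then show "AE x in lborel. (\<lambda>m. \<eta> m x * f' x) \<longlonglongrightarrow> indicat_real K x * f' x"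
    proof eventually_elim
      case (elim x)
      have "\<forall>\<^sub>F m in sequentially. \<eta> m x = indicat_real K x"
      proof (cases "x \<in> K")
        case True
        have "\<forall>\<^sub>F m in sequentially. \<forall>i\<in>H. ramp (lev m i x) = 1"
        proof (rule eventually_ball_finite[OF H], rule ballI)
          fix i assume "i \<in> H"
          then have "c i - \<nu> i \<bullet> x > 0"
            using True elim unfolding K by force
          then show "\<forall>\<^sub>F m in sequentially. ramp (lev m i x) = 1"
            using ramp_scaled_eventually[OF tendsto_const, of "c i - \<nu> i \<bullet> x"] by (simp add: lev_def)
        qed
        then show ?thesis
          by eventually_elim (use True in \<open>simp add: \<eta>_def\<close>)
      qed (simp add: \<eta>0)
      then show ?case
        by (intro tendsto_mult tendsto_const tendsto_eventually)
    qed
  qed measurable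
  moreover have "(\<lambda>m. \<integral>x. \<eta> m x * f' x \<partial>lborel) \<longlonglongrightarrow> (\<Sum>i\<in>H. (\<nu> i \<bullet> e) * I i)"
    unfolding layers by (intro tendsto_sum tendsto_mult tendsto_const layer)
  ultimately have "(\<integral>x. indicat_real K x * f' x \<partial>lborel) = (\<Sum>i\<in>H. (\<nu> i \<bullet> e) * I i)"
    by (rule LIMSEQ_unique)
  then show ?thesis unfolding I_def .
qed

section \<open>Facets of convex polytopes\<close>

lemma outward_normal_const:
  assumes "outward_normal K F \<nu>" "F \<subseteq> K" "x \<in> F" "y \<in> F"
  shows "\<nu> \<bullet> x = \<nu> \<bullet> y"
proof -
  have "\<nu> \<bullet> (x - y) \<le> 0" "\<nu> \<bullet> (y - x) \<le> 0"
    using assms unfolding outward_normal_def by blast+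
  then show ?thesis by (simp add: inner_diff_right)
qed

lemma outward_normal_exists:
  fixes K :: "(real^'d::finite) set"
  assumes "polytope K" "F facet_of K"
  obtains \<nu> where "outward_normal K F \<nu>"
proof -
  obtain a b where ab: "a \<noteq> 0" "K \<subseteq> {x. a \<bullet> x \<le> b}" "F = K \<inter> {x. a \<bullet> x = b}"
    using facet_of_polyhedron[OF polytope_imp_polyhedron[OF assms(1)] assms(2)] by metis
  have "outward_normal K F ((1 / norm a) *\<^sub>R a)"
    unfolding outward_normal_def
  proof (intro conjI ballI)
    fix x y assume "x \<in> K" "y \<in> F"
    then have "a \<bullet> (x - y) \<le> 0" using ab by (auto simp: inner_diff_right)
    then show "(1 / norm a) *\<^sub>R a \<bullet> (x - y) \<le> 0" by (simp add: divide_nonpos_nonneg)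
  qed (use ab in simp)
  then show ?thesis by (rule that)
qed

lemma facet_eq_facet:
  assumes "F facet_of K" "G facet_of K" "convex K" "F \<subseteq> G"
  shows "F = G"
proof (rule ccontr)
  assume "F \<noteq> G"
  moreover have "F face_of G"
    using assms by (metis face_of_subset facet_of_imp_face_of facet_of_imp_subset)
  moreover have "convex G"
    using assms face_of_imp_convex facet_of_imp_face_of by blast
  ultimately have "aff_dim F < aff_dim G"
    by (simp add: face_of_aff_dim_lt)
  then show False using assms by (simp add: facet_of_def)
qed

lemma full_dim_aff_dim:
  fixes K :: "(real^'d::finite) set"
  assumes "interior K \<noteq> {}"
  shows "aff_dim K = int CARD('d)"
  using aff_dim_nonempty_interior[OF assms] by simp

text \<open>Dimensions leave no room: a strictly increasing chain of faces from a facet to the body has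
  length two.\<close>

lemma face_containing_facet:
  assumes "convex K" "F facet_of K" "G face_of K" "F \<subseteq> G" "G \<noteq> K"
  shows "G = F"
proof (rule ccontr)
  assume "G \<noteq> F"
  have "F face_of G"
    using assms by (metis face_of_subset facet_of_imp_face_of face_of_imp_subset)
  moreover have "convex G" using assms face_of_imp_convex by blast
  ultimately have "aff_dim F < aff_dim G"
    using \<open>G \<noteq> F\<close> by (metis face_of_aff_dim_lt)
  moreover have "aff_dim G < aff_dim K"
    using assms by (simp add: face_of_aff_dim_lt)
  ultimately show False using assms by (simp add: facet_of_def)
qed

lemma inner_less_on_interior:
  fixes \<nu> :: "'a::euclidean_space"
  assumes "x \<in> interior K" "\<And>y. y \<in> K \<Longrightarrow> \<nu> \<bullet> y \<le> c" "norm \<nu> = 1"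
  shows "\<nu> \<bullet> x < c"
proof -
  obtain e where e: "e > 0" "cball x e \<subseteq> K"
    using assms(1) mem_interior_cball by blast
  have "x + e *\<^sub>R \<nu> \<in> K"
    using e assms by (auto simp: subset_iff dist_norm)
  then have "\<nu> \<bullet> x + e \<le> c"
    using assms(2)[of "x + e *\<^sub>R \<nu>"] assms(3) by (simp add: inner_add_right norm_eq_1)
  with e show ?thesis by simp
qed

locale convex_cell =
  fixes K :: "(real^'d::finite) set" and \<nu> :: "(real^'d) set \<Rightarrow> real^'d"
  assumes poly: "polytope K" and int: "interior K \<noteq> {}"
    and nrm: "\<And>F. F facet_of K \<Longrightarrow> outward_normal K F (\<nu> F)"
begin

text \<open>The value of \<open>\<nu> F\<close> on \<open>F\<close>. It is the same at all points of \<open>F\<close>, see \<open>off_eq\<close>, so the choice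
  is immaterial.\<close>

definition off :: "(real^'d) set \<Rightarrow> real" where
  "off F = \<nu> F \<bullet> (SOME y. y \<in> F)"

lemma convex_K: "convex K" and compact_K: "compact K" and closed_K: "closed K"
  using poly polytope_imp_convex polytope_imp_compact polytope_imp_closed by auto

lemma finite_facets: "finite {F. F facet_of K}"
  by (rule finite_polyhedron_facets[OF polytope_imp_polyhedron[OF poly]])

lemma norm_nu: "F facet_of K \<Longrightarrow> norm (\<nu> F) = 1"
  using nrm by (simp add: outward_normal_def)

lemma off_eq: "F facet_of K \<Longrightarrow> y \<in> F \<Longrightarrow> \<nu> F \<bullet> y = off F"
  unfolding off_def
  by (rule outward_normal_const[OF nrm]) (auto simp: facet_of_imp_subset intro: someI)

lemma off_le: 
  assumes "F facet_of K" "x \<in> K"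
  shows "\<nu> F \<bullet> x \<le> off F"
proof -
  obtain y where y: "y \<in> F" using assms by (auto simp: facet_of_def)
  have "\<nu> F \<bullet> (x - y) \<le> 0"
    using nrm[OF assms(1)] assms(2) y by (simp add: outward_normal_def)
  then show ?thesis using off_eq[OF assms(1) y] by (simp add: inner_diff_right)
qed

lemma off_less_interior: "F facet_of K \<Longrightarrow> x \<in> interior K \<Longrightarrow> \<nu> F \<bullet> x < off F"
  by (rule inner_less_on_interior[OF _ off_le norm_nu])

lemma facet_eq: 
  assumes "F facet_of K"
  shows "F = {x\<in>K. \<nu> F \<bullet> x = off F}"
proof -
  let ?G = "K \<inter> {x. \<nu> F \<bullet> x = off F}"
  have "?G face_of K"
    by (rule face_of_Int_supporting_hyperplane_le[OF convex_K]) (use off_le[OF assms] in auto)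
  moreover have "?G \<noteq> K"
  proof -
    obtain x0 where "x0 \<in> interior K" using int by auto
    then have "\<nu> F \<bullet> x0 < off F" "x0 \<in> K"
      using off_less_interior[OF assms] interior_subset by auto
    then have "x0 \<in> K \<and> x0 \<notin> K \<inter> {x. \<nu> F \<bullet> x = off F}" by simp
    then show ?thesis by metis
  qed
  moreover have "F \<subseteq> ?G"
    using off_eq[OF assms] facet_of_imp_subset[OF assms] by auto
  ultimately have "?G = F"
    using face_containing_facet[OF convex_K assms] by blast
  then show ?thesis by blast
qed

lemma frontier_facets: "frontier K = \<Union>{F. F facet_of K}"
  using rel_frontier_of_polyhedron[OF polytope_imp_polyhedron[OF poly]] rel_frontier_nonempty_interior[OF int]
  by simp

text \<open>A segment from an interior point to a point outside leaves the body through a facet; the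
  inequality of that facet is strict at the first end, so it must fail at the second.\<close>

lemma cell_eq: "K = {x. \<forall>F\<in>{F. F facet_of K}. \<nu> F \<bullet> x \<le> off F}"
proof (intro equalityI subsetI)
  fix x assume x: "x \<in> {x. \<forall>F\<in>{F. F facet_of K}. \<nu> F \<bullet> x \<le> off F}"
  show "x \<in> K"
  proof (rule ccontr)
    assume "x \<notin> K"
    obtain x0 where x0: "x0 \<in> interior K" using int by auto
    have "closed_segment x0 x \<inter> frontier K \<noteq> {}"
      by (rule connected_Int_frontier) (use x0 \<open>x \<notin> K\<close> interior_subset in auto)
    then obtain y where y: "y \<in> closed_segment x0 x" "y \<in> frontier K" by auto
    then obtain F where F: "F facet_of K" "y \<in> F" unfolding frontier_facets by auto
    obtain u where u: "0 \<le> u" "u \<le> 1" "y = (1 - u) *\<^sub>R x0 + u *\<^sub>R x"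
      using y by (auto simp: in_segment)
    have "u < 1"
    proof (rule ccontr)
      assume "\<not> u < 1"
      then have "y = x" using u by simp
      then show False using F \<open>x \<notin> K\<close> facet_of_imp_subset by blast
    qed
    have "(1 - u) * (\<nu> F \<bullet> x0) + u * (\<nu> F \<bullet> x) < (1 - u) * off F + u * off F"
      by (rule add_less_le_mono)
        (use \<open>u < 1\<close> u x F off_less_interior[OF F(1) x0] in \<open>auto intro: mult_left_mono\<close>)
    then have "\<nu> F \<bullet> y < off F"
    proof -
      have "\<nu> F \<bullet> y = (1 - u) * (\<nu> F \<bullet> x0) + u * (\<nu> F \<bullet> x)"
        by (simp add: u(3) inner_add_right)
      also have "\<dots> < (1 - u) * off F + u * off F" by fact
      also have "\<dots> = off F" by (simp add: algebra_simps)
      finally show ?thesis .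
    qed
    then show False using off_eq[OF F] by simp
  qed
qed (use off_le in auto)

lemma rel_interior_facet_less:
  assumes "F facet_of K" "G facet_of K" "F \<noteq> G" "y \<in> rel_interior F"
  shows "\<nu> G \<bullet> y < off G"
proof (rule ccontr)
  assume n: "\<not> ?thesis"
  have yF: "y \<in> F" using assms rel_interior_subset by blast
  then have "y \<in> K" using assms(1) facet_of_imp_subset by blast
  then have "\<nu> G \<bullet> y = off G" using n off_le[OF assms(2)] by fastforce
  then have "y \<in> G" using facet_eq[OF assms(2)] \<open>y \<in> K\<close> by blast
  then have "F \<subseteq> G"
    using subset_of_face_of[of G K F] assms facet_of_imp_face_of facet_of_imp_subset by blast
  then show False using facet_eq_facet assms convex_K by blast
qed

lemma rel_interior_facet_nonempty:
  assumes "F facet_of K" obtains y where "y \<in> rel_interior F"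
  using assms by (metis all_not_in_conv convex_K face_of_imp_convex facet_of_def rel_interior_eq_empty)

text \<open>At a point of the relative interior of \<open>F\<close> the inequalities of all other facets are strict,
  so in a small ball the inequality of \<open>F\<close> is the only constraint.\<close>

lemma half_ball_subset:
  assumes F: "F facet_of K" and y: "y \<in> rel_interior F"
  obtains e where "e > 0" "\<And>x. x \<in> ball y e \<Longrightarrow> \<nu> F \<bullet> x \<le> off F \<Longrightarrow> x \<in> K"
    "\<And>G x. x \<in> ball y e \<Longrightarrow> G facet_of K \<Longrightarrow> x \<in> G \<Longrightarrow> G = F"
proof -
  have "\<exists>e>0. \<forall>x\<in>ball y e. \<forall>G\<in>{G. G facet_of K} - {F}. \<nu> G \<bullet> x < off G"
  proof -
    have "open (\<Inter>G\<in>{G. G facet_of K} - {F}. {x. \<nu> G \<bullet> x < off G})"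
      using finite_facets by (intro open_INT finite_Diff) (auto intro: open_halfspace_lt)
    moreover have "y \<in> (\<Inter>G\<in>{G. G facet_of K} - {F}. {x. \<nu> G \<bullet> x < off G})"
      using rel_interior_facet_less[OF F _ _ y] by auto
    ultimately obtain e where "e > 0" "ball y e \<subseteq> (\<Inter>G\<in>{G. G facet_of K} - {F}. {x. \<nu> G \<bullet> x < off G})"
      by (rule openE)
    then show ?thesis by (intro exI[of _ e]) (auto simp: subset_iff)
  qed
  then obtain e where e: "e > 0" "\<And>x G. x \<in> ball y e \<Longrightarrow> G facet_of K \<Longrightarrow> G \<noteq> F \<Longrightarrow> \<nu> G \<bullet> x < off G"
    by blast
  show ?thesis
  proof (rule that[OF e(1)])
    show "x \<in> K" if "x \<in> ball y e" "\<nu> F \<bullet> x \<le> off F" for x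
    proof -
      have "\<nu> G \<bullet> x \<le> off G" if "G facet_of K" for G
        using that \<open>\<nu> F \<bullet> x \<le> off F\<close> e(2)[OF \<open>x \<in> ball y e\<close>, of G] by (cases "G = F") auto
      then have "x \<in> {x. \<forall>F\<in>{F. F facet_of K}. \<nu> F \<bullet> x \<le> off F}" by simp
      then show ?thesis by (simp only: cell_eq[symmetric])
    qed
    show "G = F" if "x \<in> ball y e" "G facet_of K" "x \<in> G" for G x
    proof (rule ccontr)
      assume "G \<noteq> F"
      then have "\<nu> G \<bullet> x < off G" using e(2) that by blast
      then show False using off_eq[OF that(2,3)] by simp
    qed
  qed
qed

end

text \<open>The facet spans a hyperplane, which has only two unit normals. This compares the normals that
  different cells assign to a shared face.\<close>

lemma facet_normal_unique:
  fixes K :: "(real^'d::finite) set"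
  assumes "F facet_of K" "interior K \<noteq> {}" "norm \<nu> = 1" "norm \<mu> = 1"
    and \<nu>: "\<And>x. x \<in> F \<Longrightarrow> \<nu> \<bullet> x = c" and \<mu>: "\<And>x. x \<in> F \<Longrightarrow> \<mu> \<bullet> x = b"
  shows "\<mu> = \<nu> \<or> \<mu> = - \<nu>"
proof -
  have nz: "\<nu> \<noteq> 0" "\<mu> \<noteq> 0" using assms by force+
  obtain y where y: "y \<in> F" using assms by (auto simp: facet_of_def)
  have dF: "aff_dim F = int CARD('d) - 1"
    using assms full_dim_aff_dim by (simp add: facet_of_def)
  have hull: "affine hull F = {x. a \<bullet> x = e}" if "a \<noteq> 0" "\<And>x. x \<in> F \<Longrightarrow> a \<bullet> x = e" for a :: "real^'d" and e
  proof (rule affine_dim_equal)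
    show "affine hull F \<subseteq> {x. a \<bullet> x = e}"
      using that by (intro hull_minimal affine_hyperplane) auto
    show "aff_dim (affine hull F) = aff_dim {x. a \<bullet> x = e}"
      using that dF by (simp add: aff_dim_hyperplane)
  qed (use y in \<open>auto simp: affine_hyperplane\<close>)
  have eq: "{x. \<nu> \<bullet> x = c} = {x. \<mu> \<bullet> x = b}"
    using hull nz \<nu> \<mu> by metis
  define z where "z = \<mu> - (\<mu> \<bullet> \<nu>) *\<^sub>R \<nu>"
  have n1: "\<nu> \<bullet> \<nu> = 1" "\<mu> \<bullet> \<mu> = 1" using assms by (auto simp: norm_eq_1)
  have "\<nu> \<bullet> z = 0" by (simp add: z_def inner_diff_right n1 inner_commute)
  then have "y + z \<in> {x. \<nu> \<bullet> x = c}"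
    using \<nu>[OF y] by (simp add: inner_add_right)
  then have "\<mu> \<bullet> z = 0"
    using eq \<mu>[OF y] by (auto simp: inner_add_right)
  then have "z \<bullet> z = 0"
    using \<open>\<nu> \<bullet> z = 0\<close> by (simp add: z_def inner_diff_left)
  then have z: "\<mu> = (\<mu> \<bullet> \<nu>) *\<^sub>R \<nu>" by (simp add: z_def)
  then have "norm \<mu> = \<bar>\<mu> \<bullet> \<nu>\<bar> * norm \<nu>" by (metis norm_scaleR)
  then have "\<mu> \<bullet> \<nu> = 1 \<or> \<mu> \<bullet> \<nu> = - 1" using assms by auto
  then show ?thesis using z by auto
qed

section \<open>Partial derivatives\<close>

lemma partial_eqI: "(f has_derivative f') (at x) \<Longrightarrow> partial j f x = f' (axis j 1)"
  unfolding partial_def using frechet_derivative_at by metis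

lemma partial_cong_open:
  assumes "open S" "x \<in> S" "\<And>y. y \<in> S \<Longrightarrow> f y = g y"
  shows "partial j f x = partial j g x"
proof -
  have "(f has_derivative D) (at x) \<longleftrightarrow> (g has_derivative D) (at x)" for D
    using assms has_derivative_transform_within_open[of f D x UNIV S g] has_derivative_transform_within_open[of g D x UNIV S f]
    by metis
  then show ?thesis unfolding partial_def frechet_derivative_def by simp
qed

lemma partial_mult:
  fixes f g :: "real^'d::finite \<Rightarrow> real"
  assumes "f differentiable (at x)" "g differentiable (at x)"
  shows "partial j (\<lambda>x. f x * g x) x = partial j f x * g x + f x * partial j g x"
  using assms unfolding frechet_derivative_works
  by (subst partial_eqI[OF has_derivative_mult]) (auto simp: partial_def)

lemma partial_add:
  assumes "f differentiable (at x)" "g differentiable (at x)"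
  shows "partial j (\<lambda>x. f x + g x) x = partial j f x + partial j g x"
  using assms unfolding frechet_derivative_works
  by (subst partial_eqI[OF has_derivative_add]) (auto simp: partial_def)

lemma partial_sum:
  assumes "\<And>i. i \<in> I \<Longrightarrow> f i differentiable (at x)"
  shows "partial j (\<lambda>x. \<Sum>i\<in>I. f i x) x = (\<Sum>i\<in>I. partial j (f i) x)"
  using assms unfolding frechet_derivative_works
  by (subst partial_eqI[OF has_derivative_sum]) (auto simp: partial_def)

lemma partial_const [simp]: "partial j (\<lambda>x. c) x = 0"
  by (rule partial_eqI[where f' = "\<lambda>x. 0", simplified]) simp

lemma partial_bounded_linear:
  assumes "bounded_linear h" "f differentiable (at x)"
  shows "partial j (\<lambda>x. h (f x)) x = h (partial j f x)"
  using assms(2) unfolding frechet_derivative_works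
  by (subst partial_eqI[OF bounded_linear.has_derivative[OF assms(1)]]) (auto simp: partial_def)

lemma partial_linear: "bounded_linear h \<Longrightarrow> partial j h x = h (axis j 1)"
  by (rule partial_eqI) (rule bounded_linear_imp_has_derivative)

lemma vec_differentiable_iff:
  fixes v :: "real^'d::finite \<Rightarrow> real^'d::_"
  shows "v differentiable (at x) \<longleftrightarrow> (\<forall>i. (\<lambda>x. v x $ i) differentiable (at x))"
proof -
  have "v differentiable (at x) \<longleftrightarrow> (\<forall>i\<in>Basis. (\<lambda>x. v x \<bullet> i) differentiable (at x))"
    by (rule differentiable_componentwise_within)
  also have "\<dots> \<longleftrightarrow> (\<forall>i. (\<lambda>x. v x $ i) differentiable (at x))"
    by (auto simp: Basis_vec_def inner_axis)
  finally show ?thesis .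
qed

lemma partial_nth:
  fixes v :: "real^'d::finite \<Rightarrow> real^'d::_"
  assumes "v differentiable (at x)"
  shows "partial j v x $ i = partial j (\<lambda>x. v x $ i) x"
  using partial_bounded_linear[OF bounded_linear_vec_nth assms] by metis

lemma divh_eq:
  fixes v :: "real^'d::finite \<Rightarrow> real^'d::_"
  assumes "v differentiable (at x)"
  shows "divh v x = (\<Sum>j\<in>UNIV. partial j (\<lambda>x. v x $ j) x)"
  unfolding divh_def using partial_nth[OF assms] by simp

lemma real_polynomial_function_partial:
  fixes p :: "real^'d::finite \<Rightarrow> real"
  assumes "real_polynomial_function p"
  shows "real_polynomial_function (partial j p)" and "p differentiable (at x)"
proof -
  have "(\<forall>x. p differentiable (at x)) \<and> real_polynomial_function (partial j p)"
    using assms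
  proof induction
    case (linear f)
    then have "partial j f = (\<lambda>x. f (axis j 1))"
      by (auto simp: partial_linear)
    then show ?case
      using linear bounded_linear_imp_differentiable by auto
  next
    case (const c)
    have "partial j (\<lambda>x::real^'d. c) = (\<lambda>x. 0)" by auto
    then show ?case by auto
  next
    case (add f g)
    then have "partial j (\<lambda>x. f x + g x) = (\<lambda>x. partial j f x + partial j g x)"
      by (auto simp: partial_add)
    with add show ?case by auto
  next
    case (mult f g)
    then have "partial j (\<lambda>x. f x * g x) = (\<lambda>x. partial j f x * g x + f x * partial j g x)"
      by (auto simp: partial_mult)
    with mult show ?case by auto
  qed
  then show "real_polynomial_function (partial j p)" "p differentiable (at x)" by auto
qed

lemma Ck_polynomial:
  fixes p :: "real^'d::finite \<Rightarrow> real"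
  assumes "real_polynomial_function p"
  shows "Ck m p"
  using assms
proof (induction m arbitrary: p)
  case 0
  then show ?case
    using real_polynomial_function_partial(2)[OF 0] differentiable_imp_continuous_within
    by (auto simp: continuous_on_eq_continuous_at)
qed (auto simp: real_polynomial_function_partial)

lemma Ck1_continuous: "Ck (Suc 0) f \<Longrightarrow> continuous_on UNIV f"
  using differentiable_imp_continuous_within by (auto simp: continuous_on_eq_continuous_at)

lemma Ck1_mult:
  fixes f g :: "real^'d::finite \<Rightarrow> real"
  assumes "Ck (Suc 0) f" "Ck (Suc 0) g"
  shows "Ck (Suc 0) (\<lambda>x. f x * g x)"
proof -
  have "partial j (\<lambda>x. f x * g x) = (\<lambda>x. partial j f x * g x + f x * partial j g x)" for j
    using assms by (auto simp: partial_mult)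
  then show ?thesis
    using assms Ck1_continuous[OF assms(1)] Ck1_continuous[OF assms(2)]
    by (auto intro!: continuous_intros)
qed

lemma Ck1_line_derivative:
  fixes f :: "real^'d::finite \<Rightarrow> real"
  assumes "Ck (Suc 0) f"
  shows "((\<lambda>s. f (x + s *\<^sub>R axis j 1)) has_real_derivative partial j f x) (at 0)"
proof -
  have f: "(f has_derivative frechet_derivative f (at x)) (at (x + 0 *\<^sub>R axis j 1))"
    using assms by (simp add: frechet_derivative_works)
  have "((\<lambda>s. x + s *\<^sub>R axis j 1) has_derivative (\<lambda>s. s *\<^sub>R axis j 1)) (at 0)"
    by (auto intro!: derivative_eq_intros)
  from diff_chain_at[OF this f]
  have "((\<lambda>s. f (x + s *\<^sub>R axis j 1)) has_derivative (\<lambda>s. frechet_derivative f (at x) (s *\<^sub>R axis j 1))) (at 0)"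
    by (simp add: o_def)
  moreover have "frechet_derivative f (at x) (s *\<^sub>R axis j 1) = partial j f x * s" for s
    using linear_scale[OF linear_frechet_derivative, of f "at x" s "axis j 1"] assms
    by (simp add: partial_def mult.commute)
  ultimately show ?thesis
    by (simp add: has_field_derivative_def)
qed

section \<open>Face integrals and the divergence theorem on a cell\<close>

lemma closest_point_normal:
  fixes \<nu> :: "'a::euclidean_space"
  assumes "\<And>y. y \<in> F \<Longrightarrow> \<nu> \<bullet> y = c" "x \<in> F"
  shows "closest_point (affine hull F) (x + s *\<^sub>R \<nu>) = x"
proof -
  have h: "affine hull F \<subseteq> {x. \<nu> \<bullet> x = c}"
    using assms by (intro hull_minimal affine_hyperplane) auto
  have "x = closest_point (affine hull F) (x + s *\<^sub>R \<nu>)"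
  proof (rule closest_point_unique)
    show "\<forall>z\<in>affine hull F. dist (x + s *\<^sub>R \<nu>) x \<le> dist (x + s *\<^sub>R \<nu>) z"
    proof
      fix z assume "z \<in> affine hull F"
      then have z: "\<nu> \<bullet> z = \<nu> \<bullet> x" using h assms by auto
      have "(norm (s *\<^sub>R \<nu>))\<^sup>2 \<le> (norm (s *\<^sub>R \<nu>))\<^sup>2 + (norm (x - z))\<^sup>2" by simp
      also have "\<dots> = (norm (s *\<^sub>R \<nu> + (x - z)))\<^sup>2"
        unfolding power2_norm_eq_inner
        using z by (simp add: inner_add_left inner_add_right inner_diff_left inner_diff_right inner_commute)
      finally have "norm (s *\<^sub>R \<nu>) \<le> norm (s *\<^sub>R \<nu> + (x - z))"
        by (rule power2_le_imp_le) simp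
      moreover have "s *\<^sub>R \<nu> + (x - z) = x + s *\<^sub>R \<nu> - z" by simp
      ultimately show "dist (x + s *\<^sub>R \<nu>) x \<le> dist (x + s *\<^sub>R \<nu>) z"
        by (simp add: dist_norm)
    qed
  qed (use assms in \<open>auto simp: affine_imp_convex hull_inc\<close>)
  then show ?thesis by simp
qed

lemma face_integral_slab:
  assumes "norm \<nu> = 1" "\<And>y. y \<in> F \<Longrightarrow> \<nu> \<bullet> y = c"
  shows "face_integral \<nu> F f = (\<integral>z. slab_fun \<nu> c F f z \<partial>lebesgue)"
  unfolding face_integral_def set_lebesgue_integral_def
proof (rule arg_cong[where f = "integral\<^sup>L lebesgue"], rule ext)
  fix z
  let ?S = "{x + s *\<^sub>R \<nu> |x s. x \<in> F \<and> 0 \<le> s \<and> s \<le> 1}"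
  have n1: "\<nu> \<bullet> \<nu> = 1" using assms by (simp add: norm_eq_1)
  show "indicat_real ?S z *\<^sub>R f (closest_point (affine hull F) z) = slab_fun \<nu> c F f z"
  proof (cases "z \<in> ?S")
    case True
    then obtain x s where xs: "z = x + s *\<^sub>R \<nu>" "x \<in> F" "0 \<le> s" "s \<le> 1" by auto
    then have "\<nu> \<bullet> z - c = s" using assms n1 by (simp add: inner_add_right)
    then show ?thesis
      using xs True closest_point_normal[of F \<nu> c x s] assms by (simp add: slab_fun_def)
  next
    case False
    have "\<not> (0 \<le> \<nu> \<bullet> z - c \<and> \<nu> \<bullet> z - c \<le> 1 \<and> z - (\<nu> \<bullet> z - c) *\<^sub>R \<nu> \<in> F)"
    proof
      assume "0 \<le> \<nu> \<bullet> z - c \<and> \<nu> \<bullet> z - c \<le> 1 \<and> z - (\<nu> \<bullet> z - c) *\<^sub>R \<nu> \<in> F"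
      moreover have "z = (z - (\<nu> \<bullet> z - c) *\<^sub>R \<nu>) + (\<nu> \<bullet> z - c) *\<^sub>R \<nu>" by simp
      ultimately show False using False by blast
    qed
    then have "slab_fun \<nu> c F f z = 0"
      unfolding slab_fun_def by (rule if_not_P)
    with False show ?thesis by simp
  qed
qed

definition flat_face :: "real^'d \<Rightarrow> (real^'d) set \<Rightarrow> bool" where
  "flat_face \<nu> F \<longleftrightarrow> norm \<nu> = 1 \<and> compact F \<and> (\<exists>c. \<forall>y\<in>F. \<nu> \<bullet> y = c)"

lemma face_integral_cong:
  assumes "flat_face \<nu> F" "\<And>x. x \<in> F \<Longrightarrow> f x = g x"
  shows "face_integral \<nu> F f = face_integral \<nu> F g"
proof -
  obtain c where "norm \<nu> = 1" "\<And>y. y \<in> F \<Longrightarrow> \<nu> \<bullet> y = c"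
    using assms(1) by (auto simp: flat_face_def)
  then show ?thesis
    using assms(2) by (simp add: face_integral_slab slab_fun_def cong: if_cong)
qed

lemma face_integral_0: "flat_face \<nu> F \<Longrightarrow> (\<And>x. x \<in> F \<Longrightarrow> f x = 0) \<Longrightarrow> face_integral \<nu> F f = 0"
  using face_integral_cong[of \<nu> F f "\<lambda>x. 0"] by (simp add: face_integral_def)

lemma slab_fun_integrable:
  fixes F :: "(real^'d::finite) set"
  assumes "norm \<nu> = 1" "\<And>y. y \<in> F \<Longrightarrow> \<nu> \<bullet> y = c" "compact F" "continuous_on UNIV f"
  shows "integrable lborel (slab_fun \<nu> c F f)"
proof -
  obtain R where R: "\<And>x. x \<in> F \<Longrightarrow> norm x \<le> R"
    using compact_imp_bounded[OF assms(3)] unfolding bounded_iff by auto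
  obtain B where B: "\<And>x. x \<in> F \<Longrightarrow> \<bar>f x\<bar> \<le> B"
    using compact_imp_bounded[OF compact_continuous_image[OF continuous_on_subset[OF assms(4)] assms(3)]]
    unfolding bounded_iff by auto
  have [measurable]: "f \<in> borel_measurable borel" "F \<in> sets borel"
    using assms by (auto intro: borel_measurable_continuous_onI borel_closed compact_imp_closed)
  show ?thesis
  proof (rule integrable_bounded_support)
    show "slab_fun \<nu> c F f \<in> borel_measurable borel"
      unfolding slab_fun_def by measurable
    show "\<bar>slab_fun \<nu> c F f z\<bar> \<le> \<bar>B\<bar> * indicat_real (cball 0 (R + 1)) z" for z
    proof (cases "0 \<le> \<nu> \<bullet> z - c \<and> \<nu> \<bullet> z - c \<le> 1 \<and> z - (\<nu> \<bullet> z - c) *\<^sub>R \<nu> \<in> F")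
      case True
      have "norm z = norm ((z - (\<nu> \<bullet> z - c) *\<^sub>R \<nu>) + (\<nu> \<bullet> z - c) *\<^sub>R \<nu>)" by simp
      also have "\<dots> \<le> norm (z - (\<nu> \<bullet> z - c) *\<^sub>R \<nu>) + norm ((\<nu> \<bullet> z - c) *\<^sub>R \<nu>)"
        by (rule norm_triangle_ineq)
      also have "\<dots> \<le> R + 1"
        using True R assms(1) by (intro add_mono) auto
      finally have "norm z \<le> R + 1" .
      moreover have "\<bar>f (z - (\<nu> \<bullet> z - c) *\<^sub>R \<nu>)\<bar> \<le> \<bar>B\<bar>"
        using B True by (meson abs_ge_self order_trans)
      ultimately show ?thesis using True by (simp add: slab_fun_def)
    next
      case False
      then have "slab_fun \<nu> c F f z = 0" unfolding slab_fun_def by (rule if_not_P)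
      then show ?thesis by simp
    qed
  qed
qed

lemma face_integral_lborel:
  fixes F :: "(real^'d::finite) set"
  assumes "norm \<nu> = 1" "\<And>y. y \<in> F \<Longrightarrow> \<nu> \<bullet> y = c" "compact F" "continuous_on UNIV f"
  shows "face_integral \<nu> F f = (\<integral>z. slab_fun \<nu> c F f z \<partial>lborel)"
  using face_integral_slab[OF assms(1,2), where f = f] slab_fun_integrable[OF assms]
  by (simp add: integral_completion)

lemma face_integral_lincomb:
  fixes F :: "(real^'d::finite) set"
  assumes "flat_face \<nu> F" "continuous_on UNIV f" "continuous_on UNIV g"
  shows "face_integral \<nu> F (\<lambda>x. a * f x + b * g x) = a * face_integral \<nu> F f + b * face_integral \<nu> F g"
proof -
  obtain c where c: "norm \<nu> = 1" "\<And>y. y \<in> F \<Longrightarrow> \<nu> \<bullet> y = c" "compact F"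
    using assms(1) by (auto simp: flat_face_def)
  have cont: "continuous_on UNIV (\<lambda>x. a * f x + b * g x)"
    using assms by (intro continuous_intros)
  have "slab_fun \<nu> c F (\<lambda>x. a * f x + b * g x) z = a * slab_fun \<nu> c F f z + b * slab_fun \<nu> c F g z" for z
    by (simp add: slab_fun_def)
  then show ?thesis
    using face_integral_lborel[OF c cont] face_integral_lborel[OF c assms(2)] face_integral_lborel[OF c assms(3)]
      slab_fun_integrable[OF c assms(2)] slab_fun_integrable[OF c assms(3)]
    by simp
qed

lemma face_integral_add:
  fixes F :: "(real^'d::finite) set"
  assumes "flat_face \<nu> F" "continuous_on UNIV f" "continuous_on UNIV g"
  shows "face_integral \<nu> F (\<lambda>x. f x + g x) = face_integral \<nu> F f + face_integral \<nu> F g"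
    and "face_integral \<nu> F (\<lambda>x. f x - g x) = face_integral \<nu> F f - face_integral \<nu> F g"
    and "face_integral \<nu> F (\<lambda>x. a * f x) = a * face_integral \<nu> F f"
  using face_integral_lincomb[OF assms, where a = 1 and b = 1] face_integral_lincomb[OF assms, where a = 1 and b = "-1"]
    face_integral_lincomb[OF assms, where a = a and b = 0] by auto

lemma face_integral_sum:
  fixes F :: "(real^'d::finite) set"
  assumes "flat_face \<nu> F" "finite I" "\<And>i. i \<in> I \<Longrightarrow> continuous_on UNIV (f i)"
  shows "face_integral \<nu> F (\<lambda>x. \<Sum>i\<in>I. f i x) = (\<Sum>i\<in>I. face_integral \<nu> F (f i))"
  using assms(2,3)
proof (induction I rule: finite_induct)
  case empty
  then show ?case using face_integral_0[OF assms(1)] by simp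
next
  case (insert i I)
  then show ?case
    by (simp add: face_integral_add[OF assms(1)] continuous_on_sum)
qed

text \<open>The prism in direction \<open>- \<nu>\<close> is the prism in direction \<open>\<nu>\<close> translated by \<open>- \<nu>\<close>, and
  the extended integrand is constant along \<open>\<nu>\<close>.\<close>

lemma face_integral_uminus_normal:
  fixes F :: "(real^'d::finite) set"
  assumes "flat_face \<nu> F" "continuous_on UNIV f"
  shows "face_integral (- \<nu>) F f = face_integral \<nu> F f"
proof -
  obtain c where c: "norm \<nu> = 1" "\<And>y. y \<in> F \<Longrightarrow> \<nu> \<bullet> y = c" "compact F"
    using assms(1) by (auto simp: flat_face_def)
  have c': "norm (- \<nu>) = 1" "\<And>y. y \<in> F \<Longrightarrow> - \<nu> \<bullet> y = - c" "compact F"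
    using c by auto
  have n1: "\<nu> \<bullet> \<nu> = 1" using c by (simp add: norm_eq_1)
  have sl: "slab_fun (- \<nu>) (- c) F f ((- \<nu>) + z) = slab_fun \<nu> c F f z" for z
  proof -
    have A: "- \<nu> \<bullet> (- \<nu> + z) - (- c) = 1 - (\<nu> \<bullet> z - c)"
      by (simp add: n1 inner_diff_right)
    have B: "(- \<nu> + z) - (1 - (\<nu> \<bullet> z - c)) *\<^sub>R (- \<nu>) = z - (\<nu> \<bullet> z - c) *\<^sub>R \<nu>"
      by (simp add: algebra_simps)
    show ?thesis
      unfolding slab_fun_def A B by auto
  qed
  have "face_integral (- \<nu>) F f = (\<integral>z. slab_fun (- \<nu>) (- c) F f z \<partial>distr lborel borel ((+) (- \<nu>)))"
    using face_integral_lborel[OF c' assms(2)] by (simp add: lborel_distr_plus)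
  also have "\<dots> = (\<integral>z. slab_fun (- \<nu>) (- c) F f ((- \<nu>) + z) \<partial>lborel)"
    by (subst integral_distr) (use slab_fun_integrable[OF c' assms(2)] in auto)
  also have "\<dots> = face_integral \<nu> F f"
    unfolding sl using face_integral_lborel[OF c assms(2)] by simp
  finally show ?thesis .
qed

lemma (in convex_cell) flat_facet: "F facet_of K \<Longrightarrow> flat_face (\<nu> F) F"
  unfolding flat_face_def
  using norm_nu off_eq face_of_imp_compact[OF convex_K compact_K] facet_of_imp_face_of by blast

text \<open>Near the midpoint of the prism above \<open>y\<close> the extended integrand would be positive on an open
  set. This turns an identity between face integrals into a pointwise one.\<close>

lemma (in convex_cell) face_integral_eq_0_imp:
  assumes F: "F facet_of K" and f: "continuous_on UNIV f" "\<And>x. x \<in> F \<Longrightarrow> 0 \<le> f x"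
    and "face_integral (\<nu> F) F f = 0" and y: "y \<in> rel_interior F"
  shows "f y = 0"
proof (rule ccontr)
  assume "f y \<noteq> 0"
  have yF: "y \<in> F" using y rel_interior_subset by blast
  then have "f y > 0" using f(2) \<open>f y \<noteq> 0\<close> by force
  define c where "c = off F"
  define \<pi> where "\<pi> z = z - (\<nu> F \<bullet> z - c) *\<^sub>R \<nu> F" for z
  have c: "norm (\<nu> F) = 1" "\<And>y. y \<in> F \<Longrightarrow> \<nu> F \<bullet> y = c" "compact F"
    using flat_facet[OF F] off_eq[OF F] by (auto simp: flat_face_def c_def)
  have n1: "\<nu> F \<bullet> \<nu> F = 1" using c by (simp add: norm_eq_1)
  obtain e where e: "e > 0" "\<And>x. x \<in> ball y e \<Longrightarrow> \<nu> F \<bullet> x \<le> off F \<Longrightarrow> x \<in> K"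
    using half_ball_subset[OF F y] by metis
  define W where "W = {z. 0 < \<nu> F \<bullet> z - c} \<inter> {z. \<nu> F \<bullet> z - c < 1} \<inter> {z. dist y (\<pi> z) < e} \<inter> {z. 0 < f (\<pi> z)}"
  have \<pi>c: "continuous_on UNIV \<pi>" unfolding \<pi>_def by (intro continuous_intros)
  have f\<pi>: "continuous_on UNIV (\<lambda>z. f (\<pi> z))"
    using continuous_on_compose2[OF f(1) \<pi>c] by auto
  have "open W"
    unfolding W_def using \<pi>c f\<pi>
    by (intro open_Int open_Collect_less continuous_intros) auto
  have y2: "y + (1/2) *\<^sub>R \<nu> F \<in> W"
    using c(2)[OF yF] n1 e \<open>f y > 0\<close> by (simp add: W_def \<pi>_def inner_add_right)
  have pos: "slab_fun (\<nu> F) c F f z > 0" if "z \<in> W" for z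
  proof -
    have "\<nu> F \<bullet> \<pi> z = off F"
      by (simp add: \<pi>_def inner_diff_right n1 c_def)
    moreover from this have "\<pi> z \<in> K" using e(2)[of "\<pi> z"] that by (simp add: W_def)
    ultimately have "\<pi> z \<in> F" using facet_eq[OF F] by blast
    then show ?thesis using that by (simp add: slab_fun_def \<pi>_def W_def)
  qed
  have "AE z in lborel. slab_fun (\<nu> F) c F f z = 0"
  proof (subst integral_nonneg_eq_0_iff_AE[symmetric])
    show "integrable lborel (slab_fun (\<nu> F) c F f)" by (rule slab_fun_integrable[OF c f(1)])
    show "AE z in lborel. 0 \<le> slab_fun (\<nu> F) c F f z"
      by (rule AE_I2) (simp add: slab_fun_def f(2))
    show "(\<integral>z. slab_fun (\<nu> F) c F f z \<partial>lborel) = 0"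
      using face_integral_lborel[OF c f(1)] assms(4) by simp
  qed
  then have "AE z in lborel. z \<notin> W"
    by eventually_elim (use pos in force)
  then have "AE z in lebesgue. z \<in> - W"
    by (intro AE_completion) simp
  then have "y + (1/2) *\<^sub>R \<nu> F \<in> - W"
    using mem_closed_if_AE_lebesgue[of "- W"] \<open>open W\<close> by blast
  with y2 show False by simp
qed

text \<open>The half-space version, applied to each component of \<open>g\<close> in the direction of its coordinate
  axis and summed.\<close>

theorem divergence_theorem_cell:
  fixes K :: "(real^'d::{finite,wellorder}) set" and g :: "real^'d::_ \<Rightarrow> real^'d::_"
  assumes "convex_cell K \<nu>" and g: "\<And>j. Ck (Suc 0) (\<lambda>x. g x $ j)"
  shows "(LINT x:K|lebesgue. divh g x) = (\<Sum>F | F facet_of K. face_integral (\<nu> F) F (\<lambda>x. \<nu> F \<bullet> g x))"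
proof -
  interpret convex_cell K \<nu> by fact
  have proper: "\<exists>y. \<nu> F \<bullet> y = off F \<and> \<nu> G \<bullet> y \<noteq> off G"
    if "F \<in> {F. F facet_of K}" "G \<in> {F. F facet_of K}" "F \<noteq> G" for F G
    using that rel_interior_facet_nonempty[of F] rel_interior_facet_less[of F G] off_eq[of F] rel_interior_subset[of F]
    by (metis mem_Collect_eq order_less_irrefl subsetD)
  have Kb[measurable]: "K \<in> sets borel" using closed_K by auto
  have gc: "continuous_on UNIV (\<lambda>x. g x $ j)" "continuous_on UNIV (partial j (\<lambda>x. g x $ j))" for j
    using Ck1_continuous[OF g] g by auto
  have scalar: "(LINT x:K|lebesgue. partial j (\<lambda>x. g x $ j) x)
      = (\<Sum>F | F facet_of K. face_integral (\<nu> F) F (\<lambda>x. \<nu> F $ j * g x $ j))" (is ?eq)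
    and int: "set_integrable lebesgue K (partial j (\<lambda>x. g x $ j))" for j
  proof -
    have [measurable]: "partial j (\<lambda>x. g x $ j) \<in> borel_measurable borel"
      using gc by (intro borel_measurable_continuous_onI)
    have "K = {x. \<forall>F\<in>{F. F facet_of K}. \<nu> F \<bullet> x \<le> off F}"
      by (rule cell_eq)
    note G = divergence_theorem_halfspaces[OF finite_facets _ this compact_imp_bounded[OF compact_K] proper gc(1)[of j] gc(2)[of j] Ck1_line_derivative[OF g]]
    have sl: "slab_fun (\<nu> F) (off F) K (\<lambda>x. g x $ j) = slab_fun (\<nu> F) (off F) F (\<lambda>x. g x $ j)"
      if F: "F facet_of K" for F
    proof
      fix z
      have "\<nu> F \<bullet> (z - (\<nu> F \<bullet> z - off F) *\<^sub>R \<nu> F) = off F"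
        using norm_nu[OF F] by (simp add: inner_diff_right norm_eq_1)
      then have "z - (\<nu> F \<bullet> z - off F) *\<^sub>R \<nu> F \<in> K \<longleftrightarrow> z - (\<nu> F \<bullet> z - off F) *\<^sub>R \<nu> F \<in> F"
        using facet_eq[OF F] by blast
      then show "slab_fun (\<nu> F) (off F) K (\<lambda>x. g x $ j) z = slab_fun (\<nu> F) (off F) F (\<lambda>x. g x $ j) z"
        unfolding slab_fun_def by simp
    qed
    have "(LINT x:K|lebesgue. partial j (\<lambda>x. g x $ j) x) = (\<integral>x. indicat_real K x * partial j (\<lambda>x. g x $ j) x \<partial>lborel)"
      unfolding set_lebesgue_integral_def by (subst integral_completion) auto
    also have "\<dots> = (\<Sum>F | F facet_of K. (\<nu> F \<bullet> axis j 1) * (\<integral>z. slab_fun (\<nu> F) (off F) F (\<lambda>x. g x $ j) z \<partial>lborel))"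
      by (subst G) (auto simp: norm_nu sl)
    also have "\<dots> = (\<Sum>F | F facet_of K. face_integral (\<nu> F) F (\<lambda>x. \<nu> F $ j * g x $ j))"
    proof (rule sum.cong)
      fix F assume "F \<in> {F. F facet_of K}"
      then have F: "F facet_of K" by simp
      have "(\<integral>z. slab_fun (\<nu> F) (off F) F (\<lambda>x. g x $ j) z \<partial>lborel) = face_integral (\<nu> F) F (\<lambda>x. g x $ j)"
        by (rule face_integral_lborel[symmetric])
          (use F norm_nu off_eq gc flat_facet in \<open>auto simp: flat_face_def\<close>)
      then show "(\<nu> F \<bullet> axis j 1) * (\<integral>z. slab_fun (\<nu> F) (off F) F (\<lambda>x. g x $ j) z \<partial>lborel)
          = face_integral (\<nu> F) F (\<lambda>x. \<nu> F $ j * g x $ j)"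
        using face_integral_add(3)[OF flat_facet[OF F] gc(1) gc(1)] by (simp add: inner_axis)
    qed simp
    finally show ?eq .
    obtain R where R: "K \<subseteq> cball 0 R"
      using compact_imp_bounded[OF compact_K] unfolding bounded_iff by (auto simp: subset_iff)
    obtain B where B: "\<And>x. x \<in> K \<Longrightarrow> \<bar>partial j (\<lambda>x. g x $ j) x\<bar> \<le> B"
      using compact_imp_bounded[OF compact_continuous_image[OF continuous_on_subset[OF gc(2)[of j]] compact_K]]
      unfolding bounded_iff by auto
    have "integrable lborel (\<lambda>x. indicat_real K x * partial j (\<lambda>x. g x $ j) x)"
    proof (rule integrable_bounded_support)
      show "\<bar>indicat_real K x * partial j (\<lambda>x. g x $ j) x\<bar> \<le> \<bar>B\<bar> * indicat_real (cball 0 R) x" for x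
        using B[of x] R by (auto simp: indicator_def)
    qed measurable
    then show "set_integrable lebesgue K (partial j (\<lambda>x. g x $ j))"
      unfolding set_integrable_def by (simp add: integrable_completion)
  qed
  have "g differentiable (at x)" for x
    using g by (auto simp: vec_differentiable_iff)
  then have "(LINT x:K|lebesgue. divh g x) = (LINT x:K|lebesgue. (\<Sum>j\<in>UNIV. partial j (\<lambda>x. g x $ j) x))"
    by (simp add: divh_eq)
  also have "\<dots> = (\<Sum>j\<in>UNIV. LINT x:K|lebesgue. partial j (\<lambda>x. g x $ j) x)"
    unfolding set_lebesgue_integral_def scaleR_sum_right
    by (rule Bochner_Integration.integral_sum) (use int in \<open>simp add: set_integrable_def\<close>)
  also have "\<dots> = (\<Sum>F | F facet_of K. \<Sum>j\<in>UNIV. face_integral (\<nu> F) F (\<lambda>x. \<nu> F $ j * g x $ j))"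
    unfolding scalar by (rule sum.swap)
  also have "\<dots> = (\<Sum>F | F facet_of K. face_integral (\<nu> F) F (\<lambda>x. \<Sum>j\<in>UNIV. \<nu> F $ j * g x $ j))"
    by (intro sum.cong refl face_integral_sum[symmetric] flat_facet) (auto intro!: continuous_intros gc)
  finally show ?thesis
    by (simp add: inner_vec_def)
qed

section \<open>Polynomials and the local spaces\<close>

definition monomial :: "('d \<Rightarrow> nat) \<Rightarrow> real^'d \<Rightarrow> real" where
  "monomial \<alpha> x = (\<Prod>i\<in>UNIV. x $ i ^ \<alpha> i)"

lemma finite_multi_indices: "finite {\<alpha>::'d::finite \<Rightarrow> nat. (\<Sum>i\<in>UNIV. \<alpha> i) \<le> j}"
proof (rule finite_subset)
  show "{\<alpha>::'d \<Rightarrow> nat. (\<Sum>i\<in>UNIV. \<alpha> i) \<le> j} \<subseteq> (UNIV :: 'd set) \<rightarrow>\<^sub>E {..j}"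
  proof
    fix \<alpha> :: "'d \<Rightarrow> nat" assume a: "\<alpha> \<in> {\<alpha>. (\<Sum>i\<in>UNIV. \<alpha> i) \<le> j}"
    have "\<alpha> i \<le> (\<Sum>i\<in>UNIV. \<alpha> i)" for i by (rule member_le_sum) auto
    with a show "\<alpha> \<in> UNIV \<rightarrow>\<^sub>E {..j}" by (auto intro: order_trans)
  qed
qed (intro finite_PiE; simp)

lemma polys_iff:
  "p \<in> polys j \<longleftrightarrow> (\<exists>c. p = (\<lambda>x. \<Sum>\<alpha> | (\<Sum>i\<in>UNIV. \<alpha> i) \<le> j. c \<alpha> * monomial \<alpha> x))"
  by (auto simp: polys_def monomial_def fun_eq_iff)

lemma polys_lincomb:
  assumes "p \<in> polys j" "q \<in> polys j"
  shows "(\<lambda>x. a * p x + b * q x) \<in> polys j"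
proof -
  obtain c d where "p = (\<lambda>x. \<Sum>\<alpha> | (\<Sum>i\<in>UNIV. \<alpha> i) \<le> j. c \<alpha> * monomial \<alpha> x)"
    "q = (\<lambda>x. \<Sum>\<alpha> | (\<Sum>i\<in>UNIV. \<alpha> i) \<le> j. d \<alpha> * monomial \<alpha> x)"
    using assms unfolding polys_iff by blast
  then have "(\<lambda>x. a * p x + b * q x) = (\<lambda>x. \<Sum>\<alpha> | (\<Sum>i\<in>UNIV. \<alpha> i) \<le> j. (a * c \<alpha> + b * d \<alpha>) * monomial \<alpha> x)"
    by (simp add: sum_distrib_left sum.distrib algebra_simps)
  then show ?thesis unfolding polys_iff by (intro exI[of _ "\<lambda>\<alpha>. a * c \<alpha> + b * d \<alpha>"])
qed

lemma polys_0: "(\<lambda>x. 0) \<in> polys j"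
  unfolding polys_iff by (rule exI[of _ "\<lambda>_. 0"]) simp

lemma polys_sum:
  assumes "\<And>i. i \<in> I \<Longrightarrow> f i \<in> polys j"
  shows "(\<lambda>x. \<Sum>i\<in>I. f i x) \<in> polys j"
  using assms
proof (induction I rule: infinite_finite_induct)
  case (insert i I)
  then show ?case using polys_lincomb[of "f i" j "\<lambda>x. \<Sum>i\<in>I. f i x" 1 1] by simp
qed (simp_all add: polys_0)

lemma polys_cmult: "p \<in> polys j \<Longrightarrow> (\<lambda>x. a * p x) \<in> polys j"
  using polys_lincomb[of p j p a 0] by simp

lemma monomial_in_polys:
  fixes \<alpha> :: "'d::finite \<Rightarrow> nat"
  assumes "(\<Sum>i\<in>UNIV. \<alpha> i) \<le> j"
  shows "monomial \<alpha> \<in> polys j"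
proof -
  have "monomial \<alpha> = (\<lambda>x. \<Sum>\<beta> | (\<Sum>i\<in>UNIV. \<beta> i) \<le> j. (if \<beta> = \<alpha> then 1 else 0) * monomial \<beta> x)"
  proof
    fix x :: "real^'d"
    have "(\<Sum>\<beta> | (\<Sum>i\<in>UNIV. \<beta> i) \<le> j. (if \<beta> = \<alpha> then 1 else 0) * monomial \<beta> x)
        = (\<Sum>\<beta> | (\<Sum>i\<in>UNIV. \<beta> i) \<le> j. if \<beta> = \<alpha> then monomial \<beta> x else 0)"
      by (intro sum.cong) auto
    also have "\<dots> = monomial \<alpha> x"
      by (subst sum.delta[OF finite_multi_indices]) (use assms in auto)
    finally show "monomial \<alpha> x = (\<Sum>\<beta> | (\<Sum>i\<in>UNIV. \<beta> i) \<le> j. (if \<beta> = \<alpha> then 1 else 0) * monomial \<beta> x)"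
      by simp
  qed
  then show ?thesis unfolding polys_iff by (intro exI[of _ "\<lambda>\<beta>. if \<beta> = \<alpha> then 1 else 0"])
qed

lemma polys_mono:
  fixes p :: "real^'d::finite \<Rightarrow> real"
  assumes "p \<in> polys j" "j \<le> j'"
  shows "p \<in> polys j'"
proof -
  obtain c where p: "p = (\<lambda>x. \<Sum>\<alpha> | (\<Sum>i\<in>UNIV. \<alpha> i) \<le> j. c \<alpha> * monomial \<alpha> x)"
    using assms unfolding polys_iff by blast
  show ?thesis
    unfolding p using assms(2) by (intro polys_sum polys_cmult monomial_in_polys) auto
qed

lemma real_polynomial_function_nth [intro]: "real_polynomial_function (\<lambda>x::real^'d::finite. x $ i)"
  by (rule real_polynomial_function.intros(1)) (rule bounded_linear_vec_nth)

lemma real_polynomial_function_monomial: "real_polynomial_function (monomial \<alpha> :: real^'d::finite \<Rightarrow> real)"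
  unfolding monomial_def by (intro real_polynomial_function_prod real_polynomial_function_power real_polynomial_function_nth) auto

lemma polys_polynomial:
  fixes p :: "real^'d::finite \<Rightarrow> real"
  assumes "p \<in> polys j" shows "real_polynomial_function p"
proof -
  obtain c where p: "p = (\<lambda>x. \<Sum>\<alpha> | (\<Sum>i\<in>UNIV. \<alpha> i) \<le> j. c \<alpha> * monomial \<alpha> x)"
    using assms unfolding polys_iff by blast
  show ?thesis unfolding p
    by (intro real_polynomial_function_sum finite_multi_indices real_polynomial_function.intros(4)
        real_polynomial_function.intros(2) real_polynomial_function_monomial)
qed

lemma partial_monomial:
  fixes \<alpha> :: "'d::finite \<Rightarrow> nat"
  shows "partial i (monomial \<alpha>) x = real (\<alpha> i) * monomial (\<alpha>(i := \<alpha> i - 1)) x"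
proof -
  define P where "P = (\<Prod>k\<in>UNIV - {i}. x $ k ^ \<alpha> k)"
  have line: "monomial \<alpha> (x + s *\<^sub>R axis i 1) = (x $ i + s) ^ \<alpha> i * P" for s
  proof -
    have "(\<Prod>k\<in>UNIV - {i}. (x + s *\<^sub>R axis i 1) $ k ^ \<alpha> k) = P"
      unfolding P_def by (intro prod.cong refl) (auto simp: axis_def)
    then show ?thesis
      unfolding monomial_def by (subst prod.remove[of UNIV i]) (auto simp: axis_def)
  qed
  have "((\<lambda>s. monomial \<alpha> (x + s *\<^sub>R axis i 1)) has_real_derivative partial i (monomial \<alpha>) x) (at 0)"
    by (rule Ck1_line_derivative[OF Ck_polynomial[OF real_polynomial_function_monomial]])
  moreover have "((\<lambda>s. (x $ i + s) ^ \<alpha> i * P) has_real_derivative real (\<alpha> i) * x $ i ^ (\<alpha> i - 1) * P) (at 0)"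
    by (auto intro!: derivative_eq_intros)
  ultimately have "partial i (monomial \<alpha>) x = real (\<alpha> i) * x $ i ^ (\<alpha> i - 1) * P"
    unfolding line by (rule DERIV_unique)
  moreover have "x $ i ^ (\<alpha> i - 1) * P = monomial (\<alpha>(i := \<alpha> i - 1)) x"
    unfolding monomial_def P_def
    by (subst prod.remove[of UNIV i]) (auto intro!: prod.cong)
  ultimately show ?thesis by (simp add: mult.assoc)
qed

lemma polys_partial_expand:
  fixes c :: "('d::finite \<Rightarrow> nat) \<Rightarrow> real"
  shows "partial i (\<lambda>x. \<Sum>\<alpha> | (\<Sum>i\<in>UNIV. \<alpha> i) \<le> j. c \<alpha> * monomial \<alpha> x) x
      = (\<Sum>\<alpha> | (\<Sum>i\<in>UNIV. \<alpha> i) \<le> j. c \<alpha> * real (\<alpha> i) * monomial (\<alpha>(i := \<alpha> i - 1)) x)"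
proof -
  have d: "monomial \<alpha> differentiable (at x)" for \<alpha> :: "'d \<Rightarrow> nat"
    by (rule real_polynomial_function_partial(2)[OF real_polynomial_function_monomial])
  have "partial i (\<lambda>x. c \<alpha> * monomial \<alpha> x) x = c \<alpha> * real (\<alpha> i) * monomial (\<alpha>(i := \<alpha> i - 1)) x" for \<alpha>
    using d by (subst partial_mult) (auto simp: partial_monomial)
  then show ?thesis
    using d by (subst partial_sum) auto
qed

lemma sum_decr:
  fixes \<alpha> :: "'d::finite \<Rightarrow> nat"
  assumes "(\<Sum>i\<in>UNIV. \<alpha> i) \<le> Suc j" "\<alpha> i \<noteq> 0"
  shows "(\<Sum>k\<in>UNIV. (\<alpha>(i := \<alpha> i - 1)) k) \<le> j"
proof -
  have "(\<Sum>k\<in>UNIV. (\<alpha>(i := \<alpha> i - 1)) k) = \<alpha> i - 1 + (\<Sum>k\<in>UNIV - {i}. \<alpha> k)"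
    by (subst sum.remove[of UNIV i]) auto
  moreover have "(\<Sum>k\<in>UNIV. \<alpha> k) = \<alpha> i + (\<Sum>k\<in>UNIV - {i}. \<alpha> k)"
    by (subst sum.remove[of UNIV i]) auto
  ultimately show ?thesis using assms by linarith
qed

lemma polys_partial:
  fixes p :: "real^'d::finite \<Rightarrow> real"
  assumes "p \<in> polys (Suc j)" shows "partial i p \<in> polys j"
proof -
  obtain c where p: "p = (\<lambda>x. \<Sum>\<alpha> | (\<Sum>i\<in>UNIV. \<alpha> i) \<le> Suc j. c \<alpha> * monomial \<alpha> x)"
    using assms unfolding polys_iff by blast
  have "partial i p = (\<lambda>x. \<Sum>\<alpha> | (\<Sum>i\<in>UNIV. \<alpha> i) \<le> Suc j. c \<alpha> * real (\<alpha> i) * monomial (\<alpha>(i := \<alpha> i - 1)) x)"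
    unfolding p by (rule ext) (rule polys_partial_expand)
  also have "\<dots> \<in> polys j"
  proof (rule polys_sum)
    fix \<alpha> :: "'d \<Rightarrow> nat" assume a: "\<alpha> \<in> {\<alpha>. (\<Sum>i\<in>UNIV. \<alpha> i) \<le> Suc j}"
    show "(\<lambda>x. c \<alpha> * real (\<alpha> i) * monomial (\<alpha>(i := \<alpha> i - 1)) x) \<in> polys j"
    proof (cases "\<alpha> i = 0")
      case False
      then show ?thesis using a sum_decr[of \<alpha> j i] by (intro polys_cmult monomial_in_polys) auto
    qed (simp add: polys_0)
  qed
  finally show ?thesis .
qed

text \<open>Monomials are eigenfunctions of \<open>x\<^sub>i \<partial>\<^sub>i\<close>. This keeps the divergence of the Raviart--Thomas
  part \<open>q x\<close> in the space of \<open>q\<close>.\<close>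

lemma polys_coord_partial:
  fixes p :: "real^'d::finite \<Rightarrow> real"
  assumes "p \<in> polys j" shows "(\<lambda>x. x $ i * partial i p x) \<in> polys j"
proof -
  obtain c where p: "p = (\<lambda>x. \<Sum>\<alpha> | (\<Sum>i\<in>UNIV. \<alpha> i) \<le> j. c \<alpha> * monomial \<alpha> x)"
    using assms unfolding polys_iff by blast
  have m: "real (\<alpha> i) * (x $ i * monomial (\<alpha>(i := \<alpha> i - 1)) x) = real (\<alpha> i) * monomial \<alpha> x" for \<alpha> and x :: "real^'d"
  proof (cases "\<alpha> i")
    case (Suc n)
    have "monomial (\<alpha>(i := \<alpha> i - 1)) x = x $ i ^ (\<alpha> i - 1) * (\<Prod>k\<in>UNIV - {i}. x $ k ^ \<alpha> k)"
      unfolding monomial_def by (subst prod.remove[of UNIV i]) (auto intro!: prod.cong)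
    moreover have "monomial \<alpha> x = x $ i ^ \<alpha> i * (\<Prod>k\<in>UNIV - {i}. x $ k ^ \<alpha> k)"
      unfolding monomial_def by (subst prod.remove[of UNIV i]) auto
    ultimately show ?thesis using Suc by simp
  qed simp
  have "(\<lambda>x. x $ i * partial i p x) = (\<lambda>x. \<Sum>\<alpha> | (\<Sum>i\<in>UNIV. \<alpha> i) \<le> j. c \<alpha> * real (\<alpha> i) * monomial \<alpha> x)"
  proof
    fix x
    have "x $ i * partial i p x = (\<Sum>\<alpha> | (\<Sum>i\<in>UNIV. \<alpha> i) \<le> j. c \<alpha> * (real (\<alpha> i) * (x $ i * monomial (\<alpha>(i := \<alpha> i - 1)) x)))"
      unfolding p polys_partial_expand sum_distrib_left by (simp add: mult_ac)
    then show "x $ i * partial i p x = (\<Sum>\<alpha> | (\<Sum>i\<in>UNIV. \<alpha> i) \<le> j. c \<alpha> * real (\<alpha> i) * monomial \<alpha> x)"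
      unfolding m by (simp add: mult.assoc)
  qed
  also have "\<dots> \<in> polys j"
    by (intro polys_sum polys_cmult monomial_in_polys) auto
  finally show ?thesis .
qed

lemma polys_le_partial:
  fixes p :: "real^'d::finite \<Rightarrow> real"
  assumes "p \<in> polys j" shows "partial i p \<in> polys j"
  using polys_partial[of p j i] polys_mono[OF assms, of "Suc j"] by auto

lemma local_space_polynomial:
  fixes w :: "real^'d::finite \<Rightarrow> real^'d"
  assumes "w \<in> local_space elt k"
  shows "real_polynomial_function (\<lambda>x. w x $ i)"
proof (cases elt)
  case RT
  then obtain p q where w: "\<And>i. (\<lambda>x. p x $ i) \<in> polys k" "q \<in> polys k" "\<And>x. w x = p x + q x *\<^sub>R x"
    using assms by auto
  have "real_polynomial_function (\<lambda>x. p x $ i + q x * x $ i)"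
    by (intro real_polynomial_function.intros(3,4) real_polynomial_function_nth polys_polynomial[OF w(1)] polys_polynomial[OF w(2)])
  then show ?thesis using w(3) by simp
next
  case BDM
  then show ?thesis using assms polys_polynomial by auto
qed

lemma local_space_differentiable:
  fixes w :: "real^'d::finite \<Rightarrow> real^'d"
  assumes "w \<in> local_space elt k" shows "w differentiable (at x)"
  unfolding vec_differentiable_iff using real_polynomial_function_partial(2)[OF local_space_polynomial[OF assms]] by blast

text \<open>Makes the divergence of a discrete velocity admissible as a test function in the
  incompressibility constraint.\<close>

lemma divh_local_space:
  fixes w :: "real^'d::finite \<Rightarrow> real^'d"
  assumes w: "w \<in> local_space elt k" shows "divh w \<in> polys k"
proof -
  have eq: "divh w = (\<lambda>x. \<Sum>j\<in>UNIV. partial j (\<lambda>x. w x $ j) x)"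
    using divh_eq[OF local_space_differentiable[OF w]] by blast
  show ?thesis
  proof (cases elt)
    case RT
    then obtain p q where pq: "\<And>i. (\<lambda>x. p x $ i) \<in> polys k" "q \<in> polys k" "\<And>x. w x = p x + q x *\<^sub>R x"
      using w by auto
    have "partial j (\<lambda>x. w x $ j) x = partial j (\<lambda>x. p x $ j) x + (x $ j * partial j q x + q x)" for j x
    proof -
      have d: "(\<lambda>x. p x $ j) differentiable (at x)" "q differentiable (at x)" "(\<lambda>x. x $ j) differentiable (at x)"
        using real_polynomial_function_partial(2)[OF polys_polynomial[OF pq(1)]]
          real_polynomial_function_partial(2)[OF polys_polynomial[OF pq(2)]]
          real_polynomial_function_partial(2)[OF real_polynomial_function_nth] by blast+
      have "partial j (\<lambda>x. w x $ j) x = partial j (\<lambda>x. p x $ j + q x * x $ j) x"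
        using pq(3) by simp
      also have "\<dots> = partial j (\<lambda>x. p x $ j) x + (partial j q x * x $ j + q x * partial j (\<lambda>x. x $ j) x)"
        using d by (simp add: partial_add partial_mult)
      also have "partial j (\<lambda>x. x $ j) x = 1"
        by (simp add: partial_linear bounded_linear_vec_nth)
      finally show ?thesis by simp
    qed
    then have "divh w = (\<lambda>x. \<Sum>j\<in>UNIV. 1 * partial j (\<lambda>x. p x $ j) x + 1 * (1 * (x $ j * partial j q x) + 1 * q x))"
      unfolding eq by simp
    also have "\<dots> \<in> polys k"
      by (intro polys_sum polys_lincomb polys_le_partial polys_coord_partial pq)
    finally show ?thesis .
  next
    case BDM
    then have "(\<lambda>x. w x $ j) \<in> polys (Suc k)" for j using w by auto
    then show ?thesis unfolding eq by (intro polys_sum polys_partial)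
  qed
qed

text \<open>Rigid motions have degree one, which the Raviart--Thomas space contains from \<open>k = 1\<close> on and
  the Brezzi--Douglas--Marini space always.\<close>

lemma affine_field_in_local_space:
  fixes V :: "real^'d::finite \<Rightarrow> real^'d"
  assumes V: "\<And>x. V x = b + A x" and A: "linear A" and k: "elt = RT \<Longrightarrow> k \<ge> 1"
  shows "V \<in> local_space elt k"
proof -
  have comp: "(\<lambda>x. V x $ i) \<in> polys 1" for i
  proof -
    have Ax: "A x $ i = (\<Sum>j\<in>UNIV. A (axis j 1) $ i * x $ j)" for x
    proof -
      have "A x = A (\<Sum>j\<in>UNIV. x $ j *\<^sub>R axis j 1)"
        using basis_expansion[of x] by (simp add: scalar_mult_eq_scaleR)
      also have "\<dots> = (\<Sum>j\<in>UNIV. x $ j *\<^sub>R A (axis j 1))"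
        by (simp add: linear_sum[OF A] linear_scale[OF A])
      finally show ?thesis by (simp add: mult.commute)
    qed
    have m0: "monomial (\<lambda>_. 0) = (\<lambda>x::real^'d. 1)" by (simp add: monomial_def fun_eq_iff)
    have m1: "monomial ((\<lambda>_. 0)(j := 1)) = (\<lambda>x::real^'d. x $ j)" for j
    proof
      fix x :: "real^'d"
      show "monomial ((\<lambda>_. 0)(j := 1)) x = x $ j"
        unfolding monomial_def by (subst prod.remove[of UNIV j]) (auto intro!: prod.neutral)
    qed
    have "(\<lambda>x::real^'d. x $ j) \<in> polys 1" for j
      unfolding m1[symmetric] by (rule monomial_in_polys) (simp add: sum.remove[of UNIV j])
    moreover have "(\<lambda>x::real^'d. 1) \<in> polys 1"
      unfolding m0[symmetric] by (rule monomial_in_polys) simp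
    ultimately have "(\<lambda>x::real^'d. b $ i * 1 + 1 * (\<Sum>j\<in>UNIV. A (axis j 1) $ i * x $ j)) \<in> polys 1"
      by (intro polys_lincomb polys_sum polys_cmult)
    moreover have "V x $ i = b $ i * 1 + 1 * (\<Sum>j\<in>UNIV. A (axis j 1) $ i * x $ j)" for x
      using Ax[of x] by (simp only: V vector_add_component mult_1 mult_1_right)
    ultimately show ?thesis by (simp only:)
  qed
  show ?thesis
  proof (cases elt)
    case RT
    have "(\<lambda>x. V x $ i) \<in> polys k" for i
      by (rule polys_mono[OF comp]) (use RT k in auto)
    then show ?thesis
      unfolding RT using polys_0[of k]
      by (simp, intro exI[of _ V] conjI allI) (auto intro!: exI[of _ "\<lambda>_. 0"])
  next
    case BDM
    have "(\<lambda>x. V x $ i) \<in> polys (k + 1)" for i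
      by (rule polys_mono[OF comp]) simp
    then show ?thesis unfolding BDM by simp
  qed
qed

text \<open>On the line from \<open>y\<close> to \<open>x\<close> the polynomial has infinitely many zeros near \<open>y\<close>.\<close>

lemma polynomial_zero_on_open:
  fixes p :: "real^'d::finite \<Rightarrow> real"
  assumes p: "real_polynomial_function p" and S: "open S" "y \<in> S" "\<And>x. x \<in> S \<Longrightarrow> p x = 0"
  shows "p x = 0"
proof -
  have "polynomial_function (\<lambda>t::real. y + t *\<^sub>R (x - y))"
    by (intro polynomial_function_add polynomial_function_const polynomial_function_mult polynomial_function_id[unfolded id_def])
  from real_polynomial_function_compose[OF this p]
  obtain a n where an: "p \<circ> (\<lambda>t. y + t *\<^sub>R (x - y)) = (\<lambda>t. \<Sum>i\<le>n. a i * t ^ i)"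
    using real_polynomial_function_imp_sum by metis
  have "continuous_on UNIV (\<lambda>t::real. y + t *\<^sub>R (x - y))" by (intro continuous_intros)
  then have "open ((\<lambda>t::real. y + t *\<^sub>R (x - y)) -` S)" using S by (auto simp: continuous_on_open_vimage)
  moreover have "0 \<in> (\<lambda>t::real. y + t *\<^sub>R (x - y)) -` S" using S by simp
  ultimately obtain e where e: "e > 0" "ball 0 e \<subseteq> (\<lambda>t::real. y + t *\<^sub>R (x - y)) -` S"
    by (rule openE)
  have root: "(\<Sum>i\<le>n. a i * t ^ i) = 0" if "t \<in> ball 0 e" for t
    using e that S(3) fun_cong[OF an, of t] by auto
  have "{0<..<e} \<subseteq> ball 0 e" by (auto simp: dist_real_def)
  then have "infinite (ball (0::real) e)"
    using infinite_super[of "{0<..<e}" "ball 0 e"] infinite_Ioo[OF e(1)] by blast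
  then have "infinite {t. (\<Sum>i\<le>n. a i * t ^ i) = 0}"
    using root by (metis (mono_tags, lifting) infinite_super mem_Collect_eq subsetI)
  then have "\<forall>i\<le>n. a i = 0"
    using polyfun_finite_roots[of a n] by blast
  then have "(\<Sum>i\<le>n. a i * 1 ^ i) = 0" by simp
  then show ?thesis using fun_cong[OF an, of 1] by simp
qed

lemma AE_zero_on_open:
  fixes f :: "'a::euclidean_space \<Rightarrow> 'b::real_normed_vector"
  assumes "continuous_on UNIV f" "open S" "AE x in lebesgue. x \<in> S \<longrightarrow> f x = 0" "x \<in> S"
  shows "f x = 0"
proof -
  have "closed {x. f x = 0}"
    using assms(1) by (intro closed_Collect_eq) auto
  then have "x \<in> {x. f x = 0}"
    using mem_closed_if_AE_lebesgue_open[OF assms(2), of "{x. f x = 0}"] assms(3,4) by auto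
  then show ?thesis by simp
qed

section \<open>Smooth bump functions\<close>

text \<open>The classical smooth function \<open>exp (- 1 / s)\<close>, together with the functions
  \<open>exp (- 1 / s) / s ^ n\<close> that its derivatives are built from.\<close>

definition flat_exp :: "nat \<Rightarrow> real \<Rightarrow> real" where
  "flat_exp n s = (if s \<le> 0 then 0 else exp (- inverse s) * inverse s ^ n)"

lemma flat_exp_has_derivative:
  "(flat_exp n has_real_derivative flat_exp (Suc (Suc n)) s - real n * flat_exp (Suc n) s) (at s)"
proof -
  consider "s < 0" | "s > 0" | "s = 0" by linarith
  then show ?thesis
  proof cases
    case 1
    have "((\<lambda>x. 0) has_real_derivative 0) (at s)" by simp
    then have "(flat_exp n has_real_derivative 0) (at s)"
      by (rule has_field_derivative_transform_within_open[where S = "{..<0}"]) (use 1 in \<open>auto simp: flat_exp_def\<close>)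
    with 1 show ?thesis by (simp add: flat_exp_def)
  next
    case 2
    have "((\<lambda>x. exp (- inverse x) * inverse x ^ n) has_real_derivative
        exp (- inverse s) * inverse s ^ Suc (Suc n) - real n * (exp (- inverse s) * inverse s ^ Suc n)) (at s)"
      using 2 by (auto intro!: derivative_eq_intros simp: algebra_simps power2_eq_square) 
        (cases n; simp add: algebra_simps)
    then have "(flat_exp n has_real_derivative
        exp (- inverse s) * inverse s ^ Suc (Suc n) - real n * (exp (- inverse s) * inverse s ^ Suc n)) (at s)"
      by (rule has_field_derivative_transform_within_open[where S = "{0<..}"]) (use 2 in \<open>auto simp: flat_exp_def\<close>)
    with 2 show ?thesis by (simp add: flat_exp_def)
  next
    case 3
    have "((\<lambda>t. t ^ Suc n / exp t) \<longlongrightarrow> (0::real)) at_top"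
      by (rule tendsto_power_div_exp_0)
    then have "((\<lambda>t. flat_exp n (0 + inverse t) / inverse t) \<longlongrightarrow> 0) at_top"
      by (rule Lim_transform_eventually)
        (use eventually_gt_at_top[of 0] in \<open>eventually_elim, simp add: flat_exp_def exp_minus field_simps\<close>)
    then have "((\<lambda>h. flat_exp n (0 + h) / h) \<longlongrightarrow> 0) (at_right 0)"
      by (simp add: filterlim_at_right_to_top)
    moreover have "((\<lambda>h. flat_exp n (0 + h) / h) \<longlongrightarrow> 0) (at_left 0)"
      by (rule Lim_transform_eventually[OF tendsto_const])
        (auto simp: eventually_at_filter flat_exp_def)
    ultimately have "((\<lambda>h. flat_exp n (0 + h) / h) \<longlongrightarrow> 0) (at 0)"
      by (intro filterlim_split_at)
    with 3 show ?thesis by (simp add: DERIV_def flat_exp_def)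
  qed
qed

text \<open>A class of functions closed under partial derivatives that contains the bumps. Smoothness of
  all its members is then one induction on the order.\<close>

inductive flat_exp_span :: "(real^'d::finite \<Rightarrow> real) \<Rightarrow> (real^'d \<Rightarrow> real) \<Rightarrow> bool" for q where
  base: "real_polynomial_function p \<Longrightarrow> flat_exp_span q (\<lambda>x. p x * flat_exp n (q x))"
| add: "flat_exp_span q f \<Longrightarrow> flat_exp_span q g \<Longrightarrow> flat_exp_span q (\<lambda>x. f x + g x)"

lemma flat_exp_span_partial:
  fixes q :: "real^'d::finite \<Rightarrow> real"
  assumes q: "real_polynomial_function q" and "flat_exp_span q f"
  shows "(\<forall>x. f differentiable (at x)) \<and> flat_exp_span q (partial j f)"
  using assms(2)
proof induction
  case (base p n)
  have qd: "(q has_derivative frechet_derivative q (at x)) (at x)" for x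
    using real_polynomial_function_partial(2)[OF q] frechet_derivative_works by blast
  have fd: "((\<lambda>x. flat_exp n (q x)) has_derivative
      (\<lambda>h. frechet_derivative q (at x) h * (flat_exp (Suc (Suc n)) (q x) - real n * flat_exp (Suc n) (q x)))) (at x)" for x
    using DERIV_compose_FDERIV[OF flat_exp_has_derivative qd] .
  then have fdiff: "(\<lambda>x. flat_exp n (q x)) differentiable (at x)" for x
    unfolding differentiable_def by blast
  have pdiff: "p differentiable (at x)" for x
    using real_polynomial_function_partial(2)[OF base] .
  have "partial j (\<lambda>x. p x * flat_exp n (q x)) =
     (\<lambda>x. partial j p x * flat_exp n (q x) + ((p x * partial j q x) * flat_exp (Suc (Suc n)) (q x)
        + (- real n * (p x * partial j q x)) * flat_exp (Suc n) (q x)))"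
  proof
    fix x
    have E: "partial j (\<lambda>x. flat_exp n (q x)) x
        = partial j q x * (flat_exp (Suc (Suc n)) (q x) - real n * flat_exp (Suc n) (q x))"
      using partial_eqI[OF fd] by (simp add: partial_def)
    show "partial j (\<lambda>x. p x * flat_exp n (q x)) x =
       partial j p x * flat_exp n (q x) + ((p x * partial j q x) * flat_exp (Suc (Suc n)) (q x)
        + (- real n * (p x * partial j q x)) * flat_exp (Suc n) (q x))"
      unfolding partial_mult[OF pdiff fdiff] E by (simp add: algebra_simps)
  qed
  moreover have "flat_exp_span q \<dots>"
    by (intro flat_exp_span.intros real_polynomial_function.intros(2,4) base
        real_polynomial_function_partial(1)[OF base] real_polynomial_function_partial(1)[OF q])
  ultimately show ?case using pdiff fdiff by auto
next
  case (add f g)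
  then have "partial j (\<lambda>x. f x + g x) = (\<lambda>x. partial j f x + partial j g x)"
    by (auto simp: partial_add)
  with add show ?case by (auto intro: flat_exp_span.add)
qed

lemma Ck_flat_exp_span:
  fixes q :: "real^'d::finite \<Rightarrow> real"
  assumes "real_polynomial_function q"
  shows "flat_exp_span q f \<Longrightarrow> Ck m f"
proof (induction m arbitrary: f)
  case 0
  have "f differentiable (at x)" for x
    using flat_exp_span_partial[OF assms 0] by blast
  then show ?case
    using differentiable_imp_continuous_within by (auto simp: continuous_on_eq_continuous_at)
qed (use flat_exp_span_partial[OF assms] in auto)

text \<open>A bump around \<open>y\<close> with width \<open>e\<close> in general and \<open>d\<close> in the direction \<open>\<nu>\<close>. On the hyperplane
  through \<open>y\<close> normal to \<open>\<nu>\<close> it does not depend on \<open>d\<close>, so it can be squeezed onto the hyperplane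
  without changing its values there.\<close>

definition bump :: "real^'d \<Rightarrow> real^'d \<Rightarrow> real \<Rightarrow> real \<Rightarrow> real^'d \<Rightarrow> real" where
  "bump y \<nu> e d x = flat_exp 0 (1 - (x - y) \<bullet> (x - y) / e\<^sup>2 - (\<nu> \<bullet> (x - y))\<^sup>2 / d\<^sup>2)"

lemma bump_bounds: "0 \<le> bump y \<nu> e d x" "bump y \<nu> e d x \<le> 1"
  by (auto simp: bump_def flat_exp_def)

lemma bump_support:
  assumes "0 < e" "0 < d" "bump y \<nu> e d x \<noteq> 0"
  shows "dist y x < e" "\<bar>\<nu> \<bullet> (x - y)\<bar> < d"
proof -
  have s: "(x - y) \<bullet> (x - y) / e\<^sup>2 + (\<nu> \<bullet> (x - y))\<^sup>2 / d\<^sup>2 < 1"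
    using assms by (auto simp: bump_def flat_exp_def split: if_splits)
  have "0 \<le> (x - y) \<bullet> (x - y) / e\<^sup>2" "0 \<le> (\<nu> \<bullet> (x - y))\<^sup>2 / d\<^sup>2" by auto
  with s have "(x - y) \<bullet> (x - y) / e\<^sup>2 < 1" "(\<nu> \<bullet> (x - y))\<^sup>2 / d\<^sup>2 < 1" by linarith+
  then have "(norm (x - y))\<^sup>2 < e\<^sup>2" "\<bar>\<nu> \<bullet> (x - y)\<bar>\<^sup>2 < d\<^sup>2"
    using assms by (auto simp: power2_norm_eq_inner)
  then show "dist y x < e" "\<bar>\<nu> \<bullet> (x - y)\<bar> < d"
    using assms power2_less_imp_less by (auto simp: dist_norm norm_minus_commute intro: power2_less_imp_less)
qed

lemma bump_on_hyperplane: "\<nu> \<bullet> x = \<nu> \<bullet> y \<Longrightarrow> bump y \<nu> e d x = bump y 0 e 1 x"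
  by (simp add: bump_def inner_diff_right)

lemma bump_centre: "bump y \<nu> e d y > 0"
  by (simp add: bump_def flat_exp_def)

lemma bump_test_function:
  fixes y :: "real^'d::finite"
  assumes "0 < e" "0 < d" "cball y e \<subseteq> \<Omega>"
  shows "bump y \<nu> e d \<in> test_functions \<Omega>"
proof -
  define q where "q x = 1 - (x - y) \<bullet> (x - y) / e\<^sup>2 - (\<nu> \<bullet> (x - y))\<^sup>2 / d\<^sup>2" for x
  have "real_polynomial_function (\<lambda>x. 1 - (\<Sum>i\<in>UNIV. (x $ i - y $ i) * (x $ i - y $ i)) / e\<^sup>2
      - (\<Sum>i\<in>UNIV. \<nu> $ i * (x $ i - y $ i))\<^sup>2 / d\<^sup>2)"
    by (intro real_polynomial_function_diff real_polynomial_function_divide real_polynomial_function_sum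
        real_polynomial_function_power real_polynomial_function.intros(4) real_polynomial_function.intros(2)
        real_polynomial_function_nth) auto
  then have q: "real_polynomial_function q"
    by (simp add: q_def[abs_def] inner_vec_def)
  have "flat_exp_span q (\<lambda>x. 1 * flat_exp 0 (q x))"
    by (rule flat_exp_span.base) auto
  then have C: "Ck m (bump y \<nu> e d)" for m
    using Ck_flat_exp_span[OF q] by (simp add: bump_def[abs_def] q_def)
  have "{x. bump y \<nu> e d x \<noteq> 0} \<subseteq> cball y e"
    using bump_support(1)[OF assms(1,2)] by force
  then have cl: "closure {x. bump y \<nu> e d x \<noteq> 0} \<subseteq> cball y e"
    by (rule closure_minimal) simp
  then have "compact (closure {x. bump y \<nu> e d x \<noteq> 0})"
    by (metis bounded_cball bounded_subset closed_closure compact_eq_bounded_closed)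
  with C cl assms(3) show ?thesis by (auto simp: test_functions_def)
qed

section \<open>Geometry of the mesh\<close>

locale mesh =
  fixes M :: "'d::{finite,wellorder} dg_mesh" and \<sigma> :: real
  assumes valid: "valid_mesh \<sigma> M"
begin

abbreviation \<Omega> :: "(real^'d::_) set" where "\<Omega> \<equiv> region M"
abbreviation \<T> :: "(real^'d::_) set set" where "\<T> \<equiv> cells M"
abbreviation nF :: "(real^'d::_) set \<Rightarrow> real^'d::_" where "nF \<equiv> nrml M"
abbreviation KP :: "(real^'d::_) set \<Rightarrow> (real^'d::_) set" where "KP \<equiv> Kplus M"
abbreviation KM :: "(real^'d::_) set \<Rightarrow> (real^'d::_) set" where "KM \<equiv> Kminus M"

lemma finite_cells: "finite \<T>"
  and cell_simplex: "K \<in> \<T> \<Longrightarrow> int CARD('d) simplex K"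
  and cells_Int_face: "K \<in> \<T> \<Longrightarrow> K' \<in> \<T> \<Longrightarrow> (K \<inter> K') face_of K"
  and Union_cells: "\<Union>\<T> = closure \<Omega>"
  and open_region: "open \<Omega>" and region_interior: "interior (closure \<Omega>) = \<Omega>"
  and bounded_region: "bounded \<Omega>"
  using valid unfolding valid_mesh_def triangulation_def polyhedral_domain_def by auto

lemma KP: "F \<in> faces M \<Longrightarrow> KP F \<in> \<T>" "F \<in> faces M \<Longrightarrow> F facet_of KP F"
    "F \<in> faces M \<Longrightarrow> outward_normal (KP F) F (nF F)"
  and KM: "F \<in> interior_faces M \<Longrightarrow> KM F \<in> \<T>" "F \<in> interior_faces M \<Longrightarrow> F facet_of KM F"
    "F \<in> interior_faces M \<Longrightarrow> outward_normal (KM F) F (- nF F)"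
  using valid unfolding valid_mesh_def by auto

lemma interior_face_is_face: "F \<in> interior_faces M \<Longrightarrow> F \<in> faces M"
  and boundary_face_is_face: "F \<in> boundary_faces M \<Longrightarrow> F \<in> faces M"
  by (auto simp: interior_faces_def boundary_faces_def faces_def)

lemma facet_is_face: "K \<in> \<T> \<Longrightarrow> F facet_of K \<Longrightarrow> F \<in> faces M"
  by (auto simp: faces_def)

lemma cell_polytope: "K \<in> \<T> \<Longrightarrow> polytope K"
  using cell_simplex simplex_imp_polytope by blast

lemma cell_convex: "K \<in> \<T> \<Longrightarrow> convex K" and cell_compact: "K \<in> \<T> \<Longrightarrow> compact K"
  and cell_closed: "K \<in> \<T> \<Longrightarrow> closed K"
  using cell_polytope polytope_imp_convex polytope_imp_compact polytope_imp_closed by blast+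

lemma cell_interior: 
  assumes "K \<in> \<T>" shows "interior K \<noteq> {}"
proof -
  have "aff_dim K = int CARD('d)"
    by (rule aff_dim_simplex[OF cell_simplex[OF assms]])
  then have "affine hull K = UNIV" "K \<noteq> {}"
    by (auto simp: aff_dim_eq_full simp flip: aff_dim_eq_full)
  then show ?thesis
    using rel_interior_interior[of K] rel_interior_eq_empty[OF cell_convex[OF assms]] by simp
qed

lemma cell_subset_imp_eq:
  assumes "K \<in> \<T>" "K' \<in> \<T>" "K \<subseteq> K'" shows "K = K'"
proof (rule ccontr)
  assume "K \<noteq> K'"
  have "K face_of K'" using cells_Int_face[OF assms(2,1)] assms(3) by (simp add: Int_absorb1)
  then have "aff_dim K < aff_dim K'"
    using \<open>K \<noteq> K'\<close> cell_convex[OF assms(2)] by (simp add: face_of_aff_dim_lt)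
  then show False using aff_dim_simplex[OF cell_simplex] assms by simp
qed

lemma cell_with_normal:
  assumes "K \<in> \<T>" "F facet_of K" "outward_normal K F \<nu>"
  obtains N where "convex_cell K N" "N F = \<nu>"
proof -
  have "\<forall>G. \<exists>\<mu>. G facet_of K \<longrightarrow> outward_normal K G \<mu>"
    using outward_normal_exists[OF cell_polytope[OF assms(1)]] by metis
  then obtain N where N: "\<And>G. G facet_of K \<Longrightarrow> outward_normal K G (N G)" by metis
  have "convex_cell K (N(F := \<nu>))"
    using N assms cell_polytope[OF assms(1)] cell_interior[OF assms(1)] by unfold_locales auto
  then show ?thesis by (rule that) simp
qed

text \<open>Two distinct cells meet in a proper common face, so a facet of one that lies in the other is
  their whole intersection; having the right dimension, it is a facet of the other as well.\<close>

lemma shared_facet: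
  assumes "K \<in> \<T>" "K' \<in> \<T>" "K \<noteq> K'" "F facet_of K" "F \<subseteq> K'"
  shows "K \<inter> K' = F" "F facet_of K'"
proof -
  have "K \<inter> K' \<noteq> K"
    using cell_subset_imp_eq[OF assms(1,2)] assms(3) by blast
  moreover have "F \<subseteq> K \<inter> K'"
    using assms facet_of_imp_subset by blast
  ultimately show eq: "K \<inter> K' = F"
    using face_containing_facet[OF cell_convex[OF assms(1)] assms(4) cells_Int_face[OF assms(1,2)]] by blast
  have "F face_of K'"
    using cells_Int_face[OF assms(2,1)] eq by (simp add: Int_commute)
  then show "F facet_of K'"
    using assms(4) aff_dim_simplex[OF cell_simplex] assms(1,2) by (simp add: facet_of_def)
qed

text \<open>Two cells on the same side of a common facet would both contain a small half ball, whereas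
  their intersection lies in a hyperplane.\<close>

lemma same_side_unique:
  assumes "K \<in> \<T>" "K' \<in> \<T>" "F facet_of K" "F facet_of K'" "outward_normal K F \<nu>" "outward_normal K' F \<nu>"
  shows "K = K'"
proof (rule ccontr)
  assume "K \<noteq> K'"
  have eq: "K \<inter> K' = F"
    using shared_facet(1)[OF assms(1,2) \<open>K \<noteq> K'\<close> assms(3)] assms(4) facet_of_imp_subset by blast
  obtain N where N: "convex_cell K N" "N F = \<nu>" using cell_with_normal assms by metis
  obtain N' where N': "convex_cell K' N'" "N' F = \<nu>" using cell_with_normal assms by metis
  obtain y where y: "y \<in> rel_interior F"
    using convex_cell.rel_interior_facet_nonempty[OF N(1) assms(3)] by blast
  then have yF: "y \<in> F" using rel_interior_subset by blast
  obtain e where e: "e > 0" "\<And>x. x \<in> ball y e \<Longrightarrow> N F \<bullet> x \<le> convex_cell.off N F \<Longrightarrow> x \<in> K"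
    using convex_cell.half_ball_subset[OF N(1) assms(3) y] by metis
  obtain e' where e': "e' > 0" "\<And>x. x \<in> ball y e' \<Longrightarrow> N' F \<bullet> x \<le> convex_cell.off N' F \<Longrightarrow> x \<in> K'"
    using convex_cell.half_ball_subset[OF N'(1) assms(4) y] by metis
  have off: "convex_cell.off N F = \<nu> \<bullet> y" "convex_cell.off N' F = \<nu> \<bullet> y"
    using convex_cell.off_eq[OF N(1) assms(3) yF] convex_cell.off_eq[OF N'(1) assms(4) yF] N N' by auto
  have n: "norm \<nu> = 1" using assms(5) by (simp add: outward_normal_def)
  define s where "s = min e e' / 2"
  have s: "s > 0" "s < e" "s < e'" using e e' by (auto simp: s_def)
  define x where "x = y - s *\<^sub>R \<nu>"
  have "x \<in> ball y e" "x \<in> ball y e'" using s n by (auto simp: x_def dist_norm)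
  moreover have \<nu>x: "\<nu> \<bullet> x = \<nu> \<bullet> y - s" using n by (simp add: x_def inner_diff_right norm_eq_1)
  ultimately have "x \<in> K \<inter> K'" using e(2) e'(2) off N N' s by auto
  then have "x \<in> F" using eq by simp
  then have "\<nu> \<bullet> x = \<nu> \<bullet> y"
    using convex_cell.off_eq[OF N(1) assms(3)] off N by auto
  with \<nu>x s show False by simp
qed

lemma facet_normal_sign:
  assumes "F \<in> faces M" "K \<in> \<T>" "F facet_of K" "outward_normal K F \<mu>"
  shows "\<mu> = nF F \<or> \<mu> = - nF F"
proof -
  obtain y where y: "y \<in> F" using assms(3) by (auto simp: facet_of_def)
  have "nF F \<bullet> x = nF F \<bullet> y" "\<mu> \<bullet> x = \<mu> \<bullet> y" if "x \<in> F" for x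
    using outward_normal_const[OF KP(3)[OF assms(1)] facet_of_imp_subset[OF KP(2)[OF assms(1)]] that y]
      outward_normal_const[OF assms(4) facet_of_imp_subset[OF assms(3)] that y] by auto
  moreover have "norm (nF F) = 1" "norm \<mu> = 1"
    using KP(3)[OF assms(1)] assms(4) by (auto simp: outward_normal_def)
  ultimately show ?thesis
    using facet_normal_unique[OF assms(3) cell_interior[OF assms(2)]] by blast
qed

lemma KP_neq_KM: 
  assumes "F \<in> interior_faces M" shows "KP F \<noteq> KM F"
proof
  assume eq: "KP F = KM F"
  note F = interior_face_is_face[OF assms]
  obtain x where x: "x \<in> interior (KP F)" using cell_interior[OF KP(1)[OF F]] by auto
  obtain y where y: "y \<in> F" using KP(2)[OF F] by (auto simp: facet_of_def)
  have "norm (nF F) = 1" using KP(3)[OF F] by (auto simp: outward_normal_def)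
  have "nF F \<bullet> x < nF F \<bullet> y"
    by (rule inner_less_on_interior[OF x]) (use KP(3)[OF F] y in \<open>auto simp: outward_normal_def inner_diff_right\<close>)
  moreover have "x \<in> KM F" using x eq interior_subset by auto
  then have "- nF F \<bullet> (x - y) \<le> 0"
    using KM(3)[OF assms] y unfolding outward_normal_def by blast
  ultimately show False by (simp add: inner_diff_right)
qed

text \<open>A face has two sides, and each side admits one cell.\<close>

lemma cells_at_interior_face:
  assumes "F \<in> interior_faces M" shows "{K\<in>\<T>. F facet_of K} = {KP F, KM F}"
proof
  note F = interior_face_is_face[OF assms]
  show "{KP F, KM F} \<subseteq> {K\<in>\<T>. F facet_of K}" using KP[OF F] KM[OF assms] by auto
  show "{K\<in>\<T>. F facet_of K} \<subseteq> {KP F, KM F}"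
  proof
    fix K assume "K \<in> {K\<in>\<T>. F facet_of K}"
    then have K: "K \<in> \<T>" "F facet_of K" by auto
    obtain \<mu> where \<mu>: "outward_normal K F \<mu>" using outward_normal_exists[OF cell_polytope[OF K(1)] K(2)] .
    from facet_normal_sign[OF F K \<mu>] show "K \<in> {KP F, KM F}"
    proof
      assume "\<mu> = nF F"
      then have "K = KP F" using same_side_unique[OF K(1) KP(1)[OF F] K(2) KP(2)[OF F] \<mu>] KP(3)[OF F] by simp
      then show ?thesis by simp
    next
      assume "\<mu> = - nF F"
      then have "K = KM F" using same_side_unique[OF K(1) KM(1)[OF assms] K(2) KM(2)[OF assms] \<mu>] KM(3)[OF assms] by simp
      then show ?thesis by simp
    qed
  qed
qed

lemma cells_at_boundary_face:
  assumes "F \<in> boundary_faces M" shows "{K\<in>\<T>. F facet_of K} = {KP F}"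
proof -
  note F = boundary_face_is_face[OF assms]
  have "K = KP F" if "K \<in> \<T>" "F facet_of K" for K
  proof (rule ccontr)
    assume "K \<noteq> KP F"
    then have "F \<in> interior_faces M"
      using that KP[OF F] unfolding interior_faces_def by blast
    then show False using assms by (simp add: boundary_faces_def)
  qed
  then show ?thesis using KP(1,2)[OF F] by blast
qed

text \<open>A cell at the face \<open>F\<close> other than \<open>KP F\<close> is \<open>KM F\<close>, and \<open>nF F\<close> points into it.\<close>

definition cell_normal :: "(real^'d::_) set \<Rightarrow> (real^'d::_) set \<Rightarrow> real^'d::_" where
  "cell_normal K F = (if K = KP F then nF F else - nF F)"

lemma convex_cell_mesh:
  assumes K: "K \<in> \<T>" shows "convex_cell K (cell_normal K)"
proof
  show "polytope K" "interior K \<noteq> {}" using cell_polytope cell_interior K by auto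
  fix F assume F: "F facet_of K"
  then have Ff: "F \<in> faces M" using facet_is_face K by blast
  show "outward_normal K F (cell_normal K F)"
  proof (cases "K = KP F")
    case True
    then show ?thesis using KP(3)[OF Ff] by (simp add: cell_normal_def)
  next
    case False
    then have Fi: "F \<in> interior_faces M"
      using cells_at_boundary_face[of F] K F Ff by (auto simp: boundary_faces_def)
    then have "K = KM F" using cells_at_interior_face K F False by blast
    then show ?thesis using KM(3)[OF Fi] False by (simp add: cell_normal_def)
  qed
qed

lemma flat_face_nF:
  assumes "F \<in> faces M" shows "flat_face (nF F) F"
  using convex_cell.flat_facet[OF convex_cell_mesh[OF KP(1)[OF assms]] KP(2)[OF assms]] by (simp add: cell_normal_def)

lemma finite_faces: "finite (faces M)"
proof -
  have "faces M = (\<Union>K\<in>\<T>. {F. F facet_of K})" by (auto simp: faces_def)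
  then show ?thesis
    using finite_cells convex_cell.finite_facets[OF convex_cell_mesh] by simp
qed

lemma faces_split: "faces M = interior_faces M \<union> boundary_faces M" "interior_faces M \<inter> boundary_faces M = {}"
  using interior_face_is_face by (auto simp: boundary_faces_def)

lemma finite_interior_boundary: "finite (interior_faces M)" "finite (boundary_faces M)"
  using finite_faces faces_split by auto

lemma interior_cell_subset: "K \<in> \<T> \<Longrightarrow> interior K \<subseteq> \<Omega>"
  using Union_cells region_interior interior_mono[of K "closure \<Omega>"] by blast

lemma interior_Int_cell:
  assumes "K \<in> \<T>" "K' \<in> \<T>" "K \<noteq> K'" shows "interior K \<inter> K' = {}"
proof -
  have "K \<inter> K' \<noteq> K" using cell_subset_imp_eq[OF assms(1,2)] assms(3) by blast
  then have "K \<inter> K' \<inter> interior K = {}"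
    by (rule face_of_disjoint_interior[OF cells_Int_face[OF assms(1,2)]])
  then show ?thesis using interior_subset by blast
qed

text \<open>Sum over the cells and exchange the order of summation: an interior face is seen from two
  cells with opposite normals and contributes the jump, a boundary face is seen once.\<close>

theorem broken_divergence_theorem:
  fixes g :: "(real^'d::_) set \<Rightarrow> real^'d::_ \<Rightarrow> real^'d::_"
  assumes g: "\<And>K j. K \<in> \<T> \<Longrightarrow> Ck (Suc 0) (\<lambda>x. g K x $ j)"
  shows "(\<Sum>K\<in>\<T>. LINT x:K|lebesgue. divh (g K) x) =
      (\<Sum>F\<in>interior_faces M. face_integral (nF F) F (\<lambda>x. nF F \<bullet> (g (KP F) x - g (KM F) x)))
    + (\<Sum>F\<in>boundary_faces M. face_integral (nF F) F (\<lambda>x. nF F \<bullet> g (KP F) x))"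
proof -
  define flux where "flux K F = face_integral (nF F) F (\<lambda>x. nF F \<bullet> g K x)" for K F
  define sg where "sg K F = (if K = KP F then 1 else - 1 :: real)" for K F
  have gc: "continuous_on UNIV (\<lambda>x. a \<bullet> g K x)" if "K \<in> \<T>" for K a
    unfolding inner_vec_def inner_real_def
    by (intro continuous_on_sum continuous_on_mult[OF continuous_on_const Ck1_continuous[OF g[OF that]]])
  have cell: "(LINT x:K|lebesgue. divh (g K) x) = (\<Sum>F | F \<in> faces M \<and> F facet_of K. sg K F * flux K F)" if K: "K \<in> \<T>" for K
  proof -
    have "(LINT x:K|lebesgue. divh (g K) x) = (\<Sum>F | F facet_of K. face_integral (cell_normal K F) F (\<lambda>x. cell_normal K F \<bullet> g K x))"
      by (rule divergence_theorem_cell[OF convex_cell_mesh[OF K] g[OF K]])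
    also have "{F. F facet_of K} = {F. F \<in> faces M \<and> F facet_of K}" using facet_is_face K by blast
    also have "(\<Sum>F | F \<in> faces M \<and> F facet_of K. face_integral (cell_normal K F) F (\<lambda>x. cell_normal K F \<bullet> g K x))
         = (\<Sum>F | F \<in> faces M \<and> F facet_of K. sg K F * flux K F)"
    proof (rule sum.cong[OF refl])
      fix F assume "F \<in> {F. F \<in> faces M \<and> F facet_of K}"
      then have F: "flat_face (nF F) F" using flat_face_nF by simp
      show "face_integral (cell_normal K F) F (\<lambda>x. cell_normal K F \<bullet> g K x) = sg K F * flux K F"
      proof (cases "K = KP F")
        case False
        have "face_integral (- nF F) F (\<lambda>x. - nF F \<bullet> g K x) = face_integral (nF F) F (\<lambda>x. - nF F \<bullet> g K x)"
          by (rule face_integral_uminus_normal[OF F gc[OF K]])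
        also have "\<dots> = - flux K F"
          using face_integral_add(3)[OF F gc[OF K] gc[OF K], of "-1" "nF F"] by (simp add: flux_def)
        finally show ?thesis using False by (simp add: cell_normal_def sg_def)
      qed (simp add: cell_normal_def sg_def flux_def)
    qed
    finally show ?thesis .
  qed
  have "(\<Sum>K\<in>\<T>. LINT x:K|lebesgue. divh (g K) x) = (\<Sum>K\<in>\<T>. \<Sum>F | F \<in> faces M \<and> F facet_of K. sg K F * flux K F)"
    using cell by simp
  also have "\<dots> = (\<Sum>F\<in>faces M. \<Sum>K | K \<in> \<T> \<and> F facet_of K. sg K F * flux K F)"
    by (rule sum.swap_restrict[OF finite_cells finite_faces])
  also have "\<dots> = (\<Sum>F\<in>interior_faces M. \<Sum>K | K \<in> \<T> \<and> F facet_of K. sg K F * flux K F)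
       + (\<Sum>F\<in>boundary_faces M. \<Sum>K | K \<in> \<T> \<and> F facet_of K. sg K F * flux K F)"
    unfolding faces_split(1) by (rule sum.union_disjoint[OF finite_interior_boundary faces_split(2)])
  also have "(\<Sum>F\<in>interior_faces M. \<Sum>K | K \<in> \<T> \<and> F facet_of K. sg K F * flux K F)
      = (\<Sum>F\<in>interior_faces M. face_integral (nF F) F (\<lambda>x. nF F \<bullet> (g (KP F) x - g (KM F) x)))"
  proof (rule sum.cong[OF refl])
    fix F assume F: "F \<in> interior_faces M"
    have "(\<Sum>K | K \<in> \<T> \<and> F facet_of K. sg K F * flux K F) = flux (KP F) F - flux (KM F) F"
      using cells_at_interior_face[OF F] KP_neq_KM[OF F] by (simp add: sg_def)
    also have "\<dots> = face_integral (nF F) F (\<lambda>x. nF F \<bullet> (g (KP F) x - g (KM F) x))"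
      unfolding flux_def inner_diff_right
      by (rule face_integral_add(2)[symmetric])
        (use F KP KM interior_face_is_face in \<open>auto intro: flat_face_nF gc\<close>)
    finally show "(\<Sum>K | K \<in> \<T> \<and> F facet_of K. sg K F * flux K F)
       = face_integral (nF F) F (\<lambda>x. nF F \<bullet> (g (KP F) x - g (KM F) x))" .
  qed
  also have "(\<Sum>F\<in>boundary_faces M. \<Sum>K | K \<in> \<T> \<and> F facet_of K. sg K F * flux K F)
      = (\<Sum>F\<in>boundary_faces M. face_integral (nF F) F (\<lambda>x. nF F \<bullet> g (KP F) x))"
    by (rule sum.cong[OF refl]) (use cells_at_boundary_face in \<open>simp add: sg_def flux_def\<close>)
  finally show ?thesis .
qed

text \<open>The frontiers of the cells are null sets, and off them each point of the domain lies in the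
  interior of exactly one cell.\<close>

lemma AE_cell_indicators:
  fixes f :: "real^'d::_ \<Rightarrow> 'b::real_vector"
  assumes f: "\<And>K x. K \<in> \<T> \<Longrightarrow> x \<in> interior K \<Longrightarrow> f x = p K x"
  shows "AE x in lebesgue. (\<Sum>K\<in>\<T>. indicat_real K x *\<^sub>R p K x) = indicat_real \<Omega> x *\<^sub>R f x"
proof -
  have "AE x in lebesgue. \<forall>K\<in>\<T>. x \<notin> frontier K"
  proof (rule AE_finite_allI[OF finite_cells])
    fix K assume "K \<in> \<T>"
    then have "frontier K \<in> null_sets lebesgue"
      using negligible_convex_frontier[OF cell_convex] by (simp add: negligible_iff_null_sets)
    then show "AE x in lebesgue. x \<notin> frontier K" by (rule AE_not_in)
  qed
  then show ?thesis
  proof eventually_elim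
    case (elim x)
    have int: "x \<in> K \<longleftrightarrow> x \<in> interior K" if "K \<in> \<T>" for K
      using elim that cell_closed[OF that] interior_subset by (auto simp: frontier_def)
    show ?case
    proof (cases "\<exists>K\<in>\<T>. x \<in> K")
      case True
      then obtain K where K: "K \<in> \<T>" "x \<in> K" by auto
      have "x \<notin> K'" if "K' \<in> \<T> - {K}" for K'
        using interior_Int_cell[of K K'] K that int by blast
      then have "(\<Sum>K\<in>\<T>. indicat_real K x *\<^sub>R p K x) = p K x"
        using K finite_cells by (subst sum.remove[of _ K]) auto
      moreover have "x \<in> \<Omega>" using interior_cell_subset[OF K(1)] int K by blast
      ultimately show ?thesis using f K int by simp
    next
      case False
      then have "x \<notin> \<Omega>" using Union_cells closure_subset by blast
      with False show ?thesis by (auto intro!: sum.neutral)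
    qed
  qed
qed

lemma piecewise_measurable:
  fixes f :: "real^'d::_ \<Rightarrow> 'b::euclidean_space"
  assumes f: "\<And>K x. K \<in> \<T> \<Longrightarrow> x \<in> interior K \<Longrightarrow> f x = p K x"
    and p: "\<And>K. K \<in> \<T> \<Longrightarrow> continuous_on UNIV (p K)"
  shows "(\<lambda>x. indicat_real \<Omega> x *\<^sub>R f x) \<in> borel_measurable lebesgue"
    and "integrable lebesgue (\<lambda>x. \<Sum>K\<in>\<T>. indicat_real K x *\<^sub>R p K x)"
    and "\<And>K. K \<in> \<T> \<Longrightarrow> integrable lebesgue (\<lambda>x. indicat_real K x *\<^sub>R p K x)"
proof -
  show K: "integrable lebesgue (\<lambda>x. indicat_real K x *\<^sub>R p K x)" if "K \<in> \<T>" for K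
  proof -
    have "integrable lborel (\<lambda>x. indicat_real K x *\<^sub>R p K x)"
      by (rule borel_integrable_compact[OF cell_compact[OF that] continuous_on_subset[OF p[OF that]]]) auto
    then show ?thesis by (simp add: integrable_completion)
  qed
  then show S: "integrable lebesgue (\<lambda>x. \<Sum>K\<in>\<T>. indicat_real K x *\<^sub>R p K x)"
    by (rule Bochner_Integration.integrable_sum)
  show "(\<lambda>x. indicat_real \<Omega> x *\<^sub>R f x) \<in> borel_measurable lebesgue"
    by (rule borel_measurable_AE[OF _ AE_cell_indicators[OF f]]) (use S in auto)
qed

lemma piecewise_integral:
  fixes f :: "real^'d::_ \<Rightarrow> 'b::euclidean_space"
  assumes f: "\<And>K x. K \<in> \<T> \<Longrightarrow> x \<in> interior K \<Longrightarrow> f x = p K x"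
    and p: "\<And>K. K \<in> \<T> \<Longrightarrow> continuous_on UNIV (p K)"
  shows "set_integrable lebesgue \<Omega> f" "(LINT x:\<Omega>|lebesgue. f x) = (\<Sum>K\<in>\<T>. LINT x:K|lebesgue. p K x)"
proof -
  have S: "integrable lebesgue (\<lambda>x. \<Sum>K\<in>\<T>. indicat_real K x *\<^sub>R p K x)"
    and m: "(\<lambda>x. indicat_real \<Omega> x *\<^sub>R f x) \<in> borel_measurable lebesgue"
    and K: "\<And>K. K \<in> \<T> \<Longrightarrow> integrable lebesgue (\<lambda>x. indicat_real K x *\<^sub>R p K x)"
    using piecewise_measurable[of f p] f p by blast+
  have AE: "AE x in lebesgue. (\<Sum>K\<in>\<T>. indicat_real K x *\<^sub>R p K x) = indicat_real \<Omega> x *\<^sub>R f x"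
    by (rule AE_cell_indicators[OF f])
  show "set_integrable lebesgue \<Omega> f"
    unfolding set_integrable_def by (rule integrable_cong_AE_imp[OF S m]) (use AE in \<open>eventually_elim, simp\<close>)
  have "(LINT x:\<Omega>|lebesgue. f x) = (\<integral>x. (\<Sum>K\<in>\<T>. indicat_real K x *\<^sub>R p K x) \<partial>lebesgue)"
    unfolding set_lebesgue_integral_def
    by (rule integral_cong_AE[OF m]) (use S AE in \<open>auto elim: eventually_mono\<close>)
  also have "\<dots> = (\<Sum>K\<in>\<T>. LINT x:K|lebesgue. p K x)"
    unfolding set_lebesgue_integral_def by (rule Bochner_Integration.integral_sum[OF K])
  finally show "(LINT x:\<Omega>|lebesgue. f x) = (\<Sum>K\<in>\<T>. LINT x:K|lebesgue. p K x)" .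
qed

lemma piecewise_L2:
  fixes f :: "real^'d::_ \<Rightarrow> 'b::euclidean_space"
  assumes f: "\<And>K x. K \<in> \<T> \<Longrightarrow> x \<in> interior K \<Longrightarrow> f x = p K x"
    and p: "\<And>K. K \<in> \<T> \<Longrightarrow> continuous_on UNIV (p K)"
  shows "f \<in> L2 \<Omega>"
proof -
  have "set_borel_measurable lebesgue \<Omega> f"
    using piecewise_measurable(1)[of f p] f p unfolding set_borel_measurable_def by blast
  moreover have "set_integrable lebesgue \<Omega> (\<lambda>x. (norm (f x))\<^sup>2)"
    by (rule piecewise_integral(1)[where p = "\<lambda>K x. (norm (p K x))\<^sup>2"])
      (use f p in \<open>auto intro!: continuous_intros\<close>)
  ultimately show ?thesis by (simp add: L2_def)
qed

lemma elem_trace_eq: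
  assumes "K \<in> \<T>" "\<And>x. x \<in> interior K \<Longrightarrow> f x = p x" "continuous_on UNIV p" "x \<in> K"
  shows "elem_trace K f x = p x"
  unfolding elem_trace_def
proof (rule tendsto_Lim)
  have "x \<in> closure (interior K)"
    using convex_closure_interior[OF cell_convex[OF assms(1)] cell_interior[OF assms(1)]] assms(4) closure_subset by blast
  then have "x islimpt interior K"
    using interior_limit_point[of x "interior K"] by (auto simp: closure_def)
  then show "at x within interior K \<noteq> bot"
    by (simp add: trivial_limit_within)
  have "(p \<longlongrightarrow> p x) (at x within interior K)"
    using assms(3) by (metis UNIV_I continuous_on continuous_on_subset subset_UNIV tendsto_within_subset)
  moreover have "\<forall>\<^sub>F y in at x within interior K. p y = f y"
    using assms(2) by (simp add: eventually_at_filter)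
  ultimately show "(f \<longlongrightarrow> p x) (at x within interior K)"
    by (rule Lim_transform_eventually)
qed

text \<open>If a point of the relative interior of \<open>F\<close> were in the open domain, then points slightly
  beyond \<open>F\<close> would be covered by a second cell, which would contain \<open>F\<close> and make it an interior
  face.\<close>

lemma boundary_face_meets_frontier:
  assumes F: "F \<in> boundary_faces M"
  obtains y where "y \<in> F" "y \<in> frontier \<Omega>"
proof -
  note Ff = boundary_face_is_face[OF F]
  define K where "K = KP F"
  have K: "K \<in> \<T>" "F facet_of K" using KP[OF Ff] by (auto simp: K_def)
  interpret convex_cell K "cell_normal K" by (rule convex_cell_mesh[OF K(1)])
  obtain y where y: "y \<in> rel_interior F" using rel_interior_facet_nonempty[OF K(2)] .
  have yF: "y \<in> F" using y rel_interior_subset by blast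
  have "y \<in> closure \<Omega>" using Union_cells K yF facet_of_imp_subset by blast
  have "y \<in> frontier \<Omega>"
  proof (rule ccontr)
    assume "y \<notin> frontier \<Omega>"
    then have "y \<in> \<Omega>" using \<open>y \<in> closure \<Omega>\<close> open_region by (simp add: frontier_def interior_open)
    have "closed (\<Union>{K'\<in>\<T>. y \<notin> K'})" using finite_cells cell_closed by (intro closed_Union) auto
    then have "open (\<Omega> - \<Union>{K'\<in>\<T>. y \<notin> K'})" using open_region by (rule open_Diff[rotated])
    moreover have "y \<in> \<Omega> - \<Union>{K'\<in>\<T>. y \<notin> K'}" using \<open>y \<in> \<Omega>\<close> by auto
    ultimately obtain e where e: "e > 0" "ball y e \<subseteq> \<Omega> - \<Union>{K'\<in>\<T>. y \<notin> K'}" by (rule openE)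
    define x where "x = y + (e/2) *\<^sub>R cell_normal K F"
    have n: "norm (cell_normal K F) = 1" by (rule norm_nu[OF K(2)])
    have "x \<in> ball y e" using e n by (simp add: x_def dist_norm)
    then have "x \<in> \<Omega>" "x \<notin> \<Union>{K'\<in>\<T>. y \<notin> K'}" using e by auto
    moreover have "x \<in> \<Union>\<T>" using \<open>x \<in> \<Omega>\<close> Union_cells closure_subset by blast
    ultimately obtain K' where K': "K' \<in> \<T>" "x \<in> K'" "y \<in> K'" by blast
    have "cell_normal K F \<bullet> x > off F"
      using n e off_eq[OF K(2) yF] by (simp add: x_def inner_add_right norm_eq_1)
    then have "x \<notin> K" using off_le[OF K(2)] by force
    then have "K \<noteq> K'" using K' by blast
    have "F \<subseteq> K \<inter> K'"
      using subset_of_face_of[OF cells_Int_face[OF K(1) K'(1)], of F] y yF K' facet_of_imp_subset[OF K(2)] by blast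
    then have "F facet_of K'" using shared_facet(2)[OF K(1) K'(1) \<open>K \<noteq> K'\<close> K(2)] by blast
    then have "F \<in> interior_faces M" using K K' \<open>K \<noteq> K'\<close> unfolding interior_faces_def by blast
    then show False using F by (simp add: boundary_faces_def)
  qed
  with yF show ?thesis by (rule that)
qed

text \<open>The two adjacent cells contain complementary half balls. This is the room in which a bump
  around a point of \<open>F\<close> sees no other face.\<close>

lemma interior_face_neighbourhood:
  assumes F: "F \<in> interior_faces M" and y: "y \<in> rel_interior F"
  obtains e where "e > 0" "ball y e \<subseteq> \<Omega>"
    "\<And>G. G \<in> faces M \<Longrightarrow> G \<inter> ball y e \<noteq> {} \<Longrightarrow> G = F"
proof -
  note Ff = interior_face_is_face[OF F]
  have yF: "y \<in> F" using y rel_interior_subset by blast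
  note P = convex_cell_mesh[OF KP(1)[OF Ff]] and Q = convex_cell_mesh[OF KM(1)[OF F]]
  obtain e1 where e1: "e1 > 0" "\<And>x. x \<in> ball y e1 \<Longrightarrow> cell_normal (KP F) F \<bullet> x \<le> convex_cell.off (cell_normal (KP F)) F \<Longrightarrow> x \<in> KP F"
    "\<And>G x. x \<in> ball y e1 \<Longrightarrow> G facet_of KP F \<Longrightarrow> x \<in> G \<Longrightarrow> G = F"
    using convex_cell.half_ball_subset[OF P KP(2)[OF Ff] y] by blast
  obtain e2 where e2: "e2 > 0" "\<And>x. x \<in> ball y e2 \<Longrightarrow> cell_normal (KM F) F \<bullet> x \<le> convex_cell.off (cell_normal (KM F)) F \<Longrightarrow> x \<in> KM F"
    "\<And>G x. x \<in> ball y e2 \<Longrightarrow> G facet_of KM F \<Longrightarrow> x \<in> G \<Longrightarrow> G = F"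
    using convex_cell.half_ball_subset[OF Q KM(2)[OF F] y] by blast
  have cell_normal: "cell_normal (KP F) F = nF F" "cell_normal (KM F) F = - nF F" using KP_neq_KM[OF F] by (auto simp: cell_normal_def)
  have off: "convex_cell.off (cell_normal (KP F)) F = nF F \<bullet> y" "convex_cell.off (cell_normal (KM F)) F = - (nF F \<bullet> y)"
    using convex_cell.off_eq[OF P KP(2)[OF Ff] yF] convex_cell.off_eq[OF Q KM(2)[OF F] yF] by (auto simp: cell_normal)
  define e where "e = min e1 e2"
  have e: "e > 0" "ball y e \<subseteq> ball y e1" "ball y e \<subseteq> ball y e2" using e1 e2 by (auto simp: e_def)
  have sub: "ball y e \<subseteq> KP F \<union> KM F"
  proof
    fix x assume "x \<in> ball y e"
    then have "x \<in> ball y e1" "x \<in> ball y e2" using e by auto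
    then show "x \<in> KP F \<union> KM F"
      using e1(2)[of x] e2(2)[of x] unfolding cell_normal off by (cases "nF F \<bullet> x \<le> nF F \<bullet> y") auto
  qed
  have "ball y e \<subseteq> closure \<Omega>" using sub Union_cells KP(1)[OF Ff] KM(1)[OF F] by blast
  then have "ball y e \<subseteq> \<Omega>" using region_interior interior_maximal[of "ball y e" "closure \<Omega>"] by auto
  moreover have "G = F" if G: "G \<in> faces M" "G \<inter> ball y e \<noteq> {}" for G
  proof -
    obtain x where x: "x \<in> G" "x \<in> ball y e" using G by auto
    obtain K where K: "K \<in> \<T>" "G facet_of K" using G by (auto simp: faces_def)
    have "K = KP F \<or> K = KM F"
    proof (rule ccontr)
      assume n: "\<not> ?thesis"
      obtain z where z: "z \<in> interior K" "z \<in> ball y e"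
      proof -
        have "x \<in> closure (interior K)"
          using convex_closure_interior[OF cell_convex[OF K(1)] cell_interior[OF K(1)]] closure_subset x K facet_of_imp_subset by blast
        then have "ball y e \<inter> interior K \<noteq> {}"
          using x open_Int_closure_eq_empty[of "ball y e" "interior K"] by auto
        then show ?thesis using that by blast
      qed
      then have "z \<in> KP F \<or> z \<in> KM F" using sub by blast
      then show False using interior_Int_cell[OF K(1) KP(1)[OF Ff]] interior_Int_cell[OF K(1) KM(1)[OF F]] n z by blast
    qed
    then show ?thesis using e1(3)[of x G] e2(3)[of x G] e x K by auto
  qed
  ultimately show ?thesis using e(1) that by blast
qed

text \<open>The cell touches the frontier, so the neighbourhood in which \<open>f\<close> vanishes meets its interior
  in a nonempty open set, and there \<open>f\<close> is a polynomial.\<close>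

lemma vanishing_near_boundary:
  fixes f :: "real^'d::_ \<Rightarrow> real"
  assumes N: "inner_neighborhood \<Omega> \<Omega>b" and f0: "vanishes_in \<Omega>b f" and F: "F \<in> boundary_faces M"
    and f: "\<And>x. x \<in> interior (KP F) \<Longrightarrow> f x = p x" and p: "real_polynomial_function p"
  shows "p x = 0"
proof -
  obtain U where U: "open U" "frontier \<Omega> \<subseteq> U" "\<Omega>b = \<Omega> \<inter> U" using N by (auto simp: inner_neighborhood_def)
  obtain y where y: "y \<in> F" "y \<in> frontier \<Omega>" using boundary_face_meets_frontier[OF F] .
  note Ff = boundary_face_is_face[OF F]
  note K = KP(1)[OF Ff]
  have "y \<in> closure (interior (KP F))"
    using convex_closure_interior[OF cell_convex[OF K] cell_interior[OF K]] closure_subset y KP(2)[OF Ff] facet_of_imp_subset by blast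
  then have "U \<inter> interior (KP F) \<noteq> {}"
    using U y open_Int_closure_eq_empty[of U "interior (KP F)"] by auto
  then obtain z where z: "z \<in> U \<inter> interior (KP F)" by blast
  have S: "open (U \<inter> interior (KP F))" using U by auto
  have "AE x in lebesgue. x \<in> U \<inter> interior (KP F) \<longrightarrow> p x = 0"
    using f0 unfolding vanishes_in_def
    by eventually_elim (use f interior_cell_subset[OF K] U(3) in auto)
  then have "p x = 0" if "x \<in> U \<inter> interior (KP F)" for x
    using AE_zero_on_open[OF Ck1_continuous[OF Ck_polynomial[OF p]] S _ that] by blast
  then show ?thesis by (rule polynomial_zero_on_open[OF p S z])
qed

end

section \<open>Normal continuity and discrete incompressibility\<close>

lemma test_function_Ck: "\<psi> \<in> test_functions \<Omega> \<Longrightarrow> Ck m \<psi>"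
  by (auto simp: test_functions_def)

lemma divh_scale:
  fixes p :: "real^'d::finite \<Rightarrow> real^'d"
  assumes "\<psi> differentiable (at x)" "\<And>j. (\<lambda>x. p x $ j) differentiable (at x)"
  shows "divh (\<lambda>x. \<psi> x *\<^sub>R p x) x = p x \<bullet> (\<chi> j. partial j \<psi> x) + divh p x * \<psi> x"
proof -
  have "(\<lambda>x. \<psi> x *\<^sub>R p x) differentiable (at x)" "p differentiable (at x)"
    using assms by (auto simp: vec_differentiable_iff)
  then show ?thesis
    using assms by (simp add: divh_eq partial_mult inner_vec_def sum.distrib sum_distrib_right sum_distrib_left algebra_simps)
qed

lemma continuous_on_vec:
  fixes v :: "real^'d::finite \<Rightarrow> real^'d"
  assumes "\<And>j. continuous_on UNIV (\<lambda>x. v x $ j)"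
  shows "continuous_on UNIV v"
proof -
  have "continuous_on UNIV (\<lambda>x. \<chi> j. v x $ j)"
    by (rule continuous_on_vec_lambda) (rule assms)
  then show ?thesis by simp
qed

lemma continuous_on_divh:
  fixes v :: "real^'d::finite \<Rightarrow> real^'d"
  assumes "\<And>j. Ck (Suc 0) (\<lambda>x. v x $ j)"
  shows "continuous_on UNIV (divh v)"
proof -
  have "divh v = (\<lambda>x. \<Sum>j\<in>UNIV. partial j (\<lambda>x. v x $ j) x)"
  proof
    fix x
    have "v differentiable (at x)" using assms by (simp add: vec_differentiable_iff)
    then show "divh v x = (\<Sum>j\<in>UNIV. partial j (\<lambda>x. v x $ j) x)" by (rule divh_eq)
  qed
  then show ?thesis using assms by (auto intro!: continuous_on_sum)
qed

lemma divh_cong_open: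
  assumes "open S" "x \<in> S" "\<And>y. y \<in> S \<Longrightarrow> f y = g y"
  shows "divh f x = divh g x"
  unfolding divh_def using partial_cong_open[OF assms] by simp

lemma conv_cong_open:
  assumes "open S" "x \<in> S" "\<And>y. y \<in> S \<Longrightarrow> f y = g y" "b x = b' x"
  shows "conv b f x = conv b' g x"
  unfolding conv_def using partial_cong_open[OF assms(1-3)] assms(4) by simp

context mesh
begin

text \<open>The function \<open>p K\<close>, in most uses a polynomial, lives on the whole space, so that it also
  provides the traces of \<open>f\<close> on the faces of \<open>K\<close> and can be differentiated there.\<close>

definition pieces :: "(real^'d::_ \<Rightarrow> 'b) \<Rightarrow> ((real^'d::_) set \<Rightarrow> real^'d::_ \<Rightarrow> 'b) \<Rightarrow> bool" where
  "pieces f p \<longleftrightarrow> (\<forall>K\<in>\<T>. \<forall>x\<in>interior K. f x = p K x)"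

lemma piecesD: "pieces f p \<Longrightarrow> K \<in> \<T> \<Longrightarrow> x \<in> interior K \<Longrightarrow> f x = p K x"
  by (auto simp: pieces_def)

lemma pieces_divh: "pieces v p \<Longrightarrow> pieces (divh v) (\<lambda>K. divh (p K))"
  unfolding pieces_def using divh_cong_open[OF open_interior] by blast

lemma pieces_integral:
  fixes f :: "real^'d::_ \<Rightarrow> real"
  assumes "pieces f p" "\<And>K. K \<in> \<T> \<Longrightarrow> continuous_on UNIV (p K)"
  shows "set_integrable lebesgue \<Omega> f" "(LINT x:\<Omega>|lebesgue. f x) = (\<Sum>K\<in>\<T>. LINT x:K|lebesgue. p K x)"
  using piecewise_integral[of f p] assms by (auto simp: pieces_def)

definition normal_continuous :: "((real^'d::_) set \<Rightarrow> real^'d::_ \<Rightarrow> real^'d::_) \<Rightarrow> bool" where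
  "normal_continuous p \<longleftrightarrow>
     (\<forall>F\<in>interior_faces M. \<forall>x\<in>F. nF F \<bullet> p (KP F) x = nF F \<bullet> p (KM F) x) \<and>
     (\<forall>F\<in>boundary_faces M. \<forall>x\<in>F. nF F \<bullet> p (KP F) x = 0)"

theorem broken_green_identity:
  assumes v: "pieces v p" and p: "\<And>K j. K \<in> \<T> \<Longrightarrow> Ck (Suc 0) (\<lambda>x. p K x $ j)" and \<psi>: "Ck (Suc 0) \<psi>"
  shows "L2_inner \<Omega> v (\<lambda>x. \<chi> j. partial j \<psi> x) + L2_inner \<Omega> (divh v) \<psi> =
      (\<Sum>F\<in>interior_faces M. face_integral (nF F) F (\<lambda>x. (nF F \<bullet> (p (KP F) x - p (KM F) x)) * \<psi> x))
    + (\<Sum>F\<in>boundary_faces M. face_integral (nF F) F (\<lambda>x. (nF F \<bullet> p (KP F) x) * \<psi> x))"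
proof -
  have pc: "continuous_on UNIV (p K)" if "K \<in> \<T>" for K
    by (rule continuous_on_vec) (rule Ck1_continuous[OF p[OF that]])
  have \<psi>c: "continuous_on UNIV \<psi>" "continuous_on UNIV (\<lambda>x. \<chi> j. partial j \<psi> x)"
    using Ck1_continuous[OF \<psi>] \<psi> by (auto intro!: continuous_on_vec_lambda)
  have r1: "pieces (\<lambda>x. v x \<bullet> (\<chi> j. partial j \<psi> x)) (\<lambda>K x. p K x \<bullet> (\<chi> j. partial j \<psi> x))"
    and r2: "pieces (\<lambda>x. divh v x \<bullet> \<psi> x) (\<lambda>K x. divh (p K) x \<bullet> \<psi> x)"
    using v pieces_divh[OF v] by (auto simp: pieces_def)
  have c1: "continuous_on UNIV (\<lambda>x. p K x \<bullet> (\<chi> j. partial j \<psi> x))" 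
    and c2: "continuous_on UNIV (\<lambda>x. divh (p K) x \<bullet> \<psi> x)" if "K \<in> \<T>" for K
    using pc[OF that] \<psi>c continuous_on_divh[OF p[OF that]] by (auto intro!: continuous_on_inner continuous_on_mult)
  have "L2_inner \<Omega> v (\<lambda>x. \<chi> j. partial j \<psi> x) + L2_inner \<Omega> (divh v) \<psi>
      = (\<Sum>K\<in>\<T>. (LINT x:K|lebesgue. p K x \<bullet> (\<chi> j. partial j \<psi> x)) + (LINT x:K|lebesgue. divh (p K) x \<bullet> \<psi> x))"
    unfolding L2_inner_def sum.distrib
    by (intro arg_cong2[where f = "(+)"] pieces_integral(2) r1 r2 c1 c2)
  also have "\<dots> = (\<Sum>K\<in>\<T>. LINT x:K|lebesgue. divh (\<lambda>x. \<psi> x *\<^sub>R p K x) x)"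
  proof (rule sum.cong[OF refl])
    fix K assume K: "K \<in> \<T>"
    have i: "set_integrable lebesgue K (\<lambda>x. p K x \<bullet> (\<chi> j. partial j \<psi> x))" "set_integrable lebesgue K (\<lambda>x. divh (p K) x \<bullet> \<psi> x)"
      unfolding set_integrable_def
      using piecewise_measurable(3)[of "\<lambda>x. v x \<bullet> (\<chi> j. partial j \<psi> x)" "\<lambda>K x. p K x \<bullet> (\<chi> j. partial j \<psi> x)", OF _ c1 K]
        piecewise_measurable(3)[of "\<lambda>x. divh v x \<bullet> \<psi> x" "\<lambda>K x. divh (p K) x \<bullet> \<psi> x", OF _ c2 K] r1 r2
      by (auto simp: pieces_def)
    have "divh (\<lambda>x. \<psi> x *\<^sub>R p K x) x = p K x \<bullet> (\<chi> j. partial j \<psi> x) + divh (p K) x \<bullet> \<psi> x" for x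
      using divh_scale[of \<psi> x "p K"] p[OF K] \<psi> by simp
    then show "(LINT x:K|lebesgue. p K x \<bullet> (\<chi> j. partial j \<psi> x)) + (LINT x:K|lebesgue. divh (p K) x \<bullet> \<psi> x)
       = (LINT x:K|lebesgue. divh (\<lambda>x. \<psi> x *\<^sub>R p K x) x)"
      using set_integral_add(2)[OF i] by simp
  qed
  also have "\<dots> = (\<Sum>F\<in>interior_faces M. face_integral (nF F) F (\<lambda>x. nF F \<bullet> (\<psi> x *\<^sub>R p (KP F) x - \<psi> x *\<^sub>R p (KM F) x)))
    + (\<Sum>F\<in>boundary_faces M. face_integral (nF F) F (\<lambda>x. nF F \<bullet> (\<psi> x *\<^sub>R p (KP F) x)))"
  proof (rule broken_divergence_theorem)
    fix K j assume "K \<in> \<T>"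
    then show "Ck (Suc 0) (\<lambda>x. (\<psi> x *\<^sub>R p K x) $ j)"
      using Ck1_mult[OF \<psi> p] by simp
  qed
  finally show ?thesis
    by (simp add: inner_diff_right algebra_simps)
qed

lemma normal_continuous_green:
  assumes "pieces v p" "\<And>K j. K \<in> \<T> \<Longrightarrow> Ck (Suc 0) (\<lambda>x. p K x $ j)" "Ck (Suc 0) \<psi>"
    and n: "normal_continuous p"
  shows "L2_inner \<Omega> v (\<lambda>x. \<chi> j. partial j \<psi> x) = - L2_inner \<Omega> (divh v) \<psi>"
proof -
  have "face_integral (nF F) F (\<lambda>x. (nF F \<bullet> (p (KP F) x - p (KM F) x)) * \<psi> x) = 0" if "F \<in> interior_faces M" for F
    by (rule face_integral_0[OF flat_face_nF[OF interior_face_is_face[OF that]]])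
      (use n that in \<open>simp add: normal_continuous_def inner_diff_right\<close>)
  moreover have "face_integral (nF F) F (\<lambda>x. (nF F \<bullet> p (KP F) x) * \<psi> x) = 0" if "F \<in> boundary_faces M" for F
    by (rule face_integral_0[OF flat_face_nF[OF boundary_face_is_face[OF that]]])
      (use n that in \<open>simp add: normal_continuous_def\<close>)
  ultimately show ?thesis
    using broken_green_identity[OF assms(1-3)] by simp
qed

lemma L2_integrable:
  fixes g :: "real^'d::_ \<Rightarrow> real"
  assumes "g \<in> L2 \<Omega>" shows "set_integrable lebesgue \<Omega> g"
  unfolding set_integrable_def
proof (rule Bochner_Integration.integrable_bound)
  have \<Omega>m: "\<Omega> \<in> sets lebesgue" using open_region by auto
  have "\<Omega> \<in> lmeasurable" using bounded_region open_region by (simp add: lmeasurable_open)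
  then have "integrable lebesgue (indicat_real \<Omega>)"
    by (auto simp: fmeasurable_def intro!: integrable_real_indicator)
  moreover have "integrable lebesgue (\<lambda>x. indicat_real \<Omega> x *\<^sub>R (norm (g x))\<^sup>2)"
    using assms by (auto simp: L2_def set_integrable_def)
  ultimately show "integrable lebesgue (\<lambda>x. indicat_real \<Omega> x + indicat_real \<Omega> x *\<^sub>R (norm (g x))\<^sup>2)"
    by (rule Bochner_Integration.integrable_add)
  show "(\<lambda>x. indicat_real \<Omega> x *\<^sub>R g x) \<in> borel_measurable lebesgue"
    using assms by (auto simp: L2_def set_borel_measurable_def)
  have "\<bar>g x\<bar> \<le> 1 + (g x)\<^sup>2" for x
  proof (cases "\<bar>g x\<bar> \<le> 1")
    case False
    then have "\<bar>g x\<bar> * 1 \<le> \<bar>g x\<bar> * \<bar>g x\<bar>" by (intro mult_left_mono) auto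
    then show ?thesis by (simp add: power2_eq_square abs_mult_self_eq)
  qed (use zero_le_power2[of "g x"] in linarith)
  then show "AE x in lebesgue. norm (indicat_real \<Omega> x *\<^sub>R g x) \<le> norm (indicat_real \<Omega> x + indicat_real \<Omega> x *\<^sub>R (norm (g x))\<^sup>2)"
    by (intro AE_I2) (auto simp: indicator_def)
qed

text \<open>Test the weak divergence with a bump around a point of the face whose width in the normal
  direction shrinks to zero. By Green's identity the face integral of the normal jump against the
  bump equals a volume integral of the difference between the cellwise and the weak divergence. The
  former does not see the shrinking width, the latter tends to zero with it. Hence the normal jump
  integrates to zero against every narrow bump, and it vanishes.\<close>

lemma Hdiv_normal_jump:
  assumes v: "pieces v p" and p: "\<And>K j. K \<in> \<T> \<Longrightarrow> Ck (Suc 0) (\<lambda>x. p K x $ j)"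
    and H: "v \<in> Hdiv \<Omega>" and F: "F \<in> interior_faces M" and x: "x \<in> F"
  shows "nF F \<bullet> p (KP F) x = nF F \<bullet> p (KM F) x"
proof -
  note Ff = interior_face_is_face[OF F]
  define J where "J x = nF F \<bullet> (p (KP F) x - p (KM F) x)" for x
  have pc: "continuous_on UNIV (p K)" if "K \<in> \<T>" for K
    by (rule continuous_on_vec) (rule Ck1_continuous[OF p[OF that]])
  have Jc: "continuous_on UNIV J"
    unfolding J_def using pc KP(1)[OF Ff] KM(1)[OF F] by (intro continuous_intros) auto
  interpret P: convex_cell "KP F" "cell_normal (KP F)" by (rule convex_cell_mesh[OF KP(1)[OF Ff]])
  have cell_normal: "cell_normal (KP F) F = nF F" by (simp add: cell_normal_def)
  obtain g where g: "g \<in> L2 \<Omega>" "\<And>\<psi>. \<psi> \<in> test_functions \<Omega> \<Longrightarrow> L2_inner \<Omega> v (\<lambda>x. \<chi> j. partial j \<psi> x) = - L2_inner \<Omega> g \<psi>"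
    using H by (auto simp: Hdiv_def)
  have nz: "nF F \<noteq> 0" using KP(3)[OF Ff] by (auto simp: outward_normal_def)
  have zero: "J y = 0" if y: "y \<in> rel_interior F" for y
  proof (rule ccontr)
    assume "J y \<noteq> 0"
    have yF: "y \<in> F" using y rel_interior_subset by blast
    obtain e0 where e0: "e0 > 0" "ball y e0 \<subseteq> \<Omega>" "\<And>G. G \<in> faces M \<Longrightarrow> G \<inter> ball y e0 \<noteq> {} \<Longrightarrow> G = F"
      using interior_face_neighbourhood[OF F y] by blast
    \<comment> \<open>The width \<open>e\<close> is chosen so small that \<open>J\<close> keeps its sign on the support of the bump.\<close>
    have "open {x. 0 < J y * J x}" using Jc by (intro open_Collect_less continuous_intros) auto
    moreover have "y \<in> {x. 0 < J y * J x}" using \<open>J y \<noteq> 0\<close> by (auto simp: zero_less_mult_iff linorder_neq_iff)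
    ultimately obtain e1 where e1: "e1 > 0" "ball y e1 \<subseteq> {x. 0 < J y * J x}" by (rule openE)
    define e where "e = min e0 e1 / 2"
    have e: "e > 0" "ball y e \<subseteq> ball y e1" "ball y e \<subseteq> ball y e0" "cball y e \<subseteq> ball y e0"
      using e0 e1 by (auto simp: e_def)
    define \<psi> where "\<psi> n = bump y (nF F) e (inverse (real (Suc n)))" for n
    define I where "I = face_integral (nF F) F (\<lambda>x. J x * bump y 0 e 1 x)"
    have \<psi>t: "\<psi> n \<in> test_functions \<Omega>" for n
      unfolding \<psi>_def by (rule bump_test_function) (use e e0 in auto)
    have \<psi>0: "\<psi> n x = 0" if "x \<notin> ball y e" for n x
      using bump_support(1)[of e "inverse (real (Suc n))" y "nF F" x] e that by (auto simp: \<psi>_def)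
    have \<psi>c: "continuous_on UNIV (\<psi> n)" for n
      using Ck1_continuous[OF test_function_Ck[OF \<psi>t]] .
    have dv: "set_integrable lebesgue \<Omega> (divh v)"
      by (rule pieces_integral(1)[OF pieces_divh[OF v]]) (rule continuous_on_divh[OF p])
    have gi: "set_integrable lebesgue \<Omega> g" by (rule L2_integrable[OF g(1)])
    have \<psi>i: "set_integrable lebesgue \<Omega> (\<lambda>x. f x * \<psi> n x)" if f: "set_integrable lebesgue \<Omega> f" for f n
      unfolding set_integrable_def
    proof (rule Bochner_Integration.integrable_bound[OF f[unfolded set_integrable_def]])
      have "\<psi> n \<in> borel_measurable lebesgue"
        using borel_measurable_continuous_onI[OF \<psi>c] by (simp add: measurable_completion)
      moreover have "(\<lambda>x. indicat_real \<Omega> x *\<^sub>R f x) \<in> borel_measurable lebesgue"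
        using f unfolding set_integrable_def by auto
      ultimately have "(\<lambda>x. (indicat_real \<Omega> x *\<^sub>R f x) * \<psi> n x) \<in> borel_measurable lebesgue"
        by (rule borel_measurable_times[rotated])
      then show "(\<lambda>x. indicat_real \<Omega> x *\<^sub>R (f x * \<psi> n x)) \<in> borel_measurable lebesgue"
        by (simp add: mult.assoc)
      show "AE x in lebesgue. norm (indicat_real \<Omega> x *\<^sub>R (f x * \<psi> n x)) \<le> norm (indicat_real \<Omega> x *\<^sub>R f x)"
        using bump_bounds[of y "nF F" e "inverse (real (Suc n))"]
        by (intro AE_I2) (auto simp: abs_mult \<psi>_def indicator_def intro!: mult_left_le)
    qed
    \<comment> \<open>The left-hand side does not depend on the normal width \<open>1 / (n + 1)\<close>.\<close>
    have In: "I = (LINT x:\<Omega>|lebesgue. (divh v x - g x) * \<psi> n x)" for n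
    proof -
      have "L2_inner \<Omega> v (\<lambda>x. \<chi> j. partial j (\<psi> n) x) + L2_inner \<Omega> (divh v) (\<psi> n) =
         (\<Sum>G\<in>interior_faces M. face_integral (nF G) G (\<lambda>x. (nF G \<bullet> (p (KP G) x - p (KM G) x)) * \<psi> n x))
       + (\<Sum>G\<in>boundary_faces M. face_integral (nF G) G (\<lambda>x. (nF G \<bullet> p (KP G) x) * \<psi> n x))"
        by (rule broken_green_identity[OF v p test_function_Ck[OF \<psi>t]])
      also have "(\<Sum>G\<in>boundary_faces M. face_integral (nF G) G (\<lambda>x. (nF G \<bullet> p (KP G) x) * \<psi> n x)) = 0"
      proof (rule sum.neutral, rule ballI)
        fix G assume G: "G \<in> boundary_faces M"
        note Gf = boundary_face_is_face[OF G]
        have "G \<noteq> F" using G F by (auto simp: boundary_faces_def)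
        then have "G \<inter> ball y e = {}" using e0(3)[OF Gf] e by blast
        then have "\<psi> n x = 0" if "x \<in> G" for x using \<psi>0 that by blast
        then show "face_integral (nF G) G (\<lambda>x. (nF G \<bullet> p (KP G) x) * \<psi> n x) = 0"
          by (intro face_integral_0[OF flat_face_nF[OF Gf]]) simp
      qed
      also have "(\<Sum>G\<in>interior_faces M. face_integral (nF G) G (\<lambda>x. (nF G \<bullet> (p (KP G) x - p (KM G) x)) * \<psi> n x))
          = (\<Sum>G\<in>{F}. face_integral (nF G) G (\<lambda>x. (nF G \<bullet> (p (KP G) x - p (KM G) x)) * \<psi> n x))"
      proof (rule sum.mono_neutral_right[OF finite_interior_boundary(1)])
        show "\<forall>G\<in>interior_faces M - {F}. face_integral (nF G) G (\<lambda>x. (nF G \<bullet> (p (KP G) x - p (KM G) x)) * \<psi> n x) = 0"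
        proof
          fix G assume G: "G \<in> interior_faces M - {F}"
          then have Gf: "G \<in> faces M" using interior_face_is_face by blast
          then have "G \<inter> ball y e = {}" using e0(3)[OF Gf] e G by blast
          then have "\<psi> n x = 0" if "x \<in> G" for x using \<psi>0 that by blast
          then show "face_integral (nF G) G (\<lambda>x. (nF G \<bullet> (p (KP G) x - p (KM G) x)) * \<psi> n x) = 0"
            by (intro face_integral_0[OF flat_face_nF[OF Gf]]) simp
        qed
      qed (use F in auto)
      also have "\<dots> = I"
      proof -
        have "face_integral (nF F) F (\<lambda>x. J x * \<psi> n x) = I"
          unfolding I_def \<psi>_def
        proof (rule face_integral_cong[OF flat_face_nF[OF Ff]])
          fix x assume "x \<in> F"
          then have "nF F \<bullet> x = nF F \<bullet> y"
            using outward_normal_const[OF KP(3)[OF Ff] facet_of_imp_subset[OF KP(2)[OF Ff]]] yF by blast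
          then show "J x * bump y (nF F) e (inverse (real (Suc n))) x = J x * bump y 0 e 1 x"
            using bump_on_hyperplane by metis
        qed
        then show ?thesis by (simp add: J_def)
      qed
      finally have "I = - L2_inner \<Omega> g (\<psi> n) + L2_inner \<Omega> (divh v) (\<psi> n)"
        using g(2)[OF \<psi>t] by simp
      also have "\<dots> = (LINT x:\<Omega>|lebesgue. divh v x * \<psi> n x) - (LINT x:\<Omega>|lebesgue. g x * \<psi> n x)"
        by (simp add: L2_inner_def)
      also have "\<dots> = (LINT x:\<Omega>|lebesgue. divh v x * \<psi> n x - g x * \<psi> n x)"
        by (rule set_integral_diff(2)[symmetric, OF \<psi>i[OF dv] \<psi>i[OF gi]])
      finally show ?thesis by (simp add: algebra_simps)
    qed
    have "(\<lambda>n. LINT x:\<Omega>|lebesgue. (divh v x - g x) * \<psi> n x) \<longlonglongrightarrow> integral\<^sup>L lebesgue (\<lambda>x::real^'d::_. 0)"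
      unfolding set_lebesgue_integral_def
    proof (rule integral_dominated_convergence[where w = "\<lambda>x. norm (indicat_real \<Omega> x *\<^sub>R (divh v x - g x))"])
      have di: "set_integrable lebesgue \<Omega> (\<lambda>x. divh v x - g x)"
        by (rule set_integral_diff(1)[OF dv gi])
      then show "integrable lebesgue (\<lambda>x. norm (indicat_real \<Omega> x *\<^sub>R (divh v x - g x)))"
        unfolding set_integrable_def by (rule integrable_norm)
      show "(\<lambda>x. indicat_real \<Omega> x *\<^sub>R ((divh v x - g x) * \<psi> n x)) \<in> borel_measurable lebesgue" for n
        using \<psi>i[OF di, of n] unfolding set_integrable_def by auto
      show "AE x in lebesgue. norm (indicat_real \<Omega> x *\<^sub>R ((divh v x - g x) * \<psi> n x)) \<le> norm (indicat_real \<Omega> x *\<^sub>R (divh v x - g x))" for n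
        using bump_bounds[of y "nF F" e "inverse (real (Suc n))"]
        by (intro AE_I2) (auto simp: abs_mult \<psi>_def indicator_def intro!: mult_left_le)
      have "AE x in lebesgue. nF F \<bullet> x \<noteq> nF F \<bullet> y"
        using AE_not_in_hyperplane[of "nF F" "nF F \<bullet> y"] nz by (intro AE_completion) auto
      then show "AE x in lebesgue. (\<lambda>n. indicat_real \<Omega> x *\<^sub>R ((divh v x - g x) * \<psi> n x)) \<longlonglongrightarrow> 0"
      proof eventually_elim
        case (elim x)
        then have d: "\<bar>nF F \<bullet> (x - y)\<bar> > 0" by (simp add: inner_diff_right)
        have "\<forall>\<^sub>F n in sequentially. inverse (real (Suc n)) < \<bar>nF F \<bullet> (x - y)\<bar>"
          using LIMSEQ_inverse_real_of_nat d by (rule order_tendstoD(2))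
        then have "\<forall>\<^sub>F n in sequentially. \<psi> n x = 0"
        proof eventually_elim
          case (elim n)
          then show ?case
            using bump_support(2)[of e "inverse (real (Suc n))" y "nF F" x] e by (force simp: \<psi>_def)
        qed
        then have "\<forall>\<^sub>F n in sequentially. indicat_real \<Omega> x *\<^sub>R ((divh v x - g x) * \<psi> n x) = 0"
          by eventually_elim simp
        then show ?case by (rule tendsto_eventually)
      qed
    qed simp
    then have "(\<lambda>n::nat. I) \<longlonglongrightarrow> 0"
      by (simp flip: In)
    then have I0: "I = 0" by (simp add: LIMSEQ_const_iff)
    have bc: "continuous_on UNIV (bump y 0 e 1)"
      by (rule Ck1_continuous[OF test_function_Ck[OF bump_test_function[of e 1 y \<Omega>]]]) (use e e0 in auto)
    have Jb: "continuous_on UNIV (\<lambda>x. J x * bump y 0 e 1 x)"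
      by (rule continuous_on_mult[OF Jc bc])
    have "J y * (J y * bump y 0 e 1 y) = 0"
    proof (rule P.face_integral_eq_0_imp[OF KP(2)[OF Ff], where f = "\<lambda>x. J y * (J x * bump y 0 e 1 x)"])
      show "continuous_on UNIV (\<lambda>x. J y * (J x * bump y 0 e 1 x))"
        by (rule continuous_on_mult[OF continuous_on_const Jb])
      show "0 \<le> J y * (J x * bump y 0 e 1 x)" for x
      proof (cases "x \<in> ball y e")
        case True
        then have "0 < J y * J x" using e e1 by blast
        then have "0 \<le> (J y * J x) * bump y 0 e 1 x"
          by (rule mult_nonneg_nonneg[OF less_imp_le bump_bounds(1)])
        then show ?thesis by (simp add: mult.assoc)
      next
        case False
        then have "bump y 0 e 1 x = 0" using bump_support(1)[of e 1 y 0 x] e by auto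
        then show ?thesis by simp
      qed
      show "face_integral (cell_normal (KP F) F) F (\<lambda>x. J y * (J x * bump y 0 e 1 x)) = 0"
        unfolding cell_normal using face_integral_add(3)[OF flat_face_nF[OF Ff] Jb Jb, of "J y"] I0 by (simp add: I_def)
    qed (rule y)
    then show False using \<open>J y \<noteq> 0\<close> bump_centre[of y 0 e 1] by simp
  qed
  have "convex F" using KP(2)[OF Ff] P.convex_K face_of_imp_convex facet_of_imp_face_of by blast
  then have "x \<in> closure (rel_interior F)"
    using x convex_closure_rel_interior closure_subset by blast
  moreover have "closed {x. J x = 0}"
    using Jc by (intro closed_Collect_eq continuous_intros) auto
  then have "closure (rel_interior F) \<subseteq> {x. J x = 0}"
    by (intro closure_minimal) (use zero in auto)
  ultimately have "J x = 0" by blast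
  then show ?thesis by (simp add: J_def inner_diff_right)
qed

lemma normal_continuous_Vdiv:
  assumes v: "v \<in> Vdiv M elt k" "pieces v p" and p: "\<And>K. K \<in> \<T> \<Longrightarrow> p K \<in> local_space elt k"
  shows "normal_continuous p"
  unfolding normal_continuous_def
proof (intro conjI ballI)
  have C: "Ck (Suc 0) (\<lambda>x. p K x $ j)" if "K \<in> \<T>" for K j
    by (rule Ck_polynomial[OF local_space_polynomial[OF p[OF that]]])
  show "nF F \<bullet> p (KP F) x = nF F \<bullet> p (KM F) x" if "F \<in> interior_faces M" "x \<in> F" for F x
    by (rule Hdiv_normal_jump[OF v(2) C _ that]) (use v in \<open>auto simp: Vdiv_def\<close>)
  show "nF F \<bullet> p (KP F) x = 0" if F: "F \<in> boundary_faces M" "x \<in> F" for F x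
  proof -
    note Ff = boundary_face_is_face[OF F(1)]
    have "elem_trace (KP F) v x = p (KP F) x"
      by (rule elem_trace_eq[OF KP(1)[OF Ff] piecesD[OF v(2) KP(1)[OF Ff]] continuous_on_vec])
        (use Ck1_continuous[OF C[OF KP(1)[OF Ff]]] F facet_of_imp_subset[OF KP(2)[OF Ff]] in auto)
    moreover have "elem_trace (KP F) v x \<bullet> nF F = 0" using v(1) F unfolding Vdiv_def by blast
    ultimately show ?thesis by (simp add: inner_commute)
  qed
qed

lemma jump_pieces:
  fixes p :: "(real^'d::_) set \<Rightarrow> real^'d::_ \<Rightarrow> 'b::real_normed_vector"
  assumes "pieces v p" "\<And>K. K \<in> \<T> \<Longrightarrow> continuous_on UNIV (p K)" "x \<in> F"
  shows "F \<in> interior_faces M \<Longrightarrow> jump M F v x = p (KP F) x - p (KM F) x"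
    and "F \<in> boundary_faces M \<Longrightarrow> jump M F v x = p (KP F) x"
    and "F \<in> interior_faces M \<Longrightarrow> avg M F v x = (1/2) *\<^sub>R (p (KP F) x + p (KM F) x)"
    and "F \<in> boundary_faces M \<Longrightarrow> avg M F v x = p (KP F) x"
proof -
  have tr: "elem_trace K v x = p K x" if "K \<in> \<T>" "F facet_of K" for K
    using elem_trace_eq[OF that(1) piecesD[OF assms(1) that(1)] assms(2)[OF that(1)]] assms(3) facet_of_imp_subset[OF that(2)] by auto
  show "F \<in> interior_faces M \<Longrightarrow> jump M F v x = p (KP F) x - p (KM F) x"
    "F \<in> boundary_faces M \<Longrightarrow> jump M F v x = p (KP F) x"
    "F \<in> interior_faces M \<Longrightarrow> avg M F v x = (1/2) *\<^sub>R (p (KP F) x + p (KM F) x)"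
    "F \<in> boundary_faces M \<Longrightarrow> avg M F v x = p (KP F) x"
    using tr KP KM interior_face_is_face boundary_face_is_face by (auto simp: jump_def avg_def boundary_faces_def)
qed

lemma normal_jump_zero:
  assumes "pieces v p" "\<And>K. K \<in> \<T> \<Longrightarrow> continuous_on UNIV (p K)" "normal_continuous p" "F \<in> faces M" "x \<in> F"
  shows "jump M F v x \<bullet> nF F = 0"
proof (cases "F \<in> interior_faces M")
  case True
  then have "jump M F v x = p (KP F) x - p (KM F) x" using jump_pieces(1)[OF assms(1,2,5)] by simp
  then show ?thesis using assms(3,5) True by (simp add: normal_continuous_def inner_commute inner_diff_right)
next
  case False
  then have F: "F \<in> boundary_faces M" using assms(4) by (simp add: boundary_faces_def)
  then have "jump M F v x = p (KP F) x" using jump_pieces(2)[OF assms(1,2,5)] by simp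
  then show ?thesis using assms(3,5) F by (simp add: normal_continuous_def inner_commute)
qed

lemma face_inner_0:
  assumes "F \<in> faces M" "\<And>x. x \<in> F \<Longrightarrow> f x \<bullet> g x = 0"
  shows "face_inner M F f g = 0"
  unfolding face_inner_def by (rule face_integral_0[OF flat_face_nF[OF assms(1)] assms(2)])

lemma bh_normal_continuous:
  assumes "pieces v p" "\<And>K. K \<in> \<T> \<Longrightarrow> continuous_on UNIV (p K)" "normal_continuous p"
  shows "bh M v q = L2_inner \<Omega> (divh v) q"
proof -
  have "face_inner M F (\<lambda>x. jump M F v x \<bullet> nF F) (avg M F q) = 0" if "F \<in> faces M" for F
    by (rule face_inner_0[OF that]) (simp add: normal_jump_zero[OF assms that])
  then show ?thesis by (simp add: bh_def)
qed

text \<open>The divergence of \<open>v\<close> is itself an admissible pressure: it has the right degree, and its mean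
  is zero because all normal jumps vanish. Tested with it, the constraint says that its square has
  integral zero.\<close>

lemma pointwise_divergence_free:
  assumes v: "pieces v p" and p: "\<And>K. K \<in> \<T> \<Longrightarrow> p K \<in> local_space elt k" and n: "normal_continuous p"
    and b: "\<And>q. q \<in> Qh M k \<Longrightarrow> bh M v q = 0" and K: "K \<in> \<T>"
  shows "divh (p K) x = 0"
proof -
  have C: "Ck (Suc 0) (\<lambda>x. p K x $ j)" if "K \<in> \<T>" for K j
    by (rule Ck_polynomial[OF local_space_polynomial[OF p[OF that]]])
  have pc: "continuous_on UNIV (p K)" if "K \<in> \<T>" for K
    by (rule continuous_on_vec) (rule Ck1_continuous[OF C[OF that]])
  note dc = continuous_on_divh[OF C]
  note dr = pieces_divh[OF v]
  have "L2_inner \<Omega> v (\<lambda>x. \<chi> j. partial j (\<lambda>x. 1) x) = - L2_inner \<Omega> (divh v) (\<lambda>x. 1)"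
    by (rule normal_continuous_green[OF v C _ n]) (auto intro: Ck_polynomial)
  then have mean: "(LINT x:\<Omega>|lebesgue. divh v x) = 0"
    by (simp add: L2_inner_def zero_vec_def[symmetric])
  have "divh v \<in> Qh M k"
    unfolding Qh_def
  proof (intro CollectI conjI ballI)
    show "divh v \<in> L2 \<Omega>"
      by (rule piecewise_L2[where p = "\<lambda>K. divh (p K)"]) (use dr dc in \<open>auto simp: pieces_def\<close>)
    show "\<exists>q\<in>polys k. \<forall>x\<in>interior K. divh v x = q x" if "K \<in> \<T>" for K
      using divh_local_space[OF p[OF that]] piecesD[OF dr that] by blast
  qed (rule mean)
  then have "L2_inner \<Omega> (divh v) (divh v) = 0"
    using b bh_normal_continuous[OF v pc n] by simp
  moreover have r2: "pieces (\<lambda>x. divh v x \<bullet> divh v x) (\<lambda>K x. (divh (p K) x)\<^sup>2)"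
    using dr by (auto simp: pieces_def power2_eq_square)
  have dc2: "continuous_on UNIV (\<lambda>x. (divh (p K) x)\<^sup>2)" if "K \<in> \<T>" for K
    using dc[OF that] by (intro continuous_intros)
  ultimately have s0: "(\<Sum>K\<in>\<T>. LINT x:K|lebesgue. (divh (p K) x)\<^sup>2) = 0"
    using pieces_integral(2)[OF r2 dc2] by (simp add: L2_inner_def)
  have nn: "0 \<le> (LINT x:K|lebesgue. (divh (p K) x)\<^sup>2)" for K
    unfolding set_lebesgue_integral_def by (intro Bochner_Integration.integral_nonneg_AE AE_I2) auto
  have "(LINT x:K|lebesgue. (divh (p K) x)\<^sup>2) = 0"
    using s0 K nn by (simp add: sum_nonneg_eq_0_iff[OF finite_cells])
  moreover have "integrable lebesgue (\<lambda>x. indicat_real K x *\<^sub>R (divh (p K) x)\<^sup>2)"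
    by (rule piecewise_measurable(3)[of "\<lambda>x. divh v x \<bullet> divh v x" "\<lambda>K x. (divh (p K) x)\<^sup>2"])
      (use r2 dc2 K in \<open>auto simp: pieces_def\<close>)
  ultimately have "AE x in lebesgue. indicat_real K x *\<^sub>R (divh (p K) x)\<^sup>2 = 0"
    unfolding set_lebesgue_integral_def by (subst (asm) integral_nonneg_eq_0_iff_AE) auto
  then have "AE x in lebesgue. x \<in> interior K \<longrightarrow> divh (p K) x = 0"
    by eventually_elim (use interior_subset in \<open>auto simp: indicator_def\<close>)
  then have z: "divh (p K) x = 0" if "x \<in> interior K" for x
    using AE_zero_on_open[OF dc[OF K] open_interior _ that] by blast
  obtain y where y: "y \<in> interior K" using cell_interior[OF K] by auto
  show ?thesis
    by (rule polynomial_zero_on_open[OF polys_polynomial[OF divh_local_space[OF p[OF K]]] open_interior y z])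
qed

end

section \<open>Conforming test fields\<close>

text \<open>With vertices \<open>u\<close>, barycentric coordinates \<open>bc u\<close>, and \<open>a\<close> the vertex opposite to \<open>G\<close>, take
  the field \<open>\<Sum>u. bc u x *\<^sub>R (((\<nu> G \<bullet> (b + A u)) / H a) *\<^sub>R (u - a))\<close>, where \<open>H a\<close> is the height over
  \<open>G\<close>. On another facet the coordinate of its opposite vertex vanishes, and all other directions
  \<open>u - a\<close> are tangential. On \<open>G\<close> the coordinate of \<open>a\<close> vanishes, every direction
  \<open>u - a\<close> with \<open>u \<noteq> a\<close> has normal component \<open>H a\<close>, and \<open>b + A x\<close> is the affine interpolant of its
  vertex values.\<close>

lemma simplex_normal_lift:
  fixes K :: "(real^'d::finite) set"
  assumes cell: "convex_cell K \<nu>" and splx: "int CARD('d) simplex K" and A: "linear A" and G: "G facet_of K"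
  obtains b' A' where "linear A'" "\<And>x. x \<in> G \<Longrightarrow> \<nu> G \<bullet> (b' + A' x) = \<nu> G \<bullet> (b + A x)"
    "\<And>G' x. G' facet_of K \<Longrightarrow> G' \<noteq> G \<Longrightarrow> x \<in> G' \<Longrightarrow> \<nu> G' \<bullet> (b' + A' x) = 0"
proof -
  interpret convex_cell K \<nu> by (rule cell)
  obtain C where C: "finite C" "\<not> affine_dependent C" "int (card C) = int CARD('d) + 1" "K = convex hull C"
    using splx unfolding simplex by auto
  have "2 \<le> card C" using C(3) zero_less_card_finite[where 'a = 'd] by linarith
  define fc where "fc u = convex hull (C - {u})" for u
  have facet: "T facet_of K \<longleftrightarrow> (\<exists>u\<in>C. T = fc u)" for T
    using facet_of_convex_hull_affine_independent_alt[OF C(2), of T] \<open>2 \<le> card C\<close> C(4) by (auto simp: fc_def)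
  then have fcK: "fc u facet_of K" if "u \<in> C" for u using that by blast
  have CK: "u \<in> K" if "u \<in> C" for u using that C(4) hull_inc by metis
  have vert: "\<nu> (fc u) \<bullet> w = off (fc u)" if "u \<in> C" "w \<in> C" "w \<noteq> u" for u w
    by (rule off_eq[OF fcK[OF that(1)]]) (use that in \<open>auto simp: fc_def intro: hull_inc\<close>)
  define H where "H u = off (fc u) - \<nu> (fc u) \<bullet> u" for u
  have H: "H u \<noteq> 0" if u: "u \<in> C" for u
  proof
    assume "H u = 0"
    then have "u \<in> fc u" using facet_eq[OF fcK[OF u]] CK[OF u] by (auto simp: H_def)
    then have "C \<subseteq> fc u" unfolding fc_def by (auto intro: hull_inc)
    then have "K \<subseteq> fc u" unfolding C(4) by (rule hull_minimal) (simp add: fc_def)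
    then have "fc u = K" using facet_of_imp_subset[OF fcK[OF u]] by blast
    then show False using fcK[OF u] by simp
  qed
  \<comment> \<open>The barycentric coordinate of \<open>u\<close>, as the normalised distance to the facet opposite to \<open>u\<close>.\<close>
  define bc where "bc u x = (off (fc u) - \<nu> (fc u) \<bullet> x) / H u" for u x
  have bc_comb: "bc u (\<Sum>w\<in>C. t w *\<^sub>R w) = t u" if u: "u \<in> C" and t: "sum t C = 1" for u t
  proof -
    have "off (fc u) - \<nu> (fc u) \<bullet> (\<Sum>w\<in>C. t w *\<^sub>R w) = (\<Sum>w\<in>C. t w * (off (fc u) - \<nu> (fc u) \<bullet> w))"
      using t by (simp add: inner_sum_right right_diff_distrib sum_subtractf flip: sum_distrib_right)
    also have "\<dots> = (\<Sum>w\<in>C. if w = u then t u * H u else 0)"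
      by (rule sum.cong) (use vert[OF u] in \<open>auto simp: H_def\<close>)
    also have "\<dots> = t u * H u" using u C(1) by simp
    finally show ?thesis using H[OF u] by (simp add: bc_def)
  qed
  obtain a where a: "a \<in> C" "G = fc a" using facet G by blast
  define c where "c u = ((\<nu> G \<bullet> (b + A u)) / H a) *\<^sub>R (u - a)" for u
  define A' where "A' x = - (\<Sum>u\<in>C. ((\<nu> (fc u) \<bullet> x) / H u) *\<^sub>R c u)" for x
  define b' where "b' = (\<Sum>u\<in>C. (off (fc u) / H u) *\<^sub>R c u)"
  have W: "b' + A' x = (\<Sum>u\<in>C. bc u x *\<^sub>R c u)" for x
    by (simp add: A'_def b'_def bc_def diff_divide_distrib scaleR_left_diff_distrib sum_subtractf)
  show ?thesis
  proof (rule that)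
    show "linear A'"
      by (rule linearI) (simp_all add: A'_def inner_add_right add_divide_distrib scaleR_add_left sum.distrib scaleR_sum_right)
    show "\<nu> G' \<bullet> (b' + A' x) = 0" if G': "G' facet_of K" "G' \<noteq> G" "x \<in> G'" for G' x
    proof -
      obtain m where m: "m \<in> C" "G' = fc m" using facet G' by blast
      then have "m \<noteq> a" using G' a by auto
      have "bc u x * (\<nu> G' \<bullet> c u) = 0" if "u \<in> C" for u
      proof (cases "u = m")
        case True
        then have "bc u x = 0" using off_eq[OF G'(1,3)] m by (simp add: bc_def)
        then show ?thesis by simp
      next
        case False
        then have "\<nu> G' \<bullet> u = off G'" "\<nu> G' \<bullet> a = off G'"
          using vert m that a(1) \<open>m \<noteq> a\<close> by auto
        then show ?thesis by (simp add: c_def inner_diff_right)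
      qed
      then show ?thesis
        unfolding W inner_sum_right inner_scaleR_right by (intro sum.neutral ballI)
    qed
    show "\<nu> G \<bullet> (b' + A' x) = \<nu> G \<bullet> (b + A x)" if x: "x \<in> G" for x
    proof -
      have "x \<in> convex hull C" using x G facet_of_imp_subset C(4) by blast
      then obtain t where t: "sum t C = 1" "x = (\<Sum>w\<in>C. t w *\<^sub>R w)"
        using convex_hull_finite[OF C(1)] by auto
      have "bc a x = 0" using off_eq[OF G x] a by (simp add: bc_def)
      then have ta: "t a = 0" using bc_comb[OF a(1) t(1)] t(2) by simp
      have "\<nu> G \<bullet> (b' + A' x) = (\<Sum>u\<in>C. t u * (\<nu> G \<bullet> c u))"
        unfolding W inner_sum_right by (rule sum.cong) (use bc_comb t in auto)
      also have "\<dots> = (\<Sum>u\<in>C. t u * (\<nu> G \<bullet> (b + A u)))"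
      proof (rule sum.cong[OF refl])
        fix u assume u: "u \<in> C"
        show "t u * (\<nu> G \<bullet> c u) = t u * (\<nu> G \<bullet> (b + A u))"
        proof (cases "u = a")
          case False
          have "\<nu> G \<bullet> (u - a) = H a" using vert[OF a(1) u False] a by (simp add: H_def inner_diff_right)
          then have "\<nu> G \<bullet> c u = \<nu> G \<bullet> (b + A u)" using H[OF a(1)] by (simp add: c_def)
          then show ?thesis by simp
        qed (simp add: ta)
      qed
      also have "\<dots> = \<nu> G \<bullet> (\<Sum>u\<in>C. t u *\<^sub>R (b + A u))"
        by (simp add: inner_sum_right)
      also have "(\<Sum>u\<in>C. t u *\<^sub>R (b + A u)) = b + A x"
        using t by (simp add: scaleR_add_right sum.distrib linear_sum[OF A] linear_scale[OF A] flip: scaleR_left.sum)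
      finally show ?thesis .
    qed
  qed
qed

lemma simplex_remove_normal_flux:
  fixes K :: "(real^'d::finite) set"
  assumes cell: "convex_cell K \<nu>" and splx: "int CARD('d) simplex K" and A: "linear A"
    and S: "finite S" "S \<subseteq> {G. G facet_of K}"
  obtains b' A' where "linear A'"
    "\<And>G x. G facet_of K \<Longrightarrow> x \<in> G \<Longrightarrow> \<nu> G \<bullet> (b' + A' x) = (if G \<in> S then 0 else \<nu> G \<bullet> (b + A x))"
proof -
  have "\<exists>b' A'. linear A' \<and> (\<forall>G x. G facet_of K \<and> x \<in> G \<longrightarrow> \<nu> G \<bullet> (b' + A' x) = (if G \<in> S then 0 else \<nu> G \<bullet> (b + A x)))"
    using S
  proof (induction S rule: finite_induct)
    case empty
    then show ?case using A by auto
  next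
    case (insert F S)
    then obtain b1 A1 where 1: "linear A1"
      "\<forall>G x. G facet_of K \<and> x \<in> G \<longrightarrow> \<nu> G \<bullet> (b1 + A1 x) = (if G \<in> S then 0 else \<nu> G \<bullet> (b + A x))"
      by auto
    have F: "F facet_of K" using insert by auto
    obtain b2 A2 where 2: "linear A2" "\<And>x. x \<in> F \<Longrightarrow> \<nu> F \<bullet> (b2 + A2 x) = \<nu> F \<bullet> (b + A x)"
      "\<And>G' x. G' facet_of K \<Longrightarrow> G' \<noteq> F \<Longrightarrow> x \<in> G' \<Longrightarrow> \<nu> G' \<bullet> (b2 + A2 x) = 0"
      by (rule simplex_normal_lift[OF cell splx A F, where b = b]) (rule that; blast)
    have "linear (\<lambda>x. A1 x - A2 x)" using 1(1) 2(1) by (rule linear_compose_sub)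
    moreover have "\<nu> G \<bullet> ((b1 - b2) + (A1 x - A2 x)) = (if G \<in> insert F S then 0 else \<nu> G \<bullet> (b + A x))"
      if "G facet_of K" "x \<in> G" for G x
    proof -
      have "\<nu> G \<bullet> ((b1 - b2) + (A1 x - A2 x)) = \<nu> G \<bullet> (b1 + A1 x) - \<nu> G \<bullet> (b2 + A2 x)"
        by (simp add: inner_add_right inner_diff_right)
      then show ?thesis
        using 1(2)[rule_format, OF conjI[OF that]] 2(2)[of x] 2(3)[OF that(1) _ that(2)] insert(2) that by (cases "G = F") auto
    qed
    ultimately show ?case by blast
  qed
  then show ?thesis using that by blast
qed

context mesh
begin

lemma affine_Ck:
  fixes A :: "real^'d::_ \<Rightarrow> real^'d::_"
  assumes "linear A" shows "Ck m (\<lambda>x. (b + A x) $ j)"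
proof -
  have "bounded_linear (\<lambda>x. A x $ j)"
    using assms by (intro bounded_linear_compose[OF bounded_linear_vec_nth]) (simp add: linear_conv_bounded_linear)
  then have "real_polynomial_function (\<lambda>x. b $ j + A x $ j)"
    by (intro real_polynomial_function.intros)
  then show ?thesis using Ck_polynomial by simp
qed

lemma pieces_exist:
  fixes V :: "(real^'d::_) set \<Rightarrow> real^'d::_ \<Rightarrow> 'b"
  obtains v where "pieces v V"
proof -
  define v where "v x = V (SOME K. K \<in> \<T> \<and> x \<in> interior K) x" for x
  have "v x = V K x" if K: "K \<in> \<T>" "x \<in> interior K" for K x
  proof -
    have "(SOME K. K \<in> \<T> \<and> x \<in> interior K) = K"
    proof (rule some_equality)
      fix K' assume "K' \<in> \<T> \<and> x \<in> interior K'"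
      then show "K' = K" using interior_Int_cell[of K' K] K interior_subset by blast
    qed (use K in auto)
    then show ?thesis by (simp add: v_def)
  qed
  then have "pieces v V" unfolding pieces_def by blast
  then show ?thesis by (rule that)
qed

text \<open>The rigid motion itself is not admissible, as it may cross the boundary of the domain. It is
  corrected in the cells with a boundary face only, by affine fields that cancel the flux through
  their boundary faces and leave the flux through all their other faces unchanged.\<close>

lemma conforming_test_field:
  fixes A :: "real^'d::_ \<Rightarrow> real^'d::_"
  assumes k: "elt = RT \<Longrightarrow> k \<ge> 1" and A: "linear A"
  obtains v V where "v \<in> Vdiv M elt k" "pieces v V" "normal_continuous V"
    "\<And>K. K \<in> \<T> \<Longrightarrow> \<forall>F\<in>boundary_faces M. KP F \<noteq> K \<Longrightarrow> V K = (\<lambda>x. b + A x)"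
    "\<And>K j. K \<in> \<T> \<Longrightarrow> Ck (Suc 0) (\<lambda>x. V K x $ j)"
    "\<And>F x. F \<in> interior_faces M \<Longrightarrow> x \<in> F \<Longrightarrow> nF F \<bullet> V (KP F) x = nF F \<bullet> (b + A x)"
    "\<And>F x. F \<in> interior_faces M \<Longrightarrow> x \<in> F \<Longrightarrow> nF F \<bullet> V (KM F) x = nF F \<bullet> (b + A x)"
proof -
  define good where "good K b' A' \<longleftrightarrow> linear A' \<and> 
     (\<forall>G x. G facet_of K \<and> x \<in> G \<longrightarrow> cell_normal K G \<bullet> (b' + A' x) = (if G \<in> boundary_faces M then 0 else cell_normal K G \<bullet> (b + A x))) \<and>
     ((\<forall>F\<in>boundary_faces M. KP F \<noteq> K) \<longrightarrow> b' = b \<and> A' = A)" for K b' A'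
  have "\<exists>b' A'. good K b' A'" if K: "K \<in> \<T>" for K
  proof (cases "\<forall>F\<in>boundary_faces M. KP F \<noteq> K")
    case True
    have "G \<notin> boundary_faces M" if "G facet_of K" for G
      using cells_at_boundary_face[of G] K True that by blast
    then have "good K b A" using A by (auto simp: good_def)
    then show ?thesis by blast
  next
    case False
    define S where "S = {G. G facet_of K} \<inter> boundary_faces M"
    have S: "finite S" "S \<subseteq> {G. G facet_of K}" using finite_interior_boundary by (auto simp: S_def)
    obtain b' A' where *: "linear A'"
      "\<And>G x. G facet_of K \<Longrightarrow> x \<in> G \<Longrightarrow> cell_normal K G \<bullet> (b' + A' x) = (if G \<in> S then 0 else cell_normal K G \<bullet> (b + A x))"
      by (rule simplex_remove_normal_flux[OF convex_cell_mesh[OF K] cell_simplex[OF K] A S, where b = b]) (rule that; blast)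
    have "cell_normal K G \<bullet> (b' + A' x) = (if G \<in> boundary_faces M then 0 else cell_normal K G \<bullet> (b + A x))"
      if "G facet_of K \<and> x \<in> G" for G x
      using *(2)[of G x] that by (simp add: S_def)
    then have "good K b' A'" unfolding good_def using False *(1) by blast
    then show ?thesis by blast
  qed
  then obtain B' A' where good: "\<And>K. K \<in> \<T> \<Longrightarrow> good K (B' K) (A' K)" by metis
  define V where "V K x = B' K + A' K x" for K x
  obtain v where v: "pieces v V" by (rule pieces_exist)
  have lin: "linear (A' K)" if "K \<in> \<T>" for K using good[OF that] by (simp add: good_def)
  have VC: "Ck (Suc 0) (\<lambda>x. V K x $ j)" if "K \<in> \<T>" for K j
    unfolding V_def by (rule affine_Ck[OF lin[OF that]])
  have Vc: "continuous_on UNIV (V K)" if "K \<in> \<T>" for K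
    by (rule continuous_on_vec) (rule Ck1_continuous[OF VC[OF that]])
  have flux: "cell_normal K G \<bullet> V K x = (if G \<in> boundary_faces M then 0 else cell_normal K G \<bullet> (b + A x))"
    if "K \<in> \<T>" "G facet_of K" "x \<in> G" for K G x
    using good[OF that(1)] that(2,3) unfolding good_def V_def by blast
  have iP: "nF F \<bullet> V (KP F) x = nF F \<bullet> (b + A x)" and iM: "nF F \<bullet> V (KM F) x = nF F \<bullet> (b + A x)"
    if F: "F \<in> interior_faces M" "x \<in> F" for F x
  proof -
    note Ff = interior_face_is_face[OF F(1)]
    have nb: "F \<notin> boundary_faces M" using F by (auto simp: boundary_faces_def)
    show "nF F \<bullet> V (KP F) x = nF F \<bullet> (b + A x)"
      using flux[OF KP(1,2)[OF Ff] F(2)] nb by (simp add: cell_normal_def)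
    have "cell_normal (KM F) F \<bullet> V (KM F) x = cell_normal (KM F) F \<bullet> (b + A x)"
      using flux[OF KM(1,2)[OF F(1)] F(2)] nb by simp
    then show "nF F \<bullet> V (KM F) x = nF F \<bullet> (b + A x)"
      using KP_neq_KM[OF F(1)] by (simp add: cell_normal_def)
  qed
  have bd: "nF F \<bullet> V (KP F) x = 0" if F: "F \<in> boundary_faces M" "x \<in> F" for F x
  proof -
    note Ff = boundary_face_is_face[OF F(1)]
    show ?thesis using flux[OF KP(1,2)[OF Ff] F(2)] F(1) by (simp add: cell_normal_def)
  qed
  have nc: "normal_continuous V" using iP iM bd by (simp add: normal_continuous_def)
  have "v \<in> Vdiv M elt k"
    unfolding Vdiv_def
  proof (intro CollectI conjI ballI)
    show "v \<in> Hdiv \<Omega>"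
      unfolding Hdiv_def
    proof (intro CollectI conjI bexI ballI)
      show "v \<in> L2 \<Omega>" by (rule piecewise_L2[where p = V]) (use v Vc in \<open>auto simp: pieces_def\<close>)
      show "divh v \<in> L2 \<Omega>"
        by (rule piecewise_L2[where p = "\<lambda>K. divh (V K)"])
          (use pieces_divh[OF v] continuous_on_divh[OF VC] in \<open>auto simp: pieces_def\<close>)
      show "L2_inner \<Omega> v (\<lambda>x. \<chi> j. partial j \<psi> x) = - L2_inner \<Omega> (divh v) \<psi>" if "\<psi> \<in> test_functions \<Omega>" for \<psi>
        by (rule normal_continuous_green[OF v VC test_function_Ck[OF that] nc])
    qed
    show "\<exists>w\<in>local_space elt k. \<forall>x\<in>interior K. v x = w x" if K: "K \<in> \<T>" for K
    proof (rule bexI)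
      show "V K \<in> local_space elt k"
        by (rule affine_field_in_local_space[OF _ lin[OF K] k]) (simp_all add: V_def)
    qed (use piecesD[OF v K] in auto)
    show "elem_trace (KP F) v x \<bullet> nF F = 0" if F: "F \<in> boundary_faces M" "x \<in> F" for F x
    proof -
      note Ff = boundary_face_is_face[OF F(1)]
      have "elem_trace (KP F) v x = V (KP F) x"
        by (rule elem_trace_eq[OF KP(1)[OF Ff] piecesD[OF v KP(1)[OF Ff]] Vc[OF KP(1)[OF Ff]]])
          (use F facet_of_imp_subset[OF KP(2)[OF Ff]] in auto)
      then show ?thesis using bd[OF F] by (simp add: inner_commute)
    qed
  qed
  moreover have "V K = (\<lambda>x. b + A x)" if "K \<in> \<T>" "\<forall>F\<in>boundary_faces M. KP F \<noteq> K" for K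
    using good[OF that(1)] that(2) by (auto simp: good_def V_def)
  ultimately show ?thesis using that v nc VC iP iM by blast
qed

end

section \<open>Rigid motions and the convective fluxes\<close>

lemma local_space_lincomb:
  fixes v w :: "real^'d::finite \<Rightarrow> real^'d"
  assumes "v \<in> local_space elt k" "w \<in> local_space elt k"
  shows "(\<lambda>x. a *\<^sub>R v x + b *\<^sub>R w x) \<in> local_space elt k"
proof (cases elt)
  case RT
  obtain p q where pq: "\<And>i. (\<lambda>x. p x $ i) \<in> polys k" "q \<in> polys k" "\<And>x. v x = p x + q x *\<^sub>R x"
    using assms(1) RT by auto
  obtain p' q' where pq': "\<And>i. (\<lambda>x. p' x $ i) \<in> polys k" "q' \<in> polys k" "\<And>x. w x = p' x + q' x *\<^sub>R x"
    using assms(2) RT by auto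
  have 1: "(\<lambda>x. (a *\<^sub>R p x + b *\<^sub>R p' x) $ i) \<in> polys k" for i
    using polys_lincomb[OF pq(1) pq'(1)] by simp
  have 2: "(\<lambda>x. a * q x + b * q' x) \<in> polys k"
    by (rule polys_lincomb[OF pq(2) pq'(2)])
  have 3: "a *\<^sub>R v x + b *\<^sub>R w x = (a *\<^sub>R p x + b *\<^sub>R p' x) + (a * q x + b * q' x) *\<^sub>R x" for x
    by (simp add: pq(3) pq'(3) algebra_simps)
  show ?thesis
    unfolding RT local_space.simps
    by (rule CollectI, rule exI[of _ "\<lambda>x. a *\<^sub>R p x + b *\<^sub>R p' x"], rule exI[of _ "\<lambda>x. a * q x + b * q' x"]) (use 1 2 3 in blast)
next
  case BDM
  have "(\<lambda>x. v x $ i) \<in> polys (k + 1)" "(\<lambda>x. w x $ i) \<in> polys (k + 1)" for i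
    using assms BDM by auto
  from polys_lincomb[OF this] show ?thesis
    unfolding BDM by simp
qed

lemma real_polynomial_function_inner:
  fixes f g :: "real^'d::finite \<Rightarrow> real^'d"
  assumes "\<And>i. real_polynomial_function (\<lambda>x. f x $ i)" "\<And>i. real_polynomial_function (\<lambda>x. g x $ i)"
  shows "real_polynomial_function (\<lambda>x. f x \<bullet> g x)"
  unfolding inner_vec_def inner_real_def
  by (intro real_polynomial_function_sum real_polynomial_function.intros(4) assms) simp

lemma partial_inner:
  fixes f g :: "real^'d::finite \<Rightarrow> real^'d"
  assumes "\<And>i. (\<lambda>x. f x $ i) differentiable (at x)" "\<And>i. (\<lambda>x. g x $ i) differentiable (at x)"
  shows "partial j (\<lambda>x. f x \<bullet> g x) x = (\<Sum>i\<in>UNIV. partial j (\<lambda>x. f x $ i) x * g x $ i + f x $ i * partial j (\<lambda>x. g x $ i) x)"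
  unfolding inner_vec_def inner_real_def
  using assms by (subst partial_sum) (auto simp: partial_mult intro!: differentiable_mult)

lemma conv_inner:
  fixes v w :: "real^'d::finite \<Rightarrow> real^'d"
  assumes "v differentiable (at x)"
  shows "conv b v x \<bullet> w x = (\<Sum>j\<in>UNIV. b x $ j * (\<Sum>i\<in>UNIV. partial j (\<lambda>x. v x $ i) x * w x $ i))"
proof -
  have "conv b v x \<bullet> w x = (\<Sum>i\<in>UNIV. \<Sum>j\<in>UNIV. b x $ j * (partial j (\<lambda>x. v x $ i) x * w x $ i))"
    by (simp add: conv_def inner_vec_def partial_nth[OF assms] sum_distrib_right mult.assoc)
  also have "\<dots> = (\<Sum>j\<in>UNIV. \<Sum>i\<in>UNIV. b x $ j * (partial j (\<lambda>x. v x $ i) x * w x $ i))"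
    by (rule sum.swap)
  finally show ?thesis by (simp add: sum_distrib_left)
qed

text \<open>Translations and rotations: the axes \<open>e\<^sub>i\<close> are the case \<open>A = 0\<close>, and the angular momentum
  fields are skew-symmetric linear maps.\<close>

locale rigid_motion =
  fixes A :: "real^'d::finite \<Rightarrow> real^'d" and b :: "real^'d"
  assumes lin: "linear A" and skew: "A y \<bullet> y = 0"
begin

definition \<phi> :: "real^'d \<Rightarrow> real^'d" where "\<phi> x = b + A x"

lemma phi_polynomial: "real_polynomial_function (\<lambda>x. \<phi> x $ i)"
proof -
  have "bounded_linear (\<lambda>x. A x $ i)"
    using lin by (intro bounded_linear_compose[OF bounded_linear_vec_nth]) (simp add: linear_conv_bounded_linear)
  then show ?thesis
    unfolding \<phi>_def vector_add_component by (intro real_polynomial_function.intros)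
qed

lemma phi_diff: "(\<lambda>x. \<phi> x $ i) differentiable (at x)"
  by (rule real_polynomial_function_partial(2)[OF phi_polynomial])

lemma partial_phi: "partial j (\<lambda>x. \<phi> x $ i) x = A (axis j 1) $ i"
proof -
  have bl: "bounded_linear (\<lambda>x. A x $ i)"
    using lin by (intro bounded_linear_compose[OF bounded_linear_vec_nth]) (simp add: linear_conv_bounded_linear)
  have "partial j (\<lambda>x. b $ i + A x $ i) x = partial j (\<lambda>x. b $ i) x + partial j (\<lambda>x. A x $ i) x"
    by (rule partial_add) (use bl bounded_linear_imp_differentiable in auto)
  then show ?thesis by (simp add: \<phi>_def partial_linear[OF bl])
qed

lemma divh_phi: "divh \<phi> x = 0"
proof -
  have "\<phi> differentiable (at x)" using phi_diff by (simp add: vec_differentiable_iff)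
  then have "divh \<phi> x = (\<Sum>j\<in>UNIV. A (axis j 1) \<bullet> axis j 1)"
    by (simp add: divh_eq partial_phi inner_axis)
  then show ?thesis by (simp add: skew)
qed

lemma linear_expand: "(\<Sum>j\<in>UNIV. y $ j *\<^sub>R A (axis j 1)) = A y"
proof -
  have "A y = A (\<Sum>j\<in>UNIV. y $ j *\<^sub>R axis j 1)"
    using basis_expansion[of y] by (simp add: scalar_mult_eq_scaleR)
  then show ?thesis by (simp add: linear_sum[OF lin] linear_scale[OF lin])
qed

text \<open>The gradient of \<open>\<phi>\<close> contributes \<open>p \<bullet> A p\<close>, which is zero as \<open>A\<close> is skew-symmetric.\<close>

lemma divh_momentum_flux:
  assumes p: "\<And>i. real_polynomial_function (\<lambda>x. p x $ i)" and div0: "divh p x = 0"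
  shows "divh (\<lambda>x. (p x \<bullet> \<phi> x) *\<^sub>R p x) x = conv p p x \<bullet> \<phi> x"
proof -
  have d: "(\<lambda>x. p x $ i) differentiable (at x)" for i
    by (rule real_polynomial_function_partial(2)[OF p])
  have dp: "p differentiable (at x)" using d by (simp add: vec_differentiable_iff)
  have di: "(\<lambda>x. p x \<bullet> \<phi> x) differentiable (at x)"
    by (rule real_polynomial_function_partial(2)[OF real_polynomial_function_inner[OF p phi_polynomial]])
  have "divh (\<lambda>x. (p x \<bullet> \<phi> x) *\<^sub>R p x) x = p x \<bullet> (\<chi> j. partial j (\<lambda>x. p x \<bullet> \<phi> x) x)"
    using divh_scale[OF di d] div0 by simp
  also have "\<dots> = (\<Sum>j\<in>UNIV. p x $ j * (\<Sum>i\<in>UNIV. partial j (\<lambda>x. p x $ i) x * \<phi> x $ i))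
      + (\<Sum>j\<in>UNIV. p x $ j * (\<Sum>i\<in>UNIV. p x $ i * A (axis j 1) $ i))"
    by (subst inner_vec_def) (simp add: partial_inner[OF d phi_diff] partial_phi sum.distrib distrib_left)
  also have "(\<Sum>j\<in>UNIV. p x $ j * (\<Sum>i\<in>UNIV. p x $ i * A (axis j 1) $ i)) = (\<Sum>j\<in>UNIV. p x $ j *\<^sub>R A (axis j 1)) \<bullet> p x"
    unfolding inner_sum_left by (simp add: inner_vec_def sum_distrib_left mult_ac)
  also have "\<dots> = 0" by (simp add: linear_expand skew)
  finally show ?thesis by (simp add: conv_inner[OF dp])
qed

text \<open>The divergence of \<open>\<phi>\<close> is the trace of the skew-symmetric \<open>A\<close>.\<close>

lemma divh_energy_flux:
  assumes p: "\<And>i. real_polynomial_function (\<lambda>x. p x $ i)"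
  shows "divh (\<lambda>x. (p x \<bullet> p x) *\<^sub>R \<phi> x) x = 2 * (conv \<phi> p x \<bullet> p x)"
proof -
  have d: "(\<lambda>x. p x $ i) differentiable (at x)" for i
    by (rule real_polynomial_function_partial(2)[OF p])
  have dp: "p differentiable (at x)" using d by (simp add: vec_differentiable_iff)
  have di: "(\<lambda>x. p x \<bullet> p x) differentiable (at x)"
    by (rule real_polynomial_function_partial(2)[OF real_polynomial_function_inner[OF p p]])
  have "divh (\<lambda>x. (p x \<bullet> p x) *\<^sub>R \<phi> x) x = \<phi> x \<bullet> (\<chi> j. partial j (\<lambda>x. p x \<bullet> p x) x)"
    using divh_scale[OF di phi_diff] divh_phi by simp
  also have "\<dots> = (\<Sum>j\<in>UNIV. \<phi> x $ j * (\<Sum>i\<in>UNIV. 2 * (partial j (\<lambda>x. p x $ i) x * p x $ i)))"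
    by (subst inner_vec_def) (simp add: partial_inner[OF d d] mult.commute)
  also have "\<dots> = 2 * (conv \<phi> p x \<bullet> p x)"
    by (simp add: conv_inner[OF dp] sum_distrib_left mult.left_commute)
  finally show ?thesis .
qed

end

lemma conv_zero: "conv b (\<lambda>x. 0) x = (0 :: real^'d::finite)"
  by (simp add: conv_def vec_eq_iff)

section \<open>Conservation of momentum\<close>

locale mesh_rigid = mesh M \<sigma> + rigid_motion A b
  for M :: "'d::{finite,wellorder} dg_mesh" and \<sigma> and A :: "real^'d::_ \<Rightarrow> real^'d::_" and b
begin

definition at_boundary :: "(real^'d::_) set \<Rightarrow> bool" where
  "at_boundary K \<longleftrightarrow> (\<exists>F\<in>boundary_faces M. KP F = K)"

text \<open>\<open>w\<close> is a discrete velocity that vanishes in all cells with a boundary face, and \<open>v\<close> a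
  conforming test field for the rigid motion \<open>\<phi>\<close>. In each cell \<open>w = 0\<close> or \<open>v = \<phi>\<close>, and this is what
  makes \<open>v\<close> a substitute for \<open>\<phi>\<close> below.\<close>

context
  fixes w v :: "real^'d::_ \<Rightarrow> real^'d::_" and p V :: "(real^'d::_) set \<Rightarrow> real^'d::_ \<Rightarrow> real^'d::_"
  assumes w: "pieces w p" and v: "pieces v V"
    and p: "\<And>K i. K \<in> \<T> \<Longrightarrow> real_polynomial_function (\<lambda>x. p K x $ i)"
    and V: "\<And>K j. K \<in> \<T> \<Longrightarrow> Ck (Suc 0) (\<lambda>x. V K x $ j)"
    and np: "normal_continuous p" and nV: "normal_continuous V"
    and div0: "\<And>K x. K \<in> \<T> \<Longrightarrow> divh (p K) x = 0"
    and p0: "\<And>K. K \<in> \<T> \<Longrightarrow> at_boundary K \<Longrightarrow> p K = (\<lambda>x. 0)"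
    and V\<phi>: "\<And>K. K \<in> \<T> \<Longrightarrow> \<not> at_boundary K \<Longrightarrow> V K = \<phi>"
    and VF: "\<And>F x. F \<in> interior_faces M \<Longrightarrow> x \<in> F \<Longrightarrow> nF F \<bullet> V (KP F) x = nF F \<bullet> \<phi> x"
      "\<And>F x. F \<in> interior_faces M \<Longrightarrow> x \<in> F \<Longrightarrow> nF F \<bullet> V (KM F) x = nF F \<bullet> \<phi> x"
begin

lemma continuous_velocity_piece: "K \<in> \<T> \<Longrightarrow> continuous_on UNIV (p K)"
  by (rule continuous_on_vec) (rule Ck1_continuous[OF Ck_polynomial[OF p]])

lemma continuous_test_piece: "K \<in> \<T> \<Longrightarrow> continuous_on UNIV (V K)"
  by (rule continuous_on_vec) (rule Ck1_continuous[OF V])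

lemma continuous_phi: "continuous_on UNIV \<phi>"
  by (rule continuous_on_vec) (rule Ck1_continuous[OF Ck_polynomial[OF phi_polynomial]])

lemma L2_inner_pieces_0:
  assumes "pieces (\<lambda>x. f x \<bullet> g x) (\<lambda>K x. 0)" shows "L2_inner \<Omega> f g = 0"
  unfolding L2_inner_def using pieces_integral(2)[OF assms] by simp

lemma velocity_divergence_0: "K \<in> \<T> \<Longrightarrow> x \<in> interior K \<Longrightarrow> divh w x = 0"
  using piecesD[OF pieces_divh[OF w]] div0 by simp

lemma test_divergence_or_velocity_0: "K \<in> \<T> \<Longrightarrow> x \<in> interior K \<Longrightarrow> divh v x = 0 \<or> w x = 0"
  using piecesD[OF pieces_divh[OF v]] piecesD[OF w] V\<phi> p0 divh_phi by metis

lemma conv_pieces: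
  assumes "K \<in> \<T>" "x \<in> interior K"
  shows "conv \<beta> w x = conv \<beta> (p K) x"
  by (rule conv_cong_open[OF open_interior assms(2) piecesD[OF w assms(1)] refl])

lemma conv_cong_field: "\<beta> x = \<beta>' x \<Longrightarrow> conv \<beta> f x = conv \<beta>' f x"
  by (simp add: conv_def)

text \<open>The two cells at an interior face see the same normal flux of \<open>w\<close>. So the flux is zero as
  soon as \<open>w\<close> vanishes in one of them, even though the tangential trace from the other cell need not
  vanish.\<close>

lemma interior_face_flux:
  assumes F: "F \<in> interior_faces M" and x: "x \<in> F"
  shows "avg M F w x \<bullet> nF F = nF F \<bullet> p (KP F) x" "nF F \<bullet> p (KM F) x = nF F \<bullet> p (KP F) x"
    and "nF F \<bullet> p (KP F) x = 0 \<or> (V (KP F) = \<phi> \<and> V (KM F) = \<phi>)"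
proof -
  show eq: "nF F \<bullet> p (KM F) x = nF F \<bullet> p (KP F) x" using np F x by (simp add: normal_continuous_def)
  show "avg M F w x \<bullet> nF F = nF F \<bullet> p (KP F) x"
    using jump_pieces(3)[OF w continuous_velocity_piece x F] eq by (simp add: inner_commute[of _ "nF F"] inner_add_right)
  show "nF F \<bullet> p (KP F) x = 0 \<or> (V (KP F) = \<phi> \<and> V (KM F) = \<phi>)"
    using p0[OF KP(1)[OF interior_face_is_face[OF F]]] p0[OF KM(1)[OF F]]
      V\<phi>[OF KP(1)[OF interior_face_is_face[OF F]]] V\<phi>[OF KM(1)[OF F]] eq
    by (metis inner_zero_right)
qed

lemma boundary_face_p0: "F \<in> boundary_faces M \<Longrightarrow> p (KP F) = (\<lambda>x. 0)"
  using p0[OF KP(1)[OF boundary_face_is_face]] by (auto simp: at_boundary_def)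

text \<open>The broken divergence theorem for the momentum flux \<open>(w \<bullet> \<phi>) w\<close>.\<close>

lemma convection_consistent:
  "L2_inner \<Omega> (conv w w) v =
     (\<Sum>F\<in>interior_faces M. face_inner M F (\<lambda>x. (avg M F w x \<bullet> nF F) *\<^sub>R jump M F w x) (avg M F v))"
proof -
  define g where "g K x = (p K x \<bullet> \<phi> x) *\<^sub>R p K x" for K x
  have gC: "Ck (Suc 0) (\<lambda>x. g K x $ j)" if "K \<in> \<T>" for K j
    unfolding g_def vector_scaleR_component real_scaleR_def
    by (intro Ck_polynomial real_polynomial_function.intros(4) real_polynomial_function_inner p[OF that] phi_polynomial)
  have r: "pieces (\<lambda>x. conv w w x \<bullet> v x) (\<lambda>K. divh (g K))"
    unfolding pieces_def
  proof (intro ballI)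
    fix K x assume K: "K \<in> \<T>" and x: "x \<in> interior K"
    have "divh (g K) x = conv (p K) (p K) x \<bullet> \<phi> x"
      unfolding g_def by (rule divh_momentum_flux[OF p[OF K] div0[OF K]])
    moreover have "conv w w x = conv (p K) (p K) x"
      using conv_pieces[OF K x] conv_cong_field piecesD[OF w K x] by metis
    moreover have "conv (p K) (p K) x \<bullet> V K x = conv (p K) (p K) x \<bullet> \<phi> x"
      using p0[OF K] V\<phi>[OF K] by (cases "at_boundary K") (auto simp: conv_zero)
    ultimately show "conv w w x \<bullet> v x = divh (g K) x" using piecesD[OF v K x] by simp
  qed
  have "L2_inner \<Omega> (conv w w) v = (\<Sum>K\<in>\<T>. LINT x:K|lebesgue. divh (g K) x)"
    unfolding L2_inner_def by (rule pieces_integral(2)[OF r continuous_on_divh[OF gC]])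
  also have "\<dots> = (\<Sum>F\<in>interior_faces M. face_integral (nF F) F (\<lambda>x. nF F \<bullet> (g (KP F) x - g (KM F) x)))
    + (\<Sum>F\<in>boundary_faces M. face_integral (nF F) F (\<lambda>x. nF F \<bullet> g (KP F) x))"
    by (rule broken_divergence_theorem[OF gC])
  also have "(\<Sum>F\<in>boundary_faces M. face_integral (nF F) F (\<lambda>x. nF F \<bullet> g (KP F) x)) = 0"
    by (intro sum.neutral ballI face_integral_0 flat_face_nF boundary_face_is_face)
      (simp_all add: g_def boundary_face_p0)
  also have "(\<Sum>F\<in>interior_faces M. face_integral (nF F) F (\<lambda>x. nF F \<bullet> (g (KP F) x - g (KM F) x)))
     = (\<Sum>F\<in>interior_faces M. face_inner M F (\<lambda>x. (avg M F w x \<bullet> nF F) *\<^sub>R jump M F w x) (avg M F v))"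
    unfolding face_inner_def
  proof (rule sum.cong[OF refl], rule face_integral_cong)
    fix F assume F: "F \<in> interior_faces M"
    show "flat_face (nF F) F" by (rule flat_face_nF[OF interior_face_is_face[OF F]])
    fix x assume x: "x \<in> F"
    define m where "m = nF F \<bullet> p (KP F) x"
    have "nF F \<bullet> (g (KP F) x - g (KM F) x) = m * ((p (KP F) x - p (KM F) x) \<bullet> \<phi> x)"
      using interior_face_flux(2)[OF F x] by (simp add: g_def m_def inner_diff_right inner_diff_left algebra_simps)
    also have "\<dots> = m * (jump M F w x \<bullet> avg M F v x)"
    proof (cases "m = 0")
      case False
      then have "V (KP F) = \<phi>" "V (KM F) = \<phi>" using interior_face_flux(3)[OF F x] by (auto simp: m_def)
      then have "avg M F v x = \<phi> x" using jump_pieces(3)[OF v continuous_test_piece x F] by (simp flip: scaleR_2)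
      then show ?thesis using jump_pieces(1)[OF w continuous_velocity_piece x F] by simp
    qed simp
    also have "\<dots> = ((avg M F w x \<bullet> nF F) *\<^sub>R jump M F w x) \<bullet> avg M F v x"
      using interior_face_flux(1)[OF F x] by (simp add: m_def)
    finally show "nF F \<bullet> (g (KP F) x - g (KM F) x) = ((avg M F w x \<bullet> nF F) *\<^sub>R jump M F w x) \<bullet> avg M F v x" .
  qed
  finally show ?thesis by simp
qed

text \<open>The broken divergence theorem for the energy flux \<open>\<bar>w\<bar>\<^sup>2 \<phi>\<close>. The factor two is the one in
  \<open>\<bar>w\<^sup>+\<bar>\<^sup>2 - \<bar>w\<^sup>-\<bar>\<^sup>2 = 2 (w\<^sup>+ - w\<^sup>-) \<bullet> (w\<^sup>+ + w\<^sup>-) / 2\<close>.\<close>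

lemma transport_consistent:
  "L2_inner \<Omega> (conv v w) w =
     (\<Sum>F\<in>interior_faces M. face_inner M F (\<lambda>x. (avg M F v x \<bullet> nF F) *\<^sub>R jump M F w x) (avg M F w))"
proof -
  define g where "g K x = (p K x \<bullet> p K x) *\<^sub>R \<phi> x" for K x
  have gC: "Ck (Suc 0) (\<lambda>x. g K x $ j)" if "K \<in> \<T>" for K j
    unfolding g_def vector_scaleR_component real_scaleR_def
    by (intro Ck_polynomial real_polynomial_function.intros(4) real_polynomial_function_inner p[OF that] phi_polynomial)
  have r: "pieces (\<lambda>x. 2 * (conv v w x \<bullet> w x)) (\<lambda>K. divh (g K))"
    unfolding pieces_def
  proof (intro ballI)
    fix K x assume K: "K \<in> \<T>" and x: "x \<in> interior K"
    have "divh (g K) x = 2 * (conv \<phi> (p K) x \<bullet> p K x)"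
      unfolding g_def by (rule divh_energy_flux[OF p[OF K]])
    moreover have "conv v w x = conv (V K) (p K) x"
      using conv_pieces[OF K x] conv_cong_field piecesD[OF v K x] by metis
    moreover have "conv (V K) (p K) x \<bullet> p K x = conv \<phi> (p K) x \<bullet> p K x"
      using p0[OF K] V\<phi>[OF K] by (cases "at_boundary K") auto
    ultimately show "2 * (conv v w x \<bullet> w x) = divh (g K) x" using piecesD[OF w K x] by simp
  qed
  have "2 * L2_inner \<Omega> (conv v w) w = (LINT x:\<Omega>|lebesgue. 2 * (conv v w x \<bullet> w x))"
    by (simp add: L2_inner_def)
  also have "\<dots> = (\<Sum>K\<in>\<T>. LINT x:K|lebesgue. divh (g K) x)"
    by (rule pieces_integral(2)[OF r continuous_on_divh[OF gC]])
  also have "\<dots> = (\<Sum>F\<in>interior_faces M. face_integral (nF F) F (\<lambda>x. nF F \<bullet> (g (KP F) x - g (KM F) x)))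
    + (\<Sum>F\<in>boundary_faces M. face_integral (nF F) F (\<lambda>x. nF F \<bullet> g (KP F) x))"
    by (rule broken_divergence_theorem[OF gC])
  also have "(\<Sum>F\<in>boundary_faces M. face_integral (nF F) F (\<lambda>x. nF F \<bullet> g (KP F) x)) = 0"
    by (intro sum.neutral ballI face_integral_0 flat_face_nF boundary_face_is_face)
      (simp_all add: g_def boundary_face_p0)
  also have "(\<Sum>F\<in>interior_faces M. face_integral (nF F) F (\<lambda>x. nF F \<bullet> (g (KP F) x - g (KM F) x)))
     = (\<Sum>F\<in>interior_faces M. 2 * face_inner M F (\<lambda>x. (avg M F v x \<bullet> nF F) *\<^sub>R jump M F w x) (avg M F w))"
  proof (rule sum.cong[OF refl])
    fix F assume F: "F \<in> interior_faces M"
    note Ff = interior_face_is_face[OF F]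
    note fl = flat_face_nF[OF Ff]
    define h where "h x = (nF F \<bullet> \<phi> x) * ((1/2) * ((p (KP F) x - p (KM F) x) \<bullet> (p (KP F) x + p (KM F) x)))" for x
    have hc: "continuous_on UNIV h"
      unfolding h_def using continuous_velocity_piece[OF KP(1)[OF Ff]] continuous_velocity_piece[OF KM(1)[OF F]] continuous_phi by (intro continuous_intros)
    have "nF F \<bullet> (g (KP F) x - g (KM F) x) = 2 * h x" for x
      by (simp add: g_def h_def inner_add_right inner_diff_right inner_diff_left inner_commute algebra_simps)
    then have "face_integral (nF F) F (\<lambda>x. nF F \<bullet> (g (KP F) x - g (KM F) x)) = face_integral (nF F) F (\<lambda>x. 2 * h x)"
      by simp
    also have "\<dots> = 2 * face_integral (nF F) F h"
      by (rule face_integral_add(3)[OF fl hc hc])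
    also have "face_integral (nF F) F h = face_inner M F (\<lambda>x. (avg M F v x \<bullet> nF F) *\<^sub>R jump M F w x) (avg M F w)"
      unfolding face_inner_def
    proof (rule face_integral_cong[OF fl])
      fix x assume x: "x \<in> F"
      have "avg M F v x \<bullet> nF F = nF F \<bullet> \<phi> x"
        using jump_pieces(3)[OF v continuous_test_piece x F] VF[OF F x] by (simp add: inner_commute[of _ "nF F"] inner_add_right)
      then show "h x = ((avg M F v x \<bullet> nF F) *\<^sub>R jump M F w x) \<bullet> avg M F w x"
        using jump_pieces(1)[OF w continuous_velocity_piece x F] jump_pieces(3)[OF w continuous_velocity_piece x F] by (simp add: h_def)
    qed
    finally show "face_integral (nF F) F (\<lambda>x. nF F \<bullet> (g (KP F) x - g (KM F) x))
       = 2 * face_inner M F (\<lambda>x. (avg M F v x \<bullet> nF F) *\<^sub>R jump M F w x) (avg M F w)" .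
  qed
  finally show ?thesis by (simp flip: sum_distrib_left)
qed

lemma normal_jump_terms_0:
  "F \<in> faces M \<Longrightarrow> face_inner M F (\<lambda>x. jump M F w x \<bullet> nF F) r = 0"
  "F \<in> faces M \<Longrightarrow> face_inner M F (\<lambda>x. jump M F v x \<bullet> nF F) r = 0"
  by (rule face_inner_0; simp add: normal_jump_zero[OF w continuous_velocity_piece np] normal_jump_zero[OF v continuous_test_piece nV])+

text \<open>At a face where \<open>v\<close> jumps, one adjacent cell has a boundary face, and there the flux of \<open>w\<close>
  vanishes.\<close>

lemma stabilization_0:
  assumes F: "F \<in> faces M"
  shows "face_inner M F (\<lambda>x. (\<zeta> F * \<bar>avg M F w x \<bullet> nF F\<bar>) *\<^sub>R jump M F w x) (jump M F v) = 0"
proof (rule face_inner_0[OF F])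
  fix x assume x: "x \<in> F"
  have "avg M F w x \<bullet> nF F = 0 \<or> jump M F v x = 0"
  proof (cases "F \<in> interior_faces M")
    case True
    then show ?thesis using interior_face_flux[OF True x] jump_pieces(1)[OF v continuous_test_piece x True] by auto
  next
    case False
    then have "F \<in> boundary_faces M" using F by (simp add: boundary_faces_def)
    then show ?thesis using jump_pieces(4)[OF w continuous_velocity_piece x] boundary_face_p0 by simp
  qed
  then show "((\<zeta> F * \<bar>avg M F w x \<bullet> nF F\<bar>) *\<^sub>R jump M F w x) \<bullet> jump M F v x = 0" by auto
qed

lemma volume_terms_0:
  "L2_inner \<Omega> (\<lambda>x. divh w x *\<^sub>R w x) v = 0"
  "L2_inner \<Omega> (\<lambda>x. divh v x *\<^sub>R w x) w = 0"
  "L2_inner \<Omega> (divh w) (divh v) = 0"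
proof -
  show "L2_inner \<Omega> (\<lambda>x. divh w x *\<^sub>R w x) v = 0" "L2_inner \<Omega> (divh w) (divh v) = 0"
    by (rule L2_inner_pieces_0; simp add: pieces_def velocity_divergence_0)+
  show "L2_inner \<Omega> (\<lambda>x. divh v x *\<^sub>R w x) w = 0"
    by (rule L2_inner_pieces_0) (use test_divergence_or_velocity_0 in \<open>force simp: pieces_def\<close>)
qed

lemma convective_forms_0: "c \<in> {ch1 M \<theta> \<zeta>, ch2 M \<theta> \<zeta>} \<Longrightarrow> c w v = 0"
  using normal_jump_terms_0 stabilization_0 interior_face_is_face
  by (auto simp: ch1_def ch2_def volume_terms_0 convection_consistent transport_consistent)

lemma dh_0: "dh M \<gamma> w v = 0"
  by (simp add: dh_def volume_terms_0 normal_jump_terms_0)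

lemma bh_0:
  assumes P: "pieces P pP" and pP0: "\<And>K. K \<in> \<T> \<Longrightarrow> at_boundary K \<Longrightarrow> pP K = (\<lambda>x. 0)"
  shows "bh M v P = 0"
proof -
  have "L2_inner \<Omega> (divh v) P = 0"
  proof (rule L2_inner_pieces_0, unfold pieces_def, intro ballI)
  fix K x assume K: "K \<in> \<T>" and x: "x \<in> interior K"
  show "divh v x \<bullet> P x = 0"
    using piecesD[OF pieces_divh[OF v] K x] piecesD[OF P K x] V\<phi>[OF K] pP0[OF K] divh_phi
    by (cases "at_boundary K") auto
  qed
  then show ?thesis using bh_normal_continuous[OF v continuous_test_piece nV, of P] by simp
qed

end

lemma Vdiv_pieces:
  assumes "u \<in> Vdiv M elt k"
  obtains p where "pieces u p" "\<And>K. K \<in> \<T> \<Longrightarrow> p K \<in> local_space elt k"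
proof -
  have "\<forall>K\<in>\<T>. \<exists>w\<in>local_space elt k. \<forall>x\<in>interior K. u x = w x" using assms by (simp add: Vdiv_def)
  then obtain p where "\<forall>K\<in>\<T>. p K \<in> local_space elt k \<and> (\<forall>x\<in>interior K. u x = p K x)" by metis
  then show ?thesis using that[of p] by (auto simp: pieces_def)
qed

lemma vanishing_vector:
  assumes "inner_neighborhood \<Omega> \<Omega>b" "vanishes_in \<Omega>b u" "pieces u p"
    "\<And>K. K \<in> \<T> \<Longrightarrow> p K \<in> local_space elt k" "K \<in> \<T>" "at_boundary K"
  shows "p K = (\<lambda>x. 0)"
proof -
  obtain F where F: "F \<in> boundary_faces M" "KP F = K" using assms(6) by (auto simp: at_boundary_def)
  have "p K x $ i = 0" for x i
  proof (rule vanishing_near_boundary[OF assms(1) _ F(1), where f = "\<lambda>x. u x $ i" and p = "\<lambda>x. p K x $ i"])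
    show "vanishes_in \<Omega>b (\<lambda>x. u x $ i)"
      using assms(2) unfolding vanishes_in_def by eventually_elim auto
    show "real_polynomial_function (\<lambda>x. p K x $ i)" by (rule local_space_polynomial[OF assms(4)[OF assms(5)]])
    show "u x $ i = p K x $ i" if "x \<in> interior (KP F)" for x
      using piecesD[OF assms(3,5)] that F by simp
  qed
  then show ?thesis by (auto simp: vec_eq_iff fun_eq_iff)
qed

text \<open>In the momentum equation tested with \<open>v\<close>, all terms but the time difference vanish. In the
  time difference \<open>v\<close> may be replaced by \<open>\<phi>\<close>, as \<open>u0\<close> and \<open>u1\<close> are zero wherever the two differ.\<close>

theorem momentum_step:
  assumes k: "elt = RT \<Longrightarrow> k \<ge> 1"
    and u0: "u0 \<in> Vdiv M elt k" and u1: "u1 \<in> Vdiv M elt k" and P: "P \<in> Qh M k"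
    and N: "inner_neighborhood \<Omega> \<Omega>b" "vanishes_in \<Omega>b u0" "vanishes_in \<Omega>b u1" "vanishes_in \<Omega>b P"
    and c: "c \<in> {ch1 M \<theta> \<zeta>, ch2 M \<theta> \<zeta>}" and \<tau>: "\<tau> \<noteq> 0"
    and w: "w = (\<lambda>x. (1/2) *\<^sub>R (u1 x + u0 x))"
    and eq: "\<And>v. v \<in> Vdiv M elt k \<Longrightarrow>
        L2_inner \<Omega> (\<lambda>x. (1 / \<tau>) *\<^sub>R (u1 x - u0 x)) v + c w v - bh M v P + dh M \<gamma> w v = 0"
    and b0: "\<And>q. q \<in> Qh M k \<Longrightarrow> bh M w q = 0"
  shows "(LINT x:\<Omega>|lebesgue. u1 x \<bullet> \<phi> x) = (LINT x:\<Omega>|lebesgue. u0 x \<bullet> \<phi> x)"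
proof -
  obtain p0 where p0: "pieces u0 p0" "\<And>K. K \<in> \<T> \<Longrightarrow> p0 K \<in> local_space elt k"
    using Vdiv_pieces[OF u0] by blast
  obtain p1 where p1: "pieces u1 p1" "\<And>K. K \<in> \<T> \<Longrightarrow> p1 K \<in> local_space elt k"
    using Vdiv_pieces[OF u1] by blast
  have "\<forall>K\<in>\<T>. \<exists>q\<in>polys k. \<forall>x\<in>interior K. P x = q x" using P by (simp add: Qh_def)
  then obtain pP where "\<forall>K\<in>\<T>. pP K \<in> polys k \<and> (\<forall>x\<in>interior K. P x = pP K x)" by metis
  then have pP: "pieces P pP" "\<And>K. K \<in> \<T> \<Longrightarrow> pP K \<in> polys k" by (auto simp: pieces_def)
  have z0: "p0 K = (\<lambda>x. 0)" and z1: "p1 K = (\<lambda>x. 0)" if "K \<in> \<T>" "at_boundary K" for K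
    using vanishing_vector[OF N(1,2) p0 that] vanishing_vector[OF N(1,3) p1 that] by auto
  have zP: "pP K = (\<lambda>x. 0)" if K: "K \<in> \<T>" "at_boundary K" for K
  proof -
    obtain F where F: "F \<in> boundary_faces M" "KP F = K" using K(2) by (auto simp: at_boundary_def)
    have "pP K x = 0" for x
      by (rule vanishing_near_boundary[OF N(1,4) F(1)])
        (use piecesD[OF pP(1) K(1)] F polys_polynomial[OF pP(2)[OF K(1)]] in auto)
    then show ?thesis by auto
  qed
  define p where "p K x = (1/2) *\<^sub>R p1 K x + (1/2) *\<^sub>R p0 K x" for K x
  have wr: "pieces w p" using p0(1) p1(1) by (auto simp: pieces_def w p_def scaleR_add_right)
  have pl: "p K \<in> local_space elt k" if "K \<in> \<T>" for K
    unfolding p_def[abs_def] by (rule local_space_lincomb[OF p1(2)[OF that] p0(2)[OF that]])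
  have pz: "p K = (\<lambda>x. 0)" if "K \<in> \<T>" "at_boundary K" for K
    using z0[OF that] z1[OF that] by (simp add: p_def fun_eq_iff)
  have nc: "normal_continuous p"
    using normal_continuous_Vdiv[OF u0 p0] normal_continuous_Vdiv[OF u1 p1]
    by (simp add: normal_continuous_def p_def inner_add_right)
  have pd: "divh (p K) x = 0" if "K \<in> \<T>" for K x
    by (rule pointwise_divergence_free[OF wr pl nc b0 that])
  obtain v V where v: "v \<in> Vdiv M elt k" "pieces v V" "normal_continuous V"
    and V: "\<And>K. K \<in> \<T> \<Longrightarrow> \<forall>F\<in>boundary_faces M. KP F \<noteq> K \<Longrightarrow> V K = (\<lambda>x. b + A x)"
    "\<And>K j. K \<in> \<T> \<Longrightarrow> Ck (Suc 0) (\<lambda>x. V K x $ j)"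
    "\<And>F x. F \<in> interior_faces M \<Longrightarrow> x \<in> F \<Longrightarrow> nF F \<bullet> V (KP F) x = nF F \<bullet> (b + A x)"
    "\<And>F x. F \<in> interior_faces M \<Longrightarrow> x \<in> F \<Longrightarrow> nF F \<bullet> V (KM F) x = nF F \<bullet> (b + A x)"
  proof (rule conforming_test_field[where elt = elt and b = b, OF k lin], goal_cases)
    case (2 v V)
    show ?case by (rule that[of v V]) (fact 2)+
  qed assumption
  have V\<phi>: "V K = \<phi>" if "K \<in> \<T>" "\<not> at_boundary K" for K
    using V(1)[OF that(1)] that(2) by (auto simp: at_boundary_def \<phi>_def)
  have VF: "nF F \<bullet> V (KP F) x = nF F \<bullet> \<phi> x" "nF F \<bullet> V (KM F) x = nF F \<bullet> \<phi> x"
    if "F \<in> interior_faces M" "x \<in> F" for F x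
    using V(3,4)[OF that] by (auto simp: \<phi>_def)
  note ctx = wr v(2) local_space_polynomial[OF pl] V(2) nc v(3) pd pz V\<phi> VF
  have "c w v = 0" by (rule convective_forms_0[OF ctx c])
  moreover have "dh M \<gamma> w v = 0" by (rule dh_0[OF ctx])
  moreover have "bh M v P = 0" by (rule bh_0[OF ctx pP(1) zP])
  ultimately have 0: "L2_inner \<Omega> (\<lambda>x. (1 / \<tau>) *\<^sub>R (u1 x - u0 x)) v = 0"
    using eq[OF v(1)] by simp
  have c0: "continuous_on UNIV (p0 K)" and c1: "continuous_on UNIV (p1 K)" if "K \<in> \<T>" for K
    using continuous_on_vec Ck1_continuous[OF Ck_polynomial[OF local_space_polynomial[OF p0(2)[OF that]]]]
      Ck1_continuous[OF Ck_polynomial[OF local_space_polynomial[OF p1(2)[OF that]]]] by blast+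
  have \<phi>c: "continuous_on UNIV \<phi>"
    by (rule continuous_on_vec) (rule Ck1_continuous[OF Ck_polynomial[OF phi_polynomial]])
  have r0: "pieces (\<lambda>x. u0 x \<bullet> \<phi> x) (\<lambda>K x. p0 K x \<bullet> \<phi> x)" and r1: "pieces (\<lambda>x. u1 x \<bullet> \<phi> x) (\<lambda>K x. p1 K x \<bullet> \<phi> x)"
    using p0(1) p1(1) by (auto simp: pieces_def)
  have i: "set_integrable lebesgue \<Omega> (\<lambda>x. u1 x \<bullet> \<phi> x)" "set_integrable lebesgue \<Omega> (\<lambda>x. u0 x \<bullet> \<phi> x)"
    by (rule pieces_integral(1)[OF r1] pieces_integral(1)[OF r0]; intro continuous_on_inner c0 c1 \<phi>c; assumption)+
  have "pieces (\<lambda>x. ((1 / \<tau>) *\<^sub>R (u1 x - u0 x)) \<bullet> v x) (\<lambda>K x. (1 / \<tau>) * (p1 K x \<bullet> \<phi> x - p0 K x \<bullet> \<phi> x))"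
    unfolding pieces_def
  proof (intro ballI)
    fix K x assume K: "K \<in> \<T>" and x: "x \<in> interior K"
    show "((1 / \<tau>) *\<^sub>R (u1 x - u0 x)) \<bullet> v x = (1 / \<tau>) * (p1 K x \<bullet> \<phi> x - p0 K x \<bullet> \<phi> x)"
      using piecesD[OF p0(1) K x] piecesD[OF p1(1) K x] piecesD[OF v(2) K x] z0[OF K] z1[OF K] V\<phi>[OF K]
      by (cases "at_boundary K") (auto simp: inner_diff_left)
  qed
  then have "L2_inner \<Omega> (\<lambda>x. (1 / \<tau>) *\<^sub>R (u1 x - u0 x)) v
      = (\<Sum>K\<in>\<T>. LINT x:K|lebesgue. (1 / \<tau>) * (p1 K x \<bullet> \<phi> x - p0 K x \<bullet> \<phi> x))"
    unfolding L2_inner_def by (rule pieces_integral(2)) (intro continuous_intros c0 c1 \<phi>c; assumption)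
  also have "\<dots> = (LINT x:\<Omega>|lebesgue. (1 / \<tau>) * (u1 x \<bullet> \<phi> x - u0 x \<bullet> \<phi> x))"
  proof (rule pieces_integral(2)[symmetric])
    show "pieces (\<lambda>x. (1 / \<tau>) * (u1 x \<bullet> \<phi> x - u0 x \<bullet> \<phi> x)) (\<lambda>K x. (1 / \<tau>) * (p1 K x \<bullet> \<phi> x - p0 K x \<bullet> \<phi> x))"
      using r0 r1 by (simp add: pieces_def)
  qed (intro continuous_intros c0 c1 \<phi>c; assumption)
  also have "\<dots> = (1 / \<tau>) * ((LINT x:\<Omega>|lebesgue. u1 x \<bullet> \<phi> x) - (LINT x:\<Omega>|lebesgue. u0 x \<bullet> \<phi> x))"
    using set_integral_diff(2)[OF i] by simp
  finally show ?thesis using 0 \<tau> by simp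
qed

end

theorem momentum_conserved:
  fixes M :: "'d::{finite,wellorder} dg_mesh"
  assumes k: "elt = RT \<Longrightarrow> k \<ge> 1" and t: "\<forall>n<N. t n < t (Suc n)"
    and M: "valid_mesh \<sigma> M" and c: "c \<in> {ch1 M \<theta> \<zeta>, ch2 M \<theta> \<zeta>}"
    and S: "solves_scheme M elt k \<gamma> c t N u P"
    and N: "inner_neighborhood (region M) \<Omega>b"
      "\<forall>n\<le>N. vanishes_in \<Omega>b (u n)" "\<forall>n<N. vanishes_in \<Omega>b (P n)" and n: "n < N"
    and A: "linear A" "\<And>y. A y \<bullet> y = 0"
  shows "(LINT x:region M|lebesgue. u (Suc n) x \<bullet> (b + A x)) = (LINT x:region M|lebesgue. u n x \<bullet> (b + A x))"
proof -
  interpret mesh_rigid M \<sigma> A b by (intro mesh_rigid.intro mesh.intro rigid_motion.intro) (use M A in auto)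
  have "(LINT x:region M|lebesgue. u (Suc n) x \<bullet> \<phi> x) = (LINT x:region M|lebesgue. u n x \<bullet> \<phi> x)"
  proof (rule momentum_step[OF k _ _ _ N(1) _ _ _ c, where \<tau> = "t (Suc n) - t n" and P = "P n" and w = "midpoint_step u n"])
    show "midpoint_step u n = (\<lambda>x. (1 / 2) *\<^sub>R (u (Suc n) x + u n x))"
      by (simp add: midpoint_step_def fun_eq_iff)
    show "t (Suc n) - t n \<noteq> 0" using t n by auto
  qed (use S N n in \<open>auto simp: solves_scheme_def\<close>)
  then show ?thesis by (simp add: \<phi>_def)
qed

theorem theorem4:
  fixes elt :: hdiv_element and k N :: nat and \<theta> \<gamma> T :: real and t :: "nat \<Rightarrow> real"
  assumes "elt = RT \<Longrightarrow> k \<ge> 1"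
    and "\<theta> \<in> {0, 1, -1}" and "\<gamma> \<ge> 0"
    and "t 0 = 0" and "t N = T" and "\<forall>n<N. t n < t (Suc n)"
  shows
    "(\<forall>(M :: 2 dg_mesh) \<sigma> \<zeta> c u P \<Omega>b.
        valid_mesh \<sigma> M \<and> (\<forall>F\<in>faces M. \<zeta> F \<ge> 0) \<and> c \<in> {ch1 M \<theta> \<zeta>, ch2 M \<theta> \<zeta>} \<and>
        solves_scheme M elt k \<gamma> c t N u P \<and>
        inner_neighborhood (region M) \<Omega>b \<and>
        (\<forall>n\<le>N. vanishes_in \<Omega>b (u n)) \<and> (\<forall>n<N. vanishes_in \<Omega>b (P n)) \<longrightarrow>
        (\<forall>n<N.
           (\<forall>i. (LINT x:region M|lebesgue. u (Suc n) x \<bullet> axis i 1)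
              = (LINT x:region M|lebesgue. u n x \<bullet> axis i 1)) \<and>
           (LINT x:region M|lebesgue. u (Suc n) x \<bullet> vector [x $ 2, - (x $ 1)])
              = (LINT x:region M|lebesgue. u n x \<bullet> vector [x $ 2, - (x $ 1)])))
     \<and>
     (\<forall>(M :: 3 dg_mesh) \<sigma> \<zeta> c u P \<Omega>b.
        valid_mesh \<sigma> M \<and> (\<forall>F\<in>faces M. \<zeta> F \<ge> 0) \<and> c \<in> {ch1 M \<theta> \<zeta>, ch2 M \<theta> \<zeta>} \<and>
        solves_scheme M elt k \<gamma> c t N u P \<and>
        inner_neighborhood (region M) \<Omega>b \<and>
        (\<forall>n\<le>N. vanishes_in \<Omega>b (u n)) \<and> (\<forall>n<N. vanishes_in \<Omega>b (P n)) \<longrightarrow>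
        (\<forall>n<N.
           (\<forall>i. (LINT x:region M|lebesgue. u (Suc n) x \<bullet> axis i 1)
              = (LINT x:region M|lebesgue. u n x \<bullet> axis i 1)) \<and>
           (\<forall>i. (LINT x:region M|lebesgue. u (Suc n) x \<bullet> cross3 x (axis i 1))
              = (LINT x:region M|lebesgue. u n x \<bullet> cross3 x (axis i 1)))))"
proof (intro conjI allI impI; elim conjE)
  fix M :: "2 dg_mesh" and \<sigma> \<zeta> c u P \<Omega>b n i
  assume "valid_mesh \<sigma> M" "c \<in> {ch1 M \<theta> \<zeta>, ch2 M \<theta> \<zeta>}" "solves_scheme M elt k \<gamma> c t N u P"
    "inner_neighborhood (region M) \<Omega>b" "\<forall>n\<le>N. vanishes_in \<Omega>b (u n)" "\<forall>n<N. vanishes_in \<Omega>b (P n)" "n < N"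
  note conserved = momentum_conserved[OF assms(1) assms(6) this]
  show "(LINT x:region M|lebesgue. u (Suc n) x \<bullet> axis i 1) = (LINT x:region M|lebesgue. u n x \<bullet> axis i 1)"
    using conserved[of "\<lambda>x. 0" "axis i 1"] by (simp add: linear_zero)
  have "linear (\<lambda>x::real^2. vector [x $ 2, - (x $ 1)] :: real^2)"
    by (rule linearI) (auto simp: vec_eq_iff forall_2)
  moreover have "vector [y $ 2, - (y $ 1)] \<bullet> y = 0" for y :: "real^2"
    by (simp add: inner_vec_def sum_2)
  ultimately show "(LINT x:region M|lebesgue. u (Suc n) x \<bullet> vector [x $ 2, - (x $ 1)])
              = (LINT x:region M|lebesgue. u n x \<bullet> vector [x $ 2, - (x $ 1)])"
    using conserved[of "\<lambda>x. vector [x $ 2, - (x $ 1)]" 0] by simp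
next
  fix M :: "3 dg_mesh" and \<sigma> \<zeta> c u P \<Omega>b n i
  assume "valid_mesh \<sigma> M" "c \<in> {ch1 M \<theta> \<zeta>, ch2 M \<theta> \<zeta>}" "solves_scheme M elt k \<gamma> c t N u P"
    "inner_neighborhood (region M) \<Omega>b" "\<forall>n\<le>N. vanishes_in \<Omega>b (u n)" "\<forall>n<N. vanishes_in \<Omega>b (P n)" "n < N"
  note conserved = momentum_conserved[OF assms(1) assms(6) this]
  show "(LINT x:region M|lebesgue. u (Suc n) x \<bullet> axis i 1) = (LINT x:region M|lebesgue. u n x \<bullet> axis i 1)"
    using conserved[of "\<lambda>x. 0" "axis i 1"] by (simp add: linear_zero)
  have "linear (\<lambda>x. cross3 x (axis i 1))"
    by (rule linearI) (simp_all add: cross_add_left cross_mult_left)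
  then show "(LINT x:region M|lebesgue. u (Suc n) x \<bullet> cross3 x (axis i 1))
              = (LINT x:region M|lebesgue. u n x \<bullet> cross3 x (axis i 1))"
    using conserved[of "\<lambda>x. cross3 x (axis i 1)" 0] by (simp add: dot_cross_self)
qed

end
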